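(* Let $H\in(\frac12,1)$, $\theta,\rho>0$, $\theta\neq\rho$, let $X$ solve $X_0=0$, $dX_t=-\theta X_t\,dt+dV_t$, where $V_0=0$, $dV_t=-\rho V_t\,dt+dB^H_t$, $B^H$ a fractional Brownian motion of Hurst index $H$. Let $\Delta_n>0$, $t_i=i\Delta_n$, $T_n=n\Delta_n\to\infty$, and assume $\Delta_n\le n^\alpha$ for some $\alpha\in(-\infty,1/H)$. Let $(\underline\theta_n,\underline\rho_n)\in(0,\infty)^2$ be the solution of $$\overline F(\underline\theta_n,\underline\rho_n)=\big(Q_n(X),Q_n(V)\big),$$ with $\overline F$ and $Q_n$ as defined in the context. Then, as $n\to\infty$, $(\underline\theta_n,\underline\rho_n)\to(\theta,\rho)$ almost surely.
   Context: $B^H$ is a centered Gaussian process with $E(B^H_tB^H_s)=\frac12(t^{2H}+s^{2H}-|t-s|^{2H})$. For a process $Z$, $Q_n(Z)=\frac1n\sum_{i=1}^n(Z_{t_{i-1}})^2$. For $(x,y)\in(0,\infty)^2$, $$\overline F(x,y)=H\Gamma(2H)\times\begin{cases}\Big(\frac{y^{2-2H}-x^{2-2H}}{y^2-x^2},\,y^{-2H}\Big)&x\neq y,\\ \big((1-H)x^{-2H},\,x^{-2H}\big)&x=y,\end{cases}$$ which is injective. Equivalently, $\underline\rho_n=\big(\frac{H\Gamma(2H)}{Q_n(V)}\big)^{1/(2H)}$ and $\underline\theta_n+\underline\rho_n=\frac{H\Gamma(2H)[(\underline\rho_n)^{2-2H}-(\underline\theta_n)^{2-2H}]}{(\underline\rho_n-\underline\theta_n)Q_n(X)}$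 (the quotient being extended by continuity when $\underline\theta_n=\underline\rho_n$). If no solution exists for a given $n$ and outcome, the value of $(\underline\theta_n,\underline\rho_n)$ is fixed arbitrarily. *)

theory Defs
  imports "HOL-Probability.Probability"
begin

(* Degenerate (almost surely constant) variables count as Gaussian, as they must for
   linear combinations of the coordinates of a Gaussian process. *)
definition gaussian_rv :: "'a measure \<Rightarrow> ('a \<Rightarrow> real) \<Rightarrow> bool" where
  "gaussian_rv M X \<longleftrightarrow>
     X \<in> borel_measurable M \<and>
     ((\<exists>\<mu> \<sigma>. 0 < \<sigma> \<and> distributed M lborel X (\<lambda>x. ennreal (normal_density \<mu> \<sigma> x)))
      \<or> (\<exists>\<mu>. AE \<omega> in M. X \<omega> = \<mu>))"

(* Processes are indexed by [0, \<infinity>): values at negative times are never constrained. *)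
definition gaussian_process :: "'a measure \<Rightarrow> (real \<Rightarrow> 'a \<Rightarrow> real) \<Rightarrow> bool" where
  "gaussian_process M Z \<longleftrightarrow>
     (\<forall>S c. finite S \<and> S \<subseteq> {0..} \<longrightarrow> gaussian_rv M (\<lambda>\<omega>. \<Sum>t\<in>S. c t * Z t \<omega>))"

definition fractional_brownian_motion :: "'a measure \<Rightarrow> real \<Rightarrow> (real \<Rightarrow> 'a \<Rightarrow> real) \<Rightarrow> bool" where
  "fractional_brownian_motion M H B \<longleftrightarrow>
     gaussian_process M B \<and>
     (\<forall>t\<ge>0. integral\<^sup>L M (B t) = 0) \<and>
     (\<forall>t\<ge>0. \<forall>s\<ge>0. integral\<^sup>L M (\<lambda>\<omega>. B t \<omega> * B s \<omega>)
        = (t powr (2 * H) + s powr (2 * H) - \<bar>t - s\<bar> powr (2 * H)) / 2) \<and>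
     (AE \<omega> in M. continuous_on {0..} (\<lambda>t. B t \<omega>))"

(* Z solves dZ = - a Z dt + dN, Z_0 = 0.  The noise is additive, so the equation is read
   pathwise in integrated form.  Continuity of Z is not imposed: it follows from that of N. *)
definition langevin_solution ::
    "'a measure \<Rightarrow> real \<Rightarrow> (real \<Rightarrow> 'a \<Rightarrow> real) \<Rightarrow> (real \<Rightarrow> 'a \<Rightarrow> real) \<Rightarrow> bool" where
  "langevin_solution M a N Z \<longleftrightarrow>
     (\<forall>t\<ge>0. Z t \<in> borel_measurable M) \<and>
     (AE \<omega> in M. Z 0 \<omega> = 0 \<and>
        (\<forall>t\<ge>0. (\<lambda>s. Z s \<omega>) integrable_on {0..t} \<and>
           Z t \<omega> = - a * integral {0..t} (\<lambda>s. Z s \<omega>) + (N t \<omega> - N 0 \<omega>)))"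

(* The grid is t_i = i d, with step d. *)
definition quad_mean :: "nat \<Rightarrow> real \<Rightarrow> (real \<Rightarrow> 'a \<Rightarrow> real) \<Rightarrow> 'a \<Rightarrow> real" where
  "quad_mean n d Z \<omega> = (1 / real n) * (\<Sum>i=1..n. (Z (real (i - 1) * d) \<omega>)\<^sup>2)"

definition F_bar :: "real \<Rightarrow> real \<times> real \<Rightarrow> real \<times> real" where
  "F_bar H = (\<lambda>(x, y). (H * Gamma (2 * H)) *\<^sub>R
     (if x \<noteq> y
      then ((y powr (2 - 2 * H) - x powr (2 - 2 * H)) / (y\<^sup>2 - x\<^sup>2), y powr (- 2 * H))
      else ((1 - H) * x powr (- 2 * H), x powr (- 2 * H))))"

definition moment_solution :: "real \<Rightarrow> real \<times> real \<Rightarrow> real \<times> real \<Rightarrow> bool" where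
  "moment_solution H q p \<longleftrightarrow> p \<in> {0<..} \<times> {0<..} \<and> F_bar H p = q"

(* No constraint on p when the moment equation has no solution. *)
definition moment_estimate :: "real \<Rightarrow> real \<times> real \<Rightarrow> real \<times> real \<Rightarrow> bool" where
  "moment_estimate H q p \<longleftrightarrow> ((\<exists>p'. moment_solution H q p') \<longrightarrow> moment_solution H q p)"

end

theory Submission
  imports Defs
begin

text \<open>
  Solving the two Langevin equations pathwise gives
  \<open>V\<^sub>t = \<integral> \<rho> e\<^bsup>-\<rho>x\<^esup> (B\<^sub>t - B\<^bsub>(t-x)+\<^esub>) dx\<close> and, by partial fractions, a representation of \<open>X\<close> of the same form
  with kernel \<open>(\<rho>\<^sup>2 e\<^bsup>-\<rho>x\<^esup> - \<theta>\<^sup>2 e\<^bsup>-\<theta>x\<^esup>) / (\<rho> - \<theta>)\<close>. Such a process \<open>W\<close> is Gaussian, its covariance decays like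
  \<open>|t - s|\<^bsup>2H-2\<^esup>\<close>, and its variance converges to an explicit integral, which for the two kernels gives the two
  components of \<open>F\<close>.

  To see that \<open>Q\<^sub>n(W)\<close> converges almost surely for an arbitrary step, note that \<open>T\<^sub>n\<close> may grow arbitrarily
  slowly. When \<open>T\<^sub>n \<ge> \<surd>n\<close>, all moments of \<open>Q\<^sub>n - E Q\<^sub>n\<close> are bounded by powers of \<open>min(n, T\<^sub>n)\<^bsup>2H-2\<^esup>\<close>, so a high moment
  makes Borel--Cantelli work. When \<open>T\<^sub>n < \<surd>n\<close>, the step is so small that, again by a high moment, \<open>Q\<^sub>n\<close> is close to the
  time average over \<open>[0, T\<^sub>n]\<close>; the latter converges along the integers by the first case applied to a fine grid,
  hence everywhere since \<open>T \<mapsto> \<integral>\<^sub>0\<^sup>T W\<^sup>2\<close> is monotone.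

  Finally, the second component of the moment equation determines the estimate of \<open>\<rho>\<close>, and the first component is a
  secant slope of the concave function \<open>u \<mapsto> u\<^bsup>1-H\<^esup>\<close>, strictly decreasing in the estimate of \<open>\<theta>\<close>; the intermediate
  value theorem gives existence and convergence.
\<close>

section \<open>Centred normal laws\<close>

text \<open>No stochastic integral occurs: the equations are integrated path by path, and
  Gaussianity survives because grid approximations are finite combinations of \<open>B\<close>.
  Stopping the lookback time at 0 makes the representation exact from time 0 on, at the price of
  stationarity: the variance is constant only in the limit. The rate comes from row sums of
  covariances. With \<open>\<gamma> = 2 - 2 * H\<close>, \<open>n\<close> points of step
  \<open>d\<close> behave like \<open>min n (n * d)\<close> points of unit step, and their mean has
  a variance of the order of that number to the power \<open>- \<gamma>\<close>. For H near 1 this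
  is far from summable; a moment of order \<open>2 * p\<close> yields its p-th power, and p is
  chosen from \<gamma>. For small steps, the variance \<open>d powr (2 * H)\<close> of an increment
  is used in the same way. The cubic weights on the kernels are the price of extracting the decay in
  the time distance: two powers bound the variance of a Brownian increment, one more pays for
  increments that are not well separated. The two second moments converge separately, each almost
  surely; what follows for the estimates is deterministic.\<close>

text \<open>Stated through characteristic functions so that the degenerate law (variance \<open>0\<close>) is
  included and almost sure limits are immediate.\<close>

definition centred_normal :: "'a measure \<Rightarrow> real \<Rightarrow> ('a \<Rightarrow> real) \<Rightarrow> bool" where
  "centred_normal M v L \<longleftrightarrow> L \<in> borel_measurable M \<and> 0 \<le> v \<and>
     (\<forall>s. char (distr M borel L) s = complex_of_real (exp (- (v * s\<^sup>2) / 2)))"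

definition std_moment :: "nat \<Rightarrow> real" where
  "std_moment m = (LINT x|std_normal_distribution. x ^ m)"

lemma char_distr:
  assumes "L \<in> borel_measurable M"
  shows "char (distr M borel L) s = (CLINT \<omega>|M. iexp (s * L \<omega>))"
  unfolding char_def using assms by (subst integral_distr) auto

lemma centred_normal_measurable [measurable_dest]:
  "centred_normal M v L \<Longrightarrow> L \<in> borel_measurable M"
  by (simp add: centred_normal_def)

lemma char_scaled_std_normal:
  "char (distr std_normal_distribution borel ((*) c)) s = complex_of_real (exp (- (c\<^sup>2 * s\<^sup>2) / 2))"
proof -
  have "char (distr std_normal_distribution borel ((*) c)) s = char std_normal_distribution (s * c)"
    by (subst char_distr) (simp_all add: char_def mult_ac)
  then show ?thesis
    by (simp add: char_std_normal_distribution power_mult_distrib mult_ac)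
qed

text \<open>The characteristic function determines the law, which is therefore the image of the
  standard normal law under scaling by \<open>sqrt v\<close>; for \<open>v = 0\<close> this is the
  point mass at 0. The moment formulas below are read off from this image.\<close>

lemma centred_normal_distr:
  assumes "prob_space M" "centred_normal M v L"
  shows "distr M borel L = distr std_normal_distribution borel ((*) (sqrt v))"
proof (rule Levy_uniqueness)
  interpret prob_space M by fact
  note [measurable] = centred_normal_measurable[OF assms(2)]
  interpret N: real_distribution std_normal_distribution by (rule real_dist_normal_dist)
  show "real_distribution (distr M borel L)" by simp
  show "real_distribution (distr std_normal_distribution borel ((*) (sqrt v)))"
    by (intro N.real_distribution_distr) simp
  show "char (distr M borel L) = char (distr std_normal_distribution borel ((*) (sqrt v)))"
    using assms(2) by (auto simp: fun_eq_iff char_scaled_std_normal centred_normal_def)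
qed

lemma centred_normal_integral:
  fixes f :: "real \<Rightarrow> real"
  assumes "prob_space M" "centred_normal M v L" and [measurable]: "f \<in> borel_measurable borel"
  shows "(LINT \<omega>|M. f (L \<omega>)) = (LINT x|std_normal_distribution. f (sqrt v * x))"
    and "integrable M (\<lambda>\<omega>. f (L \<omega>)) \<longleftrightarrow> integrable std_normal_distribution (\<lambda>x. f (sqrt v * x))"
proof -
  note [measurable] = centred_normal_measurable[OF assms(2)]
  note eq = centred_normal_distr[OF assms(1,2)]
  have "(LINT \<omega>|M. f (L \<omega>)) = integral\<^sup>L (distr M borel L) f"
    by (subst integral_distr) auto
  then show "(LINT \<omega>|M. f (L \<omega>)) = (LINT x|std_normal_distribution. f (sqrt v * x))"
    unfolding eq by (subst (asm) integral_distr) auto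
  have "integrable M (\<lambda>\<omega>. f (L \<omega>)) \<longleftrightarrow> integrable (distr M borel L) f"
    by (subst integrable_distr_eq) auto
  then show "integrable M (\<lambda>\<omega>. f (L \<omega>)) \<longleftrightarrow> integrable std_normal_distribution (\<lambda>x. f (sqrt v * x))"
    unfolding eq by (subst (asm) integrable_distr_eq) auto
qed

lemma centred_normal_moment:
  assumes "prob_space M" "centred_normal M v L"
  shows "integrable M (\<lambda>\<omega>. L \<omega> ^ m)"
    and "(LINT \<omega>|M. L \<omega> ^ m) = sqrt v ^ m * std_moment m"
proof -
  show "integrable M (\<lambda>\<omega>. L \<omega> ^ m)"
    using centred_normal_integral(2)[OF assms, of "\<lambda>x. x ^ m"]
    by (simp add: power_mult_distrib integrable_std_normal_distribution_moment)
  show "(LINT \<omega>|M. L \<omega> ^ m) = sqrt v ^ m * std_moment m"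
    using centred_normal_integral(1)[OF assms, of "\<lambda>x. x ^ m"]
    by (simp add: power_mult_distrib std_moment_def)
qed

lemma std_moment_2 [simp]: "std_moment 2 = 1"
  using std_normal_distribution_even_moments(1)[of 1] by (simp add: std_moment_def fact_numeral)

lemma std_moment_even_nonneg: "0 \<le> std_moment (2 * p)"
  unfolding std_moment_def by (intro integral_nonneg_AE) auto

lemma centred_normal_variance:
  assumes "prob_space M" "centred_normal M v L"
  shows "(LINT \<omega>|M. (L \<omega>)\<^sup>2) = v"
  using centred_normal_moment(2)[OF assms, of 2] assms(2) by (simp add: centred_normal_def)

lemma centred_normal_even_moment:
  assumes "prob_space M" "centred_normal M v L"
  shows "(LINT \<omega>|M. L \<omega> ^ (2 * p)) = v ^ p * std_moment (2 * p)"
  using centred_normal_moment(2)[OF assms, of "2 * p"] assms(2)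
  by (simp add: centred_normal_def power_mult)

lemma gaussian_rv_centred_normal:
  assumes "prob_space M" "gaussian_rv M L" "(LINT \<omega>|M. L \<omega>) = 0" "(LINT \<omega>|M. (L \<omega>)\<^sup>2) = v"
  shows "centred_normal M v L"
proof -
  interpret prob_space M by fact
  have [measurable]: "L \<in> borel_measurable M" using assms(2) by (simp add: gaussian_rv_def)
  consider (pos) \<mu> \<sigma> where "0 < \<sigma>" "distributed M lborel L (\<lambda>x. ennreal (normal_density \<mu> \<sigma> x))"
    | (const) \<mu> where "AE \<omega> in M. L \<omega> = \<mu>"
    using assms(2) by (auto simp: gaussian_rv_def)
  then show ?thesis
  proof cases
    case pos
    have \<mu>: "\<mu> = 0" using normal_distributed_expectation[OF pos] assms(3) by simp
    have v: "v = \<sigma>\<^sup>2" using normal_distributed_variance[OF pos] assms(3,4) \<mu> by simp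
    have "distributed M lborel (\<lambda>x. (L x - \<mu>) / \<sigma>) std_normal_density"
      using pos normal_standard_normal_convert by blast
    then have D: "distr M lborel (\<lambda>x. L x / \<sigma>) = std_normal_distribution"
      by (simp add: distributed_def \<mu>)
    have "char (distr M borel L) s = complex_of_real (exp (- (v * s\<^sup>2) / 2))" for s
    proof -
      have "char (distr M borel L) s = (CLINT \<omega>|M. iexp ((s * \<sigma>) * (L \<omega> / \<sigma>)))"
        using pos by (subst char_distr) auto
      also have "\<dots> = char (distr M lborel (\<lambda>x. L x / \<sigma>)) (s * \<sigma>)"
        unfolding char_def by (subst integral_distr) auto
      also have "\<dots> = complex_of_real (exp (- (v * s\<^sup>2) / 2))"
        unfolding D char_std_normal_distribution by (simp add: v power_mult_distrib mult_ac)
      finally show ?thesis .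
    qed
    then show ?thesis by (simp add: centred_normal_def v)
  next
    case const
    have "(LINT \<omega>|M. L \<omega>) = (LINT \<omega>|M. \<mu>)" by (rule integral_cong_AE) (use const in auto)
    then have \<mu>: "\<mu> = 0" using assms(3) by (simp add: prob_space)
    have "(LINT \<omega>|M. (L \<omega>)\<^sup>2) = (LINT \<omega>|M. \<mu>\<^sup>2)" by (rule integral_cong_AE) (use const in auto)
    then have v: "v = 0" using assms(4) \<mu> by simp
    have "char (distr M borel L) s = 1" for s
    proof -
      have "(CLINT \<omega>|M. iexp (s * L \<omega>)) = (CLINT \<omega>|M. 1)"
        by (rule integral_cong_AE) (use const \<mu> in auto)
      then show ?thesis by (simp add: char_distr prob_space)
    qed
    then show ?thesis by (simp add: centred_normal_def v)
  qed
qed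

text \<open>The integrands \<open>iexp (s * L m \<omega>)\<close> have norm 1, so dominated
  convergence carries almost sure convergence over to characteristic functions without any moment
  bound on the \<open>L m\<close>.\<close>

lemma centred_normal_limit:
  assumes "prob_space M" and L: "\<And>m. centred_normal M (v m) (L m)" 
    and lim: "AE \<omega> in M. (\<lambda>m::nat. L m \<omega>) \<longlonglongrightarrow> L' \<omega>" and v: "v \<longlonglongrightarrow> v'" 
    and [measurable]: "L' \<in> borel_measurable M"
  shows "centred_normal M v' L'"
proof -
  interpret prob_space M by fact
  note [measurable] = centred_normal_measurable[OF L]
  have "0 \<le> v'" using LIMSEQ_le_const[OF v] L by (auto simp: centred_normal_def)
  moreover have "char (distr M borel L') s = complex_of_real (exp (- (v' * s\<^sup>2) / 2))" for s
  proof -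
    have "(\<lambda>m. CLINT \<omega>|M. iexp (s * L m \<omega>)) \<longlonglongrightarrow> (CLINT \<omega>|M. iexp (s * L' \<omega>))"
    proof (rule integral_dominated_convergence[where w="\<lambda>_. 1"])
      show "AE \<omega> in M. (\<lambda>m. iexp (s * L m \<omega>)) \<longlonglongrightarrow> iexp (s * L' \<omega>)"
        using lim by eventually_elim (intro tendsto_intros)
    qed auto
    moreover have "(CLINT \<omega>|M. iexp (s * L m \<omega>)) = complex_of_real (exp (- (v m * s\<^sup>2) / 2))" for m
      using L[of m] by (simp add: centred_normal_def char_distr)
    ultimately have "(\<lambda>m. complex_of_real (exp (- (v m * s\<^sup>2) / 2))) \<longlonglongrightarrow> (CLINT \<omega>|M. iexp (s * L' \<omega>))"
      by simp
    moreover have "(\<lambda>m. complex_of_real (exp (- (v m * s\<^sup>2) / 2))) \<longlonglongrightarrow> complex_of_real (exp (- (v' * s\<^sup>2) / 2))"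
      by (intro tendsto_intros v) simp
    ultimately show ?thesis using LIMSEQ_unique by (auto simp: char_distr)
  qed
  ultimately show ?thesis by (simp add: centred_normal_def)
qed

text \<open>Independence is modelled by the product measure, on which the characteristic function of
  the sum factors. This provides the independent copy for the decoupling of quadratic forms.\<close>

lemma centred_normal_add_indep:
  assumes "prob_space M" "prob_space N" "centred_normal M v L" "centred_normal N w K"
  shows "centred_normal (M \<Otimes>\<^sub>M N) (v + w) (\<lambda>z. L (fst z) + K (snd z))"
proof -
  interpret M: prob_space M by fact
  interpret N: prob_space N by fact
  interpret P: pair_prob_space M N ..
  note [measurable] = centred_normal_measurable[OF assms(3)] centred_normal_measurable[OF assms(4)]
  have "char (distr (M \<Otimes>\<^sub>M N) borel (\<lambda>z. L (fst z) + K (snd z))) s 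
      = complex_of_real (exp (- ((v + w) * s\<^sup>2) / 2))" for s
  proof -
    have "char (distr (M \<Otimes>\<^sub>M N) borel (\<lambda>z. L (fst z) + K (snd z))) s
       = (CLINT z|M \<Otimes>\<^sub>M N. iexp (s * L (fst z)) * iexp (s * K (snd z)))"
      by (subst char_distr) (auto simp: ring_distribs exp_add)
    also have "\<dots> = (CLINT x|M. CLINT y|N. iexp (s * L x) * iexp (s * K y))"
      by (subst P.integral_fst'[symmetric])
         (auto intro!: P.integrable_const_bound[where B=1] simp: norm_mult)
    also have "\<dots> = (CLINT x|M. iexp (s * L x)) * (CLINT y|N. iexp (s * K y))"
      by simp
    also have "\<dots> = complex_of_real (exp (- (v * s\<^sup>2) / 2)) * complex_of_real (exp (- (w * s\<^sup>2) / 2))"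
      using assms(3,4) by (simp add: centred_normal_def char_distr)
    finally show ?thesis by (simp add: exp_add[symmetric] of_real_mult[symmetric] field_simps del: of_real_mult)
  qed
  then show ?thesis using assms(3,4) by (simp add: centred_normal_def)
qed

section \<open>Moments of Gaussian quadratic forms\<close>

text \<open>A class closed under sums and products: integrability of any polynomial in Gaussian
  variables then follows from introduction rules alone.\<close>

definition all_moments :: "'a measure \<Rightarrow> ('a \<Rightarrow> real) \<Rightarrow> bool" where
  "all_moments M f \<longleftrightarrow> f \<in> borel_measurable M \<and> (\<forall>m. integrable M (\<lambda>\<omega>. f \<omega> ^ m))"

lemma all_moments_measurable: "all_moments M f \<Longrightarrow> f \<in> borel_measurable M"
  by (simp add: all_moments_def)

lemma all_moments_integrable: "all_moments M f \<Longrightarrow> integrable M f"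
  unfolding all_moments_def by (elim conjE allE[of _ 1]) simp

lemma all_moments_power_integrable: "all_moments M f \<Longrightarrow> integrable M (\<lambda>\<omega>. f \<omega> ^ m)"
  by (simp add: all_moments_def)

lemma all_momentsI_even:
  assumes [measurable]: "f \<in> borel_measurable M" and "\<And>m. integrable M (\<lambda>\<omega>. f \<omega> ^ (2 * m))"
  shows "all_moments M f"
  unfolding all_moments_def
proof (intro conjI allI)
  fix m
  have "integrable M (\<lambda>\<omega>. f \<omega> ^ (2 * 0) + f \<omega> ^ (2 * m))"
    by (intro Bochner_Integration.integrable_add assms)
  then show "integrable M (\<lambda>\<omega>. f \<omega> ^ m)"
  proof (rule Bochner_Integration.integrable_bound)
    have "\<bar>x\<bar> \<le> 1 + x\<^sup>2" for x :: real
    proof -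
      have "2 * \<bar>x\<bar> \<le> 1 + x\<^sup>2" using sum_squares_bound[of 1 "\<bar>x\<bar>"] by simp
      then show ?thesis using abs_ge_zero[of x] by linarith
    qed
    from this[of "f \<omega> ^ m" for \<omega>]
    have "\<bar>f \<omega> ^ m\<bar> \<le> 1 + (f \<omega> ^ m)\<^sup>2" for \<omega> .
    then show "AE \<omega> in M. norm (f \<omega> ^ m) \<le> norm (f \<omega> ^ (2 * 0) + f \<omega> ^ (2 * m))"
      unfolding real_norm_def by (intro AE_I2 order_trans[OF _ abs_ge_self]) (simp add: power_mult[symmetric] mult.commute)
  qed simp
qed fact

lemma power_add_le:
  fixes x y :: real
  shows "(x + y) ^ (2 * m) \<le> 4 ^ m * (x ^ (2 * m) + y ^ (2 * m))"
proof -
  have "(x + y)\<^sup>2 \<le> 4 * max (x\<^sup>2) (y\<^sup>2)"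
    using sum_squares_bound[of x y] by (simp add: power2_sum max_def)
  then have "((x + y)\<^sup>2) ^ m \<le> (4 * max (x\<^sup>2) (y\<^sup>2)) ^ m"
    by (intro power_mono) auto
  also have "\<dots> = 4 ^ m * (max (x\<^sup>2) (y\<^sup>2)) ^ m" by (simp add: power_mult_distrib)
  also have "(max (x\<^sup>2) (y\<^sup>2)) ^ m \<le> (x\<^sup>2) ^ m + (y\<^sup>2) ^ m"
    by (simp add: max_def)
  finally show ?thesis by (simp add: power_mult)
qed

lemma all_moments_add:
  assumes "all_moments M f" "all_moments M g"
  shows "all_moments M (\<lambda>\<omega>. f \<omega> + g \<omega>)"
proof (rule all_momentsI_even)
  note [measurable] = assms[THEN all_moments_measurable]
  show "(\<lambda>\<omega>. f \<omega> + g \<omega>) \<in> borel_measurable M" by simp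
  fix m
  have "integrable M (\<lambda>\<omega>. 4 ^ m * (f \<omega> ^ (2 * m) + g \<omega> ^ (2 * m)))"
    using assms by (auto simp: all_moments_def)
  then show "integrable M (\<lambda>\<omega>. (f \<omega> + g \<omega>) ^ (2 * m))"
    by (rule Bochner_Integration.integrable_bound) (auto intro!: AE_I2 order_trans[OF power_add_le])
qed

lemma all_moments_mult:
  assumes "all_moments M f" "all_moments M g"
  shows "all_moments M (\<lambda>\<omega>. f \<omega> * g \<omega>)"
proof (rule all_momentsI_even)
  note [measurable] = assms[THEN all_moments_measurable]
  show "(\<lambda>\<omega>. f \<omega> * g \<omega>) \<in> borel_measurable M" by simp
  fix m
  have "integrable M (\<lambda>\<omega>. f \<omega> ^ (2 * (2 * m)) + g \<omega> ^ (2 * (2 * m)))"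
    using assms by (auto simp: all_moments_def)
  then show "integrable M (\<lambda>\<omega>. (f \<omega> * g \<omega>) ^ (2 * m))"
  proof (rule Bochner_Integration.integrable_bound)
    show "AE \<omega> in M. norm ((f \<omega> * g \<omega>) ^ (2 * m)) \<le> norm (f \<omega> ^ (2 * (2 * m)) + g \<omega> ^ (2 * (2 * m)))"
    proof (intro AE_I2)
      fix \<omega>
      have eq: "x ^ (2 * (2 * m)) = (x ^ (2 * m))\<^sup>2" for x :: real
        by (simp add: power_mult[symmetric] mult_ac)
      have xy: "\<bar>x * y\<bar> \<le> \<bar>x\<^sup>2 + y\<^sup>2\<bar>" for x y :: real
      proof -
        have "2 * \<bar>x * y\<bar> \<le> x\<^sup>2 + y\<^sup>2" using sum_squares_bound[of "\<bar>x\<bar>" "\<bar>y\<bar>"] by (simp add: abs_mult)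
        then show ?thesis using abs_ge_zero[of "x * y"] by linarith
      qed
      show "norm ((f \<omega> * g \<omega>) ^ (2 * m)) \<le> norm (f \<omega> ^ (2 * (2 * m)) + g \<omega> ^ (2 * (2 * m)))"
        unfolding eq power_mult_distrib real_norm_def by (rule xy)
    qed
  qed simp
qed

lemma (in finite_measure) all_moments_const: "all_moments M (\<lambda>_. c)"
  by (simp add: all_moments_def)

lemma all_moments_diff:
  assumes "finite_measure M" "all_moments M f" "all_moments M g"
  shows "all_moments M (\<lambda>\<omega>. f \<omega> - g \<omega>)"
  using all_moments_add[OF assms(2) all_moments_mult[OF finite_measure.all_moments_const[OF assms(1), of "-1"] assms(3)]]
  by simp

lemma all_moments_sum:
  assumes "finite_measure M" "\<And>i. i \<in> I \<Longrightarrow> all_moments M (f i)"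
  shows "all_moments M (\<lambda>\<omega>. \<Sum>i\<in>I. f i \<omega>)"
proof -
  interpret finite_measure M by fact
  show ?thesis using assms(2)
    by (induction I rule: infinite_finite_induct) (auto intro: all_moments_add all_moments_const)
qed

lemma all_moments_prod:
  assumes "finite_measure M" "\<And>i. i \<in> I \<Longrightarrow> all_moments M (f i)"
  shows "all_moments M (\<lambda>\<omega>. \<Prod>i\<in>I. f i \<omega>)"
proof -
  interpret finite_measure M by fact
  show ?thesis using assms(2)
    by (induction I rule: infinite_finite_induct) (auto intro: all_moments_mult all_moments_const)
qed

lemma all_moments_power:
  assumes "finite_measure M" "all_moments M f"
  shows "all_moments M (\<lambda>\<omega>. f \<omega> ^ m)"
  using all_moments_prod[OF assms(1), of "{..<m}" "\<lambda>_. f"] assms(2) by simp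

lemma centred_normal_all_moments:
  "prob_space M \<Longrightarrow> centred_normal M v L \<Longrightarrow> all_moments M L"
  by (simp add: all_moments_def centred_normal_moment centred_normal_measurable)

section \<open>Polarization and mixed moments of Gaussian families\<close>

lemma sum_Pow_insert:
  fixes g :: "'k set \<Rightarrow> real"
  assumes "finite K" "a \<notin> K"
  shows "(\<Sum>S\<in>Pow (insert a K). g S) = (\<Sum>S\<in>Pow K. g (insert a S)) + (\<Sum>S\<in>Pow K. g S)"
proof -
  have "(\<Sum>S\<in>Pow (insert a K). g S) = (\<Sum>S\<in>Pow K. g S) + (\<Sum>S\<in>insert a ` Pow K. g S)"
    unfolding Pow_insert using assms by (subst sum.union_disjoint) auto
  also have "(\<Sum>S\<in>insert a ` Pow K. g S) = (\<Sum>S\<in>Pow K. g (insert a S))"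
    by (subst sum.reindex) (use assms in \<open>auto simp: inj_on_def\<close>)
  finally show ?thesis by simp
qed

text \<open>The alternating sum is the \<open>card K\<close>-fold finite difference, with steps
  \<open>x k\<close>, of the power \<open>j\<close> at \<open>y\<close>. Each difference lowers the
  degree, so powers below \<open>card K\<close> vanish and at degree \<open>card K\<close> only the
  leading term is left.\<close>

lemma polarization_shifted:
  fixes x :: "'k \<Rightarrow> real"
  assumes "finite K" "j \<le> card K"
  shows "(\<Sum>S\<in>Pow K. (-1) ^ (card K - card S) * (y + (\<Sum>k\<in>S. x k)) ^ j)
     = (if j = card K then fact j * (\<Prod>k\<in>K. x k) else 0)"
  using assms
proof (induction K arbitrary: j y rule: finite_induct)
  case empty
  then show ?case by simp
next
  case (insert a K)
  let ?D = "\<lambda>y j. \<Sum>S\<in>Pow K. (-1) ^ (card K - card S) * (y + (\<Sum>k\<in>S. x k)) ^ j"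
  have S: "finite S" "a \<notin> S" "card S \<le> card K" if "S \<in> Pow K" for S
    using that insert(1,2) by (auto intro: finite_subset card_mono)
  have "(\<Sum>S\<in>Pow (insert a K). (-1) ^ (card (insert a K) - card S) * (y + (\<Sum>k\<in>S. x k)) ^ j)
     = (\<Sum>S\<in>Pow K. (-1) ^ (card K - card S) * (y + x a + (\<Sum>k\<in>S. x k)) ^ j)
       + (\<Sum>S\<in>Pow K. - ((-1) ^ (card K - card S)) * (y + (\<Sum>k\<in>S. x k)) ^ j)"
    unfolding sum_Pow_insert[OF insert(1,2)]
  proof (intro arg_cong2[where f="(+)"] sum.cong refl)
    fix S assume "S \<in> Pow K"
    note S = S[OF this]
    show "(-1) ^ (card (insert a K) - card (insert a S)) * (y + (\<Sum>k\<in>insert a S. x k)) ^ j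
        = (-1) ^ (card K - card S) * (y + x a + (\<Sum>k\<in>S. x k)) ^ j"
      using S insert(1,2) by (simp add: add.assoc)
    show "(-1) ^ (card (insert a K) - card S) * (y + (\<Sum>k\<in>S. x k)) ^ j
        = - ((-1) ^ (card K - card S)) * (y + (\<Sum>k\<in>S. x k)) ^ j"
      using S insert(1,2) by (simp add: Suc_diff_le)
  qed
  also have "\<dots> = (\<Sum>S\<in>Pow K. (-1) ^ (card K - card S) *
        ((y + (\<Sum>k\<in>S. x k) + x a) ^ j - (y + (\<Sum>k\<in>S. x k)) ^ j))"
    by (simp add: sum.distrib[symmetric] algebra_simps)
  \<comment> \<open>The term \<open>i = j\<close> of the binomial expansion cancels, leaving powers
    \<open>i < j \<le> card K + 1\<close>; of these the induction hypothesis keeps only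
    \<open>i = card K\<close>.\<close>
  also have "\<dots> = (\<Sum>S\<in>Pow K. (-1) ^ (card K - card S) *
        (\<Sum>i<j. of_nat (j choose i) * (y + (\<Sum>k\<in>S. x k)) ^ i * x a ^ (j - i)))"
    by (subst binomial_ring) (simp add: lessThan_Suc_atMost[symmetric])
  also have "\<dots> = (\<Sum>i<j. of_nat (j choose i) * x a ^ (j - i) * ?D y i)"
    unfolding sum_distrib_left by (subst sum.swap) (simp add: mult_ac)
  also have "\<dots> = (\<Sum>i<j. of_nat (j choose i) * x a ^ (j - i) *
      (if i = card K then fact i * (\<Prod>k\<in>K. x k) else 0))"
    using insert.prems insert(1,2) by (intro sum.cong refl arg_cong2[where f="(*)"] insert.IH) auto
  also have "\<dots> = (if j = card (insert a K) then fact j * (\<Prod>k\<in>insert a K. x k) else 0)"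
    using insert.prems insert(1,2) by (auto simp: if_distrib[of "(*) _"] sum.delta' cong: if_cong)
  finally show ?case .
qed

lemma polarization:
  fixes x :: "'k \<Rightarrow> real"
  assumes "finite K"
  shows "(\<Prod>k\<in>K. x k) = (\<Sum>S\<in>Pow K. (-1) ^ (card K - card S) / fact (card K) * (\<Sum>k\<in>S. x k) ^ card K)"
  using polarization_shifted[OF assms order_refl, of 0 x]
  by (simp add: sum_divide_distrib[symmetric] field_simps)

text \<open>A product is a combination of powers of partial sums, so its expectation depends only on
  the laws of these sums. This stands in for equality of joint laws; \<open>f\<close> lets a
  variable occur several times in the product.\<close>

lemma mixed_moments_eq:
  fixes P :: "'i \<Rightarrow> 'a \<Rightarrow> real" and Q :: "'i \<Rightarrow> 'b \<Rightarrow> real" and f :: "'k \<Rightarrow> 'i"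
  assumes K: "finite K" and M: "finite_measure M" "finite_measure N"
    and PQ: "\<And>k. k \<in> K \<Longrightarrow> all_moments M (P (f k))" "\<And>k. k \<in> K \<Longrightarrow> all_moments N (Q (f k))"
    and eq: "\<And>S m. S \<subseteq> K \<Longrightarrow> (LINT \<omega>|M. (\<Sum>k\<in>S. P (f k) \<omega>) ^ m) = (LINT \<omega>|N. (\<Sum>k\<in>S. Q (f k) \<omega>) ^ m)"
  shows "(LINT \<omega>|M. (\<Prod>k\<in>K. P (f k) \<omega>)) = (LINT \<omega>|N. (\<Prod>k\<in>K. Q (f k) \<omega>))"
proof -
  have int: "integrable M (\<lambda>\<omega>. (\<Sum>k\<in>S. P (f k) \<omega>) ^ m)" "integrable N (\<lambda>\<omega>. (\<Sum>k\<in>S. Q (f k) \<omega>) ^ m)"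
    if "S \<in> Pow K" for S m
    using that by (auto intro!: all_moments_power_integrable all_moments_sum M PQ)
  show ?thesis
    unfolding polarization[OF K]
    by (subst (1 2) Bochner_Integration.integral_sum) (auto intro!: int simp: eq)
qed

text \<open>\<open>K\<close> ranges over sets of naturals because a definition cannot quantify over
  index types; \<open>gaussian_family_comb\<close> transports the property to any finite index set.
  As \<open>f\<close> need not be injective, coefficients at repeated indices are covered.\<close>

definition gaussian_family :: "'a measure \<Rightarrow> 'i set \<Rightarrow> ('i \<Rightarrow> 'a \<Rightarrow> real) \<Rightarrow> ('i \<Rightarrow> 'i \<Rightarrow> real) \<Rightarrow> bool" where
  "gaussian_family M T W r \<longleftrightarrow> (\<forall>(K :: nat set) f c. finite K \<longrightarrow> f ` K \<subseteq> T \<longrightarrow>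
     centred_normal M (\<Sum>k\<in>K. \<Sum>l\<in>K. c k * c l * r (f k) (f l)) (\<lambda>\<omega>. \<Sum>k\<in>K. c k * W (f k) \<omega>))"

lemma gaussian_family_comb:
  fixes K :: "'k set"
  assumes G: "gaussian_family M T W r" and "finite K" "f ` K \<subseteq> T"
  shows "centred_normal M (\<Sum>k\<in>K. \<Sum>l\<in>K. c k * c l * r (f k) (f l)) (\<lambda>\<omega>. \<Sum>k\<in>K. c k * W (f k) \<omega>)"
proof -
  obtain h where h: "bij_betw h {0..<card K} K" using ex_bij_betw_nat_finite[OF \<open>finite K\<close>] by blast
  have "(f \<circ> h) ` {0..<card K} \<subseteq> T" using h assms(3) by (auto simp: bij_betw_def)
  then have "centred_normal M (\<Sum>k\<in>{0..<card K}. \<Sum>l\<in>{0..<card K}. (c \<circ> h) k * (c \<circ> h) l * r ((f \<circ> h) k) ((f \<circ> h) l))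
     (\<lambda>\<omega>. \<Sum>k\<in>{0..<card K}. (c \<circ> h) k * W ((f \<circ> h) k) \<omega>)"
    using G unfolding gaussian_family_def by blast
  also have "(\<Sum>k\<in>{0..<card K}. \<Sum>l\<in>{0..<card K}. (c \<circ> h) k * (c \<circ> h) l * r ((f \<circ> h) k) ((f \<circ> h) l))
      = (\<Sum>k\<in>{0..<card K}. \<Sum>l\<in>K. (c \<circ> h) k * c l * r ((f \<circ> h) k) (f l))"
    using sum.reindex_bij_betw[OF h, of "\<lambda>l. c (h k) * c l * r (f (h k)) (f l)" for k] by simp
  also have "\<dots> = (\<Sum>k\<in>K. \<Sum>l\<in>K. c k * c l * r (f k) (f l))"
    using sum.reindex_bij_betw[OF h, of "\<lambda>k. \<Sum>l\<in>K. c k * c l * r (f k) (f l)"] by simp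
  also have "(\<lambda>\<omega>. \<Sum>k\<in>{0..<card K}. (c \<circ> h) k * W ((f \<circ> h) k) \<omega>) = (\<lambda>\<omega>. \<Sum>k\<in>K. c k * W (f k) \<omega>)"
    using sum.reindex_bij_betw[OF h, of "\<lambda>k. c k * W (f k) \<omega>" for \<omega>] by simp
  finally show ?thesis .
qed

lemma gaussian_family_single:
  assumes "gaussian_family M T W r" "i \<in> T"
  shows "centred_normal M (r i i) (W i)"
  using gaussian_family_comb[OF assms(1), of "{i}" "\<lambda>i. i" "\<lambda>_. 1"] assms(2) by simp

lemma gaussian_family_reindex:
  assumes "gaussian_family M T W r" "t ` S \<subseteq> T"
  shows "gaussian_family M S (\<lambda>i. W (t i)) (\<lambda>i j. r (t i) (t j))"
  unfolding gaussian_family_def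
proof (intro allI impI)
  fix K :: "nat set" and f :: "nat \<Rightarrow> _" and c
  assume "finite K" "f ` K \<subseteq> S"
  then have "(\<lambda>k. t (f k)) ` K \<subseteq> T" using assms(2) by blast
  from gaussian_family_comb[OF assms(1) \<open>finite K\<close> this, of c]
  show "centred_normal M (\<Sum>k\<in>K. \<Sum>l\<in>K. c k * c l * r (t (f k)) (t (f l))) (\<lambda>\<omega>. \<Sum>k\<in>K. c k * W (t (f k)) \<omega>)" .
qed

lemma power_mean_le:
  fixes a :: "'i \<Rightarrow> real"
  assumes "finite I" "\<And>i. i \<in> I \<Longrightarrow> 0 \<le> a i" "I \<noteq> {}"
  shows "(\<Sum>i\<in>I. a i) ^ p \<le> real (card I) ^ p * ((\<Sum>i\<in>I. a i ^ p) / real (card I))"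
proof -
  have c: "0 < real (card I)" using assms by (simp add: card_gt_0_iff)
  have "convex_on {0::real..} (\<lambda>x. x ^ p)"
  proof (cases "even p")
    case True
    then show ?thesis using convex_on_subset[OF convex_power_even] by blast
  next
    case False
    then show ?thesis by (rule convex_power_odd)
  qed
  from convex_on_sum[OF assms(1,3) this, of "\<lambda>_. 1 / card I" a] assms c
  have "((\<Sum>i\<in>I. a i) / card I) ^ p \<le> (\<Sum>i\<in>I. a i ^ p) / card I"
    by (simp add: sum_divide_distrib[symmetric])
  then show ?thesis using c by (simp add: power_divide field_simps)
qed

lemma prod_Times_bool:
  fixes f :: "'k \<Rightarrow> bool \<Rightarrow> real"
  shows "(\<Prod>k\<in>K. f k True * f k False) = (\<Prod>x\<in>K \<times> UNIV. f (fst x) (snd x))"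
  using prod.cartesian_product[of f UNIV K] by (simp add: UNIV_bool case_prod_beta mult.commute)

text \<open>Jensen's inequality replaces the centred form by the difference of two independent copies
  \<open>W\<close>, \<open>W'\<close>, which factors as \<open>\<Sum> (W\<^sub>i - W'\<^sub>i)(W\<^sub>i + W'\<^sub>i)\<close>. The pair \<open>(W + W', W - W')\<close> has the same mixed
  moments as \<open>\<surd>2 (W, W')\<close> (rotation invariance and polarization), and \<open>2 \<Sum> W\<^sub>i W'\<^sub>i\<close> is conditionally normal
  given \<open>W\<close>. This replaces hypercontractivity on the second Wiener chaos.\<close>

lemma quadratic_form_moment:
  fixes W :: "'i \<Rightarrow> 'a \<Rightarrow> real"
  assumes "prob_space M" and G: "gaussian_family M I W r" and I: "finite I" "I \<noteq> {}"
    and row: "\<And>i. i \<in> I \<Longrightarrow> (\<Sum>j\<in>I. \<bar>r i j\<bar>) \<le> \<Lambda>" "\<And>i. i \<in> I \<Longrightarrow> (\<Sum>j\<in>I. \<bar>r j i\<bar>) \<le> \<Lambda>"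
    and v: "\<And>i. i \<in> I \<Longrightarrow> r i i \<le> v"
  shows "(LINT \<omega>|M. (\<Sum>i\<in>I. (W i \<omega>)\<^sup>2 - r i i) ^ (2 * p)) \<le> (4 * \<Lambda> * real (card I) * v) ^ p * (std_moment (2 * p))\<^sup>2"
proof -
  interpret M: prob_space M by fact
  interpret MM: pair_prob_space M M ..
  let ?MM = "M \<Otimes>\<^sub>M M"
  have fin: "finite_measure M" "finite_measure ?MM" "prob_space ?MM"
    by unfold_locales
  define c where "c = std_moment (2 * p)"
  have c: "0 \<le> c" by (simp add: c_def std_moment_even_nonneg)
  have cn: "centred_normal M (r i i) (W i)" if "i \<in> I" for i
    using gaussian_family_single[OF G that] .
  have am: "all_moments M (W i)" if "i \<in> I" for i
    using centred_normal_all_moments[OF \<open>prob_space M\<close> cn[OF that]] .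
  have r0: "0 \<le> r i i" if "i \<in> I" for i using cn[OF that] by (simp add: centred_normal_def)
  have \<Lambda>0: "0 \<le> \<Lambda>" using I row(1) by (meson abs_ge_zero all_not_in_conv order_trans sum_nonneg)
  have pair: "centred_normal ?MM (w + w') (\<lambda>z. L (fst z) + L' (snd z))"
    if "centred_normal M w L" "centred_normal M w' L'" for w w' L L'
    using centred_normal_add_indep[OF \<open>prob_space M\<close> \<open>prob_space M\<close> that] .
  have zero: "centred_normal M 0 (\<lambda>_. 0)"
    using gaussian_family_comb[OF G, of "{} :: nat set"] by simp
  have am1: "all_moments ?MM (\<lambda>z. W i (fst z))" and am2: "all_moments ?MM (\<lambda>z. W i (snd z))" if "i \<in> I" for i
    using pair[OF cn[OF that] zero] pair[OF zero cn[OF that]]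
    by (auto intro: centred_normal_all_moments[OF fin(3)])
  have const: "all_moments M (\<lambda>_. a)" "all_moments ?MM (\<lambda>_. a)" for a
    by (rule finite_measure.all_moments_const[OF fin(1)] finite_measure.all_moments_const[OF fin(2)])+
  define F where "F = (\<lambda>\<omega>. \<Sum>i\<in>I. (W i \<omega>)\<^sup>2 - r i i)"
  have amF: "all_moments M F"
    unfolding F_def
    by (intro all_moments_sum all_moments_diff all_moments_power const fin am)
  have EF: "(LINT \<omega>|M. F \<omega>) = 0"
    unfolding F_def
    by (subst Bochner_Integration.integral_sum)
       (auto intro!: sum.neutral Bochner_Integration.integrable_diff all_moments_integrable[OF all_moments_power] fin am
         simp: centred_normal_variance[OF \<open>prob_space M\<close> cn] M.prob_space all_moments_integrable[OF all_moments_power[OF fin(1) am]])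
  \<comment> \<open>The flag selects the sum or the difference of the two copies in
    \<open>P\<close>, and \<open>sqrt 2\<close> times the first or the second copy in
    \<open>Q\<close>; the two are related by a rotation by 45 degrees.\<close>
  define P :: "bool \<times> 'i \<Rightarrow> 'a \<times> 'a \<Rightarrow> real" where
    "P = (\<lambda>x z. W (snd x) (fst z) + (if fst x then 1 else -1) * W (snd x) (snd z))"
  define Q :: "bool \<times> 'i \<Rightarrow> 'a \<times> 'a \<Rightarrow> real" where
    "Q = (\<lambda>x z. (if fst x then sqrt 2 else 0) * W (snd x) (fst z) + (if fst x then 0 else sqrt 2) * W (snd x) (snd z))"
  have amP: "all_moments ?MM (P x)" and amQ: "all_moments ?MM (Q x)" if "snd x \<in> I" for x
    unfolding P_def Q_def using that
    by (intro all_moments_add all_moments_mult const am1 am2; assumption)+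
  have mom: "(LINT z|?MM. (\<Sum>x\<in>S. P (f x) z) ^ m) = (LINT z|?MM. (\<Sum>x\<in>S. Q (f x) z) ^ m)"
    if S: "finite S" "\<And>x. x \<in> S \<Longrightarrow> snd (f x) \<in> I" for S :: "(nat \<times> bool) set" and f m
  proof -
    let ?g = "\<lambda>x. snd (f x)" and ?v = "\<lambda>c. \<Sum>x\<in>S. \<Sum>y\<in>S. c x * c y * r (snd (f x)) (snd (f y))"
    have L: "centred_normal M (?v c) (\<lambda>\<omega>. \<Sum>x\<in>S. c x * W (?g x) \<omega>)" for c
      using S by (intro gaussian_family_comb[OF G]) auto
    have P': "centred_normal ?MM (?v (\<lambda>_. 1) + ?v (\<lambda>x. if fst (f x) then 1 else -1)) (\<lambda>z. \<Sum>x\<in>S. P (f x) z)"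
      using pair[OF L[of "\<lambda>_. 1"] L[of "\<lambda>x. if fst (f x) then 1 else -1"]]
      by (simp add: P_def sum.distrib)
    have Q': "centred_normal ?MM (?v (\<lambda>x. if fst (f x) then sqrt 2 else 0) + ?v (\<lambda>x. if fst (f x) then 0 else sqrt 2)) (\<lambda>z. \<Sum>x\<in>S. Q (f x) z)"
      using pair[OF L[of "\<lambda>x. if fst (f x) then sqrt 2 else 0"] L[of "\<lambda>x. if fst (f x) then 0 else sqrt 2"]]
      by (simp add: Q_def sum.distrib)
    \<comment> \<open>Termwise: \<open>1 + e * e'\<close> with signs \<open>e\<close>,
      \<open>e'\<close> is 2 if the flags agree and 0 otherwise, and so is the sum of the products
      of the coefficients \<open>sqrt 2\<close> and 0.\<close>
    have "?v (\<lambda>_. 1) + ?v (\<lambda>x. if fst (f x) then 1 else -1)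
        = ?v (\<lambda>x. if fst (f x) then sqrt 2 else 0) + ?v (\<lambda>x. if fst (f x) then 0 else sqrt 2)"
      unfolding sum.distrib[symmetric] by (intro sum.cong refl) auto
    then show ?thesis
      using centred_normal_moment(2)[OF fin(3) P', of m] centred_normal_moment(2)[OF fin(3) Q', of m] by simp
  qed
  \<comment> \<open>Multiplied out over choice functions \<open>g\<close>, the power becomes a sum
    of products of single variables, whose expectations can be compared one by one.\<close>
  have expand: "(\<Sum>i\<in>I. R (True, i) z * R (False, i) z) ^ (2 * p)
      = (\<Sum>g\<in>{..<2 * p} \<rightarrow>\<^sub>E I. \<Prod>x\<in>{..<2 * p} \<times> UNIV. R (snd x, g (fst x)) z)"
    for R :: "bool \<times> 'i \<Rightarrow> 'a \<times> 'a \<Rightarrow> real" and z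
  proof -
    have "(\<Sum>i\<in>I. R (True, i) z * R (False, i) z) ^ (2 * p) = (\<Prod>k<2*p. \<Sum>i\<in>I. R (True, i) z * R (False, i) z)"
      by simp
    also have "\<dots> = (\<Sum>g\<in>{..<2 * p} \<rightarrow>\<^sub>E I. \<Prod>k<2*p. R (True, g k) z * R (False, g k) z)"
      by (subst prod_sum_PiE) (use I in auto)
    finally show ?thesis unfolding prod_Times_bool[of "\<lambda>k b. R (b, g k) z" "{..<2*p}" for g] .
  qed
  have g: "snd (snd x, g (fst x)) \<in> I"
    if "g \<in> {..<2 * p} \<rightarrow>\<^sub>E I" "x \<in> {..<2 * p} \<times> UNIV" for g and x :: "nat \<times> bool"
    using that by (cases x) (simp add: PiE_iff)
  have "(LINT z|?MM. (\<Sum>i\<in>I. P (True, i) z * P (False, i) z) ^ (2 * p))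
      = (\<Sum>g\<in>{..<2 * p} \<rightarrow>\<^sub>E I. LINT z|?MM. (\<Prod>x\<in>{..<2 * p} \<times> UNIV. P (snd x, g (fst x)) z))"
    unfolding expand
    by (intro Bochner_Integration.integral_sum all_moments_integrable all_moments_prod fin amP g; assumption)
  also have "\<dots> = (\<Sum>g\<in>{..<2 * p} \<rightarrow>\<^sub>E I. LINT z|?MM. (\<Prod>x\<in>{..<2 * p} \<times> UNIV. Q (snd x, g (fst x)) z))"
  proof (rule sum.cong[OF refl])
    fix g assume gP: "g \<in> {..<2 * p} \<rightarrow>\<^sub>E I"
    show "(LINT z|?MM. (\<Prod>x\<in>{..<2 * p} \<times> UNIV. P (snd x, g (fst x)) z))
        = (LINT z|?MM. (\<Prod>x\<in>{..<2 * p} \<times> UNIV. Q (snd x, g (fst x)) z))"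
    proof (rule mixed_moments_eq[where f="\<lambda>x. (snd x, g (fst x))" and P=P and Q=Q, OF _ fin(2,2)])
      show fK: "finite ({..<2 * p} \<times> (UNIV :: bool set))" by simp
      fix S :: "(nat \<times> bool) set" and m assume S: "S \<subseteq> {..<2 * p} \<times> UNIV"
      show "(LINT z|?MM. (\<Sum>x\<in>S. P (snd x, g (fst x)) z) ^ m) = (LINT z|?MM. (\<Sum>x\<in>S. Q (snd x, g (fst x)) z) ^ m)"
        using S g[OF gP] finite_subset[OF S fK] by (intro mom) blast+
    qed (intro amP amQ g[OF gP]; assumption)+
  qed
  also have "\<dots> = (LINT z|?MM. (\<Sum>i\<in>I. Q (True, i) z * Q (False, i) z) ^ (2 * p))"
    unfolding expand
    by (intro Bochner_Integration.integral_sum[symmetric] all_moments_integrable all_moments_prod fin amQ g; assumption)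
  finally have PQ: "(LINT z|?MM. (\<Sum>i\<in>I. P (True, i) z * P (False, i) z) ^ (2 * p))
      = (LINT z|?MM. (\<Sum>i\<in>I. Q (True, i) z * Q (False, i) z) ^ (2 * p))" .
  have F_P: "F (fst z) - F (snd z) = (\<Sum>i\<in>I. P (True, i) z * P (False, i) z)" for z
    by (simp add: F_def P_def sum_subtractf[symmetric] power2_eq_square algebra_simps)
  have intP: "integrable ?MM (\<lambda>z. (F (fst z) - F (snd z)) ^ (2 * p))"
    unfolding F_P by (auto intro!: all_moments_integrable[OF all_moments_power] all_moments_sum all_moments_mult fin amP)
  have intQ: "integrable ?MM (\<lambda>z. (\<Sum>i\<in>I. Q (True, i) z * Q (False, i) z) ^ (2 * p))"
    by (auto intro!: all_moments_integrable[OF all_moments_power] all_moments_sum all_moments_mult fin amQ)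
  have "(LINT \<omega>|M. F \<omega> ^ (2 * p)) \<le> (LINT \<omega>|M. LINT \<omega>'|M. (F \<omega> - F \<omega>') ^ (2 * p))"
  proof (rule integral_mono)
    show "integrable M (\<lambda>\<omega>. F \<omega> ^ (2 * p))" using amF by (rule all_moments_power_integrable)
    show "integrable M (\<lambda>\<omega>. LINT \<omega>'|M. (F \<omega> - F \<omega>') ^ (2 * p))"
      using MM.integrable_fst'[OF intP] by simp
    fix \<omega>
    have am': "all_moments M (\<lambda>\<omega>'. F \<omega> - F \<omega>')"
      by (intro all_moments_diff const amF fin)
    \<comment> \<open>Jensen's inequality in \<open>\<omega>'\<close> for fixed
      \<open>\<omega>\<close>: since \<open>F\<close> has mean zero, the inner mean is
      \<open>F \<omega>\<close>.\<close>
    have "(LINT \<omega>'|M. F \<omega> - F \<omega>') ^ (2 * p) \<le> (LINT \<omega>'|M. (F \<omega> - F \<omega>') ^ (2 * p))"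
      by (rule M.jensens_inequality[where I=UNIV])
        (use am' in \<open>auto intro: all_moments_integrable all_moments_power_integrable convex_power_even\<close>)
    then show "F \<omega> ^ (2 * p) \<le> (LINT \<omega>'|M. (F \<omega> - F \<omega>') ^ (2 * p))"
      using EF all_moments_integrable[OF amF] by (simp add: M.prob_space)
  qed
  also have "\<dots> = (LINT z|?MM. (F (fst z) - F (snd z)) ^ (2 * p))"
    using MM.integral_fst'[OF intP] by simp
  also have "\<dots> = (LINT z|?MM. (\<Sum>i\<in>I. Q (True, i) z * Q (False, i) z) ^ (2 * p))"
    unfolding F_P by (rule PQ)
  also have "\<dots> = (LINT \<omega>|M. LINT \<omega>'|M. (\<Sum>i\<in>I. (2 * W i \<omega>) * W i \<omega>') ^ (2 * p))"
    by (subst MM.integral_fst'[OF intQ, symmetric]) (simp add: Q_def mult_ac)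
  \<comment> \<open>With \<open>\<omega>\<close> frozen, the inner sum is centred normal in
    \<open>\<omega>'\<close>, and its variance is this quadratic form in the values
    \<open>W i \<omega>\<close>.\<close>
  also have "\<dots> = (LINT \<omega>|M. (\<Sum>i\<in>I. \<Sum>j\<in>I. (2 * W i \<omega>) * (2 * W j \<omega>) * r i j) ^ p * c)"
    unfolding c_def using I
    by (intro Bochner_Integration.integral_cong refl centred_normal_even_moment[OF \<open>prob_space M\<close>] gaussian_family_comb[OF G, where f="\<lambda>i. i"]) auto
  also have "\<dots> \<le> (LINT \<omega>|M. (4 * \<Lambda>) ^ p * (real (card I) ^ p * ((\<Sum>i\<in>I. (W i \<omega>) ^ (2 * p)) / real (card I))) * c)"
  proof (rule integral_mono)
    show "integrable M (\<lambda>\<omega>. (\<Sum>i\<in>I. \<Sum>j\<in>I. (2 * W i \<omega>) * (2 * W j \<omega>) * r i j) ^ p * c)"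
      by (auto intro!: all_moments_integrable[OF all_moments_power] all_moments_sum all_moments_mult fin am const)
    show "integrable M (\<lambda>\<omega>. (4 * \<Lambda>) ^ p * (real (card I) ^ p * ((\<Sum>i\<in>I. (W i \<omega>) ^ (2 * p)) / real (card I))) * c)"
      unfolding divide_inverse
      by (intro all_moments_integrable all_moments_mult all_moments_sum all_moments_power fin const am; assumption)
    fix \<omega>
    have "centred_normal M (\<Sum>i\<in>I. \<Sum>j\<in>I. (2 * W i \<omega>) * (2 * W j \<omega>) * r i j) (\<lambda>\<omega>'. \<Sum>i\<in>I. (2 * W i \<omega>) * W i \<omega>')"
      using I by (intro gaussian_family_comb[OF G, where f="\<lambda>i. i"]) auto
    then have pos: "0 \<le> (\<Sum>i\<in>I. \<Sum>j\<in>I. (2 * W i \<omega>) * (2 * W j \<omega>) * r i j)"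
      by (simp add: centred_normal_def)
    \<comment> \<open>Schur test: after splitting \<open>2 * W i * W j\<close> into squares, each
      square meets a full row or column sum of \<open>r\<close>, bounded by
      \<open>\<Lambda>\<close>.\<close>
    have "(\<Sum>i\<in>I. \<Sum>j\<in>I. (2 * W i \<omega>) * (2 * W j \<omega>) * r i j)
        \<le> (\<Sum>i\<in>I. \<Sum>j\<in>I. 2 * (W i \<omega>)\<^sup>2 * \<bar>r i j\<bar> + 2 * (W j \<omega>)\<^sup>2 * \<bar>r i j\<bar>)"
    proof (intro sum_mono)
      fix i j
      have "2 * W i \<omega> * (2 * W j \<omega>) * r i j \<le> \<bar>2 * W i \<omega> * (2 * W j \<omega>)\<bar> * \<bar>r i j\<bar>"
        by (metis abs_ge_self abs_mult)
      also have "\<bar>2 * W i \<omega> * (2 * W j \<omega>)\<bar> \<le> 2 * (W i \<omega>)\<^sup>2 + 2 * (W j \<omega>)\<^sup>2"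
        using sum_squares_bound[of "\<bar>W i \<omega>\<bar>" "\<bar>W j \<omega>\<bar>"] by (simp add: abs_mult)
      finally show "2 * W i \<omega> * (2 * W j \<omega>) * r i j \<le> 2 * (W i \<omega>)\<^sup>2 * \<bar>r i j\<bar> + 2 * (W j \<omega>)\<^sup>2 * \<bar>r i j\<bar>"
        by (simp add: mult_right_mono ring_distribs)
    qed
    also have "\<dots> = (\<Sum>i\<in>I. 2 * (W i \<omega>)\<^sup>2 * (\<Sum>j\<in>I. \<bar>r i j\<bar>)) + (\<Sum>i\<in>I. 2 * (W i \<omega>)\<^sup>2 * (\<Sum>j\<in>I. \<bar>r j i\<bar>))"
      unfolding sum.distrib sum_distrib_left by (subst (2) sum.swap) simp
    also have "\<dots> \<le> (\<Sum>i\<in>I. 2 * (W i \<omega>)\<^sup>2 * \<Lambda>) + (\<Sum>i\<in>I. 2 * (W i \<omega>)\<^sup>2 * \<Lambda>)"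
      by (intro add_mono mult_left_mono sum_mono row) auto
    finally have "(\<Sum>i\<in>I. \<Sum>j\<in>I. (2 * W i \<omega>) * (2 * W j \<omega>) * r i j) \<le> 4 * \<Lambda> * (\<Sum>i\<in>I. (W i \<omega>)\<^sup>2)"
      by (simp add: sum.distrib[symmetric] sum_distrib_left mult_ac)
    then have "(\<Sum>i\<in>I. \<Sum>j\<in>I. (2 * W i \<omega>) * (2 * W j \<omega>) * r i j) ^ p \<le> (4 * \<Lambda> * (\<Sum>i\<in>I. (W i \<omega>)\<^sup>2)) ^ p"
      using pos by (intro power_mono)
    also have "\<dots> = (4 * \<Lambda>) ^ p * (\<Sum>i\<in>I. (W i \<omega>)\<^sup>2) ^ p"
      by (rule power_mult_distrib)
    \<comment> \<open>Convexity moves the p-th power inside the sum, so that only moments of single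
      variables remain.\<close>
    also have "\<dots> \<le> (4 * \<Lambda>) ^ p * (real (card I) ^ p * ((\<Sum>i\<in>I. ((W i \<omega>)\<^sup>2) ^ p) / real (card I)))"
      using \<Lambda>0 I by (intro mult_left_mono power_mean_le) auto
    finally show "(\<Sum>i\<in>I. \<Sum>j\<in>I. (2 * W i \<omega>) * (2 * W j \<omega>) * r i j) ^ p * c
        \<le> (4 * \<Lambda>) ^ p * (real (card I) ^ p * ((\<Sum>i\<in>I. (W i \<omega>) ^ (2 * p)) / real (card I))) * c"
      unfolding power_mult by (rule mult_right_mono[OF _ c])
  qed
  also have "\<dots> = (4 * \<Lambda> * real (card I)) ^ p * ((\<Sum>i\<in>I. LINT \<omega>|M. (W i \<omega>) ^ (2 * p)) / real (card I)) * c"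
    by (simp add: Bochner_Integration.integral_sum all_moments_power_integrable[OF am] power_mult_distrib)
  also have "\<dots> \<le> (4 * \<Lambda> * real (card I)) ^ p * ((\<Sum>i\<in>I. v ^ p * c) / real (card I)) * c"
    using c \<Lambda>0 r0 v
    by (intro mult_right_mono mult_left_mono divide_right_mono sum_mono)
       (auto simp: centred_normal_even_moment[OF \<open>prob_space M\<close> cn] c_def[symmetric] intro!: mult_right_mono power_mono)
  also have "\<dots> = (4 * \<Lambda> * real (card I) * v) ^ p * c\<^sup>2"
    using I by (simp add: power_mult_distrib power2_eq_square)
  finally show ?thesis by (simp add: F_def c_def)
qed

section \<open>Moving averages of fractional Brownian increments\<close>

text \<open>The covariance of \<open>B t - B t'\<close> and \<open>B s - B s'\<close>; the one-point
  powers of the Brownian covariance have cancelled.\<close>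

definition increment_cov :: "real \<Rightarrow> real \<Rightarrow> real \<Rightarrow> real \<Rightarrow> real \<Rightarrow> real" where
  "increment_cov H t t' s s' =
     (\<bar>t - s'\<bar> powr (2 * H) + \<bar>t' - s\<bar> powr (2 * H) - \<bar>t - s\<bar> powr (2 * H) - \<bar>t' - s'\<bar> powr (2 * H)) / 2"

text \<open>The time \<open>t - x\<close>, stopped at \<open>0\<close>. A negative \<open>x\<close> (where all kernels below vanish) is treated as \<open>0\<close>, so
  that the result always lies in \<open>[0, t]\<close>.\<close>

definition lookback :: "real \<Rightarrow> real \<Rightarrow> real" where
  "lookback t x = max 0 (t - max 0 x)"

text \<open>The index of the grid point of mesh \<open>1 / m\<close> just below the lookback time.
  For fixed \<open>t \<ge> 0\<close> it takes finitely many values, so integrals of functions of it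
  are finite sums (\<open>step_integral\<close>).\<close>

definition grid_back :: "nat \<Rightarrow> real \<Rightarrow> real \<Rightarrow> nat" where
  "grid_back m t x = nat \<lfloor>real m * lookback t x\<rfloor>"

text \<open>The covariance of the moving average with kernel \<open>k\<close> at the times
  \<open>t\<close> and \<open>s\<close>, with expectation and integrals formally interchanged;
  \<open>kernel_gaussian_family\<close> justifies it.\<close>

definition kernel_cov :: "real \<Rightarrow> (real \<Rightarrow> real) \<Rightarrow> real \<Rightarrow> real \<Rightarrow> real" where
  "kernel_cov H k t s =
     (LINT x|lborel. LINT y|lborel. k x * (k y * increment_cov H t (lookback t x) s (lookback s y)))"

lemma lookback_nonneg [simp]: "0 \<le> lookback t x"
  and lookback_le: "0 \<le> t \<Longrightarrow> lookback t x \<le> t"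
  and lookback_measurable [measurable]: "lookback t \<in> borel_measurable borel"
  by (auto simp: lookback_def[abs_def])

lemma grid_back_measurable [measurable]: "grid_back m t \<in> measurable borel (count_space UNIV)"
  unfolding grid_back_def[abs_def] by measurable

lemma grid_back_le: "0 \<le> t \<Longrightarrow> grid_back m t x \<le> nat \<lfloor>real m * t\<rfloor>"
  unfolding grid_back_def by (intro nat_mono floor_mono mult_left_mono lookback_le) auto

lemma grid_back_bounds:
  assumes "0 < m"
  shows "real (grid_back m t x) / real m \<le> lookback t x" "lookback t x \<le> real (grid_back m t x) / real m + 1 / real m"
proof -
  have "real (grid_back m t x) = of_int \<lfloor>real m * lookback t x\<rfloor>" by (simp add: grid_back_def)
  then have "real (grid_back m t x) \<le> real m * lookback t x" "real m * lookback t x \<le> real (grid_back m t x) + 1"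
    by linarith+
  then show "real (grid_back m t x) / real m \<le> lookback t x" "lookback t x \<le> real (grid_back m t x) / real m + 1 / real m"
    using assms by (auto simp: field_simps)
qed

lemma grid_back_tendsto: "(\<lambda>m. real (grid_back (Suc m) t x) / real (Suc m)) \<longlonglongrightarrow> lookback t x"
proof (rule real_tendsto_sandwich)
  show "\<forall>\<^sub>F m in sequentially. lookback t x - 1 / real (Suc m) \<le> real (grid_back (Suc m) t x) / real (Suc m)"
  proof (intro always_eventually allI)
    fix m
    show "lookback t x - 1 / real (Suc m) \<le> real (grid_back (Suc m) t x) / real (Suc m)"
      using grid_back_bounds(2)[of "Suc m" t x] by linarith
  qed
  show "\<forall>\<^sub>F m in sequentially. real (grid_back (Suc m) t x) / real (Suc m) \<le> lookback t x"
    using grid_back_bounds(1)[of "Suc _" t x] by (intro always_eventually) auto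
  show "(\<lambda>m. lookback t x - 1 / real (Suc m)) \<longlonglongrightarrow> lookback t x"
    using tendsto_diff[OF tendsto_const LIMSEQ_inverse_real_of_nat, of "lookback t x"] by (simp add: inverse_eq_divide)
qed simp

lemma step_integral:
  fixes \<phi> :: "nat \<Rightarrow> real"
  assumes k: "integrable lborel k" and "0 \<le> t"
  shows "integrable lborel (\<lambda>x. k x * \<phi> (grid_back m t x))"
    and "(LINT x|lborel. k x * \<phi> (grid_back m t x))
       = (\<Sum>j\<le>nat \<lfloor>real m * t\<rfloor>. (LINT x|lborel. k x * of_bool (grid_back m t x = j)) * \<phi> j)"
proof -
  have [measurable]: "k \<in> borel_measurable borel" using k by auto
  have eq: "k x * \<phi> (grid_back m t x) = (\<Sum>j\<le>nat \<lfloor>real m * t\<rfloor>. (k x * of_bool (grid_back m t x = j)) * \<phi> j)" for x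
    using grid_back_le[OF \<open>0 \<le> t\<close>, of m x] by (simp add: of_bool_def if_distrib if_distribR sum.delta cong: if_cong)
  have int: "integrable lborel (\<lambda>x. k x * of_bool (grid_back m t x = j))" for j
    by (rule Bochner_Integration.integrable_bound[OF k]) auto
  show "integrable lborel (\<lambda>x. k x * \<phi> (grid_back m t x))"
    unfolding eq by (intro Bochner_Integration.integrable_sum integrable_mult_left int)
  show "(LINT x|lborel. k x * \<phi> (grid_back m t x))
       = (\<Sum>j\<le>nat \<lfloor>real m * t\<rfloor>. (LINT x|lborel. k x * of_bool (grid_back m t x = j)) * \<phi> j)"
    unfolding eq by (subst Bochner_Integration.integral_sum) (auto intro!: integrable_mult_left int)
qed

lemma fbm_gaussian_family:
  assumes "prob_space M" and B: "fractional_brownian_motion M H B"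
  shows "gaussian_family M {0..} B (\<lambda>t s. (t powr (2 * H) + s powr (2 * H) - \<bar>t - s\<bar> powr (2 * H)) / 2)"
    (is "gaussian_family M _ B ?R")
  unfolding gaussian_family_def
proof (intro allI impI)
  interpret prob_space M by fact
  have gp: "gaussian_rv M (\<lambda>\<omega>. \<Sum>t\<in>S. c t * B t \<omega>)" if "finite S" "S \<subseteq> {0..}" for S c
    using B that by (auto simp: fractional_brownian_motion_def gaussian_process_def)
  have mean: "(LINT \<omega>|M. B t \<omega>) = 0" if "0 \<le> t" for t
    using B that by (auto simp: fractional_brownian_motion_def)
  have cov: "(LINT \<omega>|M. B t \<omega> * B s \<omega>) = ?R t s" if "0 \<le> t" "0 \<le> s" for t s
    using B that by (auto simp: fractional_brownian_motion_def)
  \<comment> \<open>The prescribed means and covariances alone give no integrability, as a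
    non-integrable function has integral 0. It is the normal law of \<open>B t\<close> that yields
    it.\<close>
  have am: "all_moments M (B t)" if "0 \<le> t" for t
  proof -
    have "centred_normal M (?R t t) (B t)"
      using gp[of "{t}" "\<lambda>_. 1"] mean[OF that] cov[OF that that] that
      by (intro gaussian_rv_centred_normal) (auto simp: prob_space_axioms power2_eq_square)
    then show ?thesis by (rule centred_normal_all_moments[OF prob_space_axioms])
  qed
  fix K :: "nat set" and f :: "nat \<Rightarrow> real" and c :: "nat \<Rightarrow> real"
  assume K: "finite K" "f ` K \<subseteq> {0..}"
  \<comment> \<open>A Gaussian process is tested on sets of distinct times, a family on possibly
    repeated ones; coefficients at equal times are collected.\<close>
  have regroup: "(\<Sum>k\<in>K. c k * B (f k) \<omega>) = (\<Sum>t\<in>f ` K. (\<Sum>k\<in>{k\<in>K. f k = t}. c k) * B t \<omega>)" for \<omega>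
    by (subst sum.image_gen[OF K(1), of _ f]) (auto intro!: sum.cong simp: sum_distrib_right)
  have am_fk: "all_moments M (B (f k))" if "k \<in> K" for k using am that K(2) by auto
  show "centred_normal M (\<Sum>k\<in>K. \<Sum>l\<in>K. c k * c l * ?R (f k) (f l)) (\<lambda>\<omega>. \<Sum>k\<in>K. c k * B (f k) \<omega>)"
  proof (rule gaussian_rv_centred_normal[OF prob_space_axioms])
    show "gaussian_rv M (\<lambda>\<omega>. \<Sum>k\<in>K. c k * B (f k) \<omega>)"
      unfolding regroup using K by (intro gp) auto
    show "(LINT \<omega>|M. (\<Sum>k\<in>K. c k * B (f k) \<omega>)) = 0"
      using K by (subst Bochner_Integration.integral_sum) (auto simp: mean intro!: sum.neutral all_moments_integrable am)
    have "(LINT \<omega>|M. (\<Sum>k\<in>K. c k * B (f k) \<omega>)\<^sup>2)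
       = (LINT \<omega>|M. (\<Sum>k\<in>K. \<Sum>l\<in>K. c k * c l * (B (f k) \<omega> * B (f l) \<omega>)))"
      by (simp add: power2_eq_square sum_product mult_ac)
    also have "\<dots> = (\<Sum>k\<in>K. \<Sum>l\<in>K. c k * c l * (LINT \<omega>|M. B (f k) \<omega> * B (f l) \<omega>))"
      by (simp add: Bochner_Integration.integral_sum all_moments_integrable all_moments_mult am_fk)
    also have "\<dots> = (\<Sum>k\<in>K. \<Sum>l\<in>K. c k * c l * ?R (f k) (f l))"
      using K by (intro sum.cong refl arg_cong2[where f="(*)"] cov) auto
    finally show "(LINT \<omega>|M. (\<Sum>k\<in>K. c k * B (f k) \<omega>)\<^sup>2) = \<dots>" .
  qed
qed

lemma fbm_increment_family:
  assumes "prob_space M" and B: "fractional_brownian_motion M H B"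
  shows "gaussian_family M ({0..} \<times> {0..}) (\<lambda>u \<omega>. B (fst u) \<omega> - B (snd u) \<omega>)
     (\<lambda>u v. increment_cov H (fst u) (snd u) (fst v) (snd v))"
  unfolding gaussian_family_def
proof (intro allI impI)
  fix K :: "nat set" and f :: "nat \<Rightarrow> real \<times> real" and c :: "nat \<Rightarrow> real"
  assume K: "finite K" "f ` K \<subseteq> {0..} \<times> {0..}"
  define R where "R = (\<lambda>t s. (t powr (2 * H) + s powr (2 * H) - \<bar>t - s\<bar> powr (2 * H)) / 2)"
  note G = fbm_gaussian_family[OF assms, folded R_def]
  \<comment> \<open>Each increment contributes two values of \<open>B\<close>: the flag
    \<open>True\<close> marks its first time, with coefficient \<open>c\<close>, and
    \<open>False\<close> its second, with coefficient \<open>- c\<close>.\<close>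
  let ?c = "\<lambda>x. if snd x then c (fst x) else - c (fst x)"
  let ?f = "\<lambda>x. if snd x then fst (f (fst x)) else snd (f (fst x))"
  have sum: "(\<Sum>x\<in>K \<times> UNIV. g (fst x) (snd x)) = (\<Sum>k\<in>K. g k True + g k False)" for g :: "nat \<Rightarrow> bool \<Rightarrow> real"
    using sum.cartesian_product[of g UNIV K] by (simp add: UNIV_bool case_prod_beta add.commute)
  have "centred_normal M (\<Sum>x\<in>K \<times> UNIV. \<Sum>y\<in>K \<times> UNIV. ?c x * ?c y * R (?f x) (?f y))
     (\<lambda>\<omega>. \<Sum>x\<in>K \<times> UNIV. ?c x * B (?f x) \<omega>)"
    using K by (intro gaussian_family_comb[OF G]) (auto simp: image_subset_iff mem_Times_iff)
  also have "(\<lambda>\<omega>. \<Sum>x\<in>K \<times> UNIV. ?c x * B (?f x) \<omega>) = (\<lambda>\<omega>. \<Sum>k\<in>K. c k * (B (fst (f k)) \<omega> - B (snd (f k)) \<omega>))"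
    using sum[of "\<lambda>k b. (if b then c k else - c k) * B (if b then fst (f k) else snd (f k)) \<omega>" for \<omega>]
    by (simp add: algebra_simps)
  also have "(\<Sum>x\<in>K \<times> UNIV. \<Sum>y\<in>K \<times> UNIV. ?c x * ?c y * R (?f x) (?f y))
     = (\<Sum>k\<in>K. \<Sum>l\<in>K. c k * c l * increment_cov H (fst (f k)) (snd (f k)) (fst (f l)) (snd (f l)))"
  proof -
    have inc: "increment_cov H t t' s s' = R t s - R t s' - R t' s + R t' s'" for t t' s s'
      by (simp add: increment_cov_def R_def) (simp add: field_simps)
    have inner: "(\<Sum>y\<in>K \<times> UNIV. ?c x * ?c y * R (?f x) (?f y))
       = (\<Sum>l\<in>K. ?c x * c l * (R (?f x) (fst (f l)) - R (?f x) (snd (f l))))" for x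
      using sum[of "\<lambda>l b. ?c x * (if b then c l else - c l) * R (?f x) (if b then fst (f l) else snd (f l))"]
      by (simp add: algebra_simps)
    have "(\<Sum>x\<in>K \<times> UNIV. \<Sum>y\<in>K \<times> UNIV. ?c x * ?c y * R (?f x) (?f y))
      = (\<Sum>k\<in>K. (\<Sum>l\<in>K. c k * c l * (R (fst (f k)) (fst (f l)) - R (fst (f k)) (snd (f l))))
          + (\<Sum>l\<in>K. - c k * c l * (R (snd (f k)) (fst (f l)) - R (snd (f k)) (snd (f l)))))"
      unfolding inner
      using sum[of "\<lambda>k b. \<Sum>l\<in>K. (if b then c k else - c k) * c l * (R (if b then fst (f k) else snd (f k)) (fst (f l)) - R (if b then fst (f k) else snd (f k)) (snd (f l)))"]
      by simp
    also have "\<dots> = (\<Sum>k\<in>K. \<Sum>l\<in>K. c k * c l * increment_cov H (fst (f k)) (snd (f k)) (fst (f l)) (snd (f l)))"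
      unfolding sum.distrib[symmetric]
      by (intro sum.cong refl) (simp add: inc algebra_simps)
    finally show ?thesis .
  qed
  finally show "centred_normal M (\<Sum>k\<in>K. \<Sum>l\<in>K. c k * c l * increment_cov H (fst (f k)) (snd (f k)) (fst (f l)) (snd (f l)))
     (\<lambda>\<omega>. \<Sum>k\<in>K. c k * (B (fst (f k)) \<omega> - B (snd (f k)) \<omega>))" .
qed

text \<open>The sum and the difference of two increments have nonnegative variance
  (\<open>e = 1\<close> and \<open>e = -1\<close>), which bounds twice the covariance in absolute
  value by the sum of the two variances.\<close>

lemma increment_cov_bound:
  assumes "prob_space M" and B: "fractional_brownian_motion M H B" and "0 \<le> t" "0 \<le> t'" "0 \<le> s" "0 \<le> s'"
  shows "\<bar>increment_cov H t t' s s'\<bar> \<le> (\<bar>t - t'\<bar> powr (2 * H) + \<bar>s - s'\<bar> powr (2 * H)) / 2"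
proof -
  have "0 \<le> \<bar>t - t'\<bar> powr (2 * H) + e * 2 * increment_cov H t t' s s' + \<bar>s - s'\<bar> powr (2 * H)" if "e * e = 1" for e
  proof -
    let ?f = "\<lambda>b. if b then (t, t') else (s, s')"
    have "centred_normal M (\<Sum>b\<in>UNIV. \<Sum>b'\<in>UNIV. (if b then 1 else e) * (if b' then 1 else e) *
        increment_cov H (fst (?f b)) (snd (?f b)) (fst (?f b')) (snd (?f b')))
      (\<lambda>\<omega>. \<Sum>b\<in>UNIV. (if b then 1 else e) * (B (fst (?f b)) \<omega> - B (snd (?f b)) \<omega>))"
      using assms by (intro gaussian_family_comb[OF fbm_increment_family[OF assms(1,2)]]) auto
    then have "0 \<le> (\<Sum>b\<in>UNIV. \<Sum>b'\<in>UNIV. (if b then 1 else e) * (if b' then 1 else e) *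
        increment_cov H (fst (?f b)) (snd (?f b)) (fst (?f b')) (snd (?f b')))"
      by (simp add: centred_normal_def)
    also have "\<dots> = increment_cov H t t' t t' + e * increment_cov H t t' s s' + e * increment_cov H s s' t t' + (e * e) * increment_cov H s s' s s'"
      by (simp add: UNIV_bool)
    also have "increment_cov H s s' t t' = increment_cov H t t' s s'"
      by (simp add: increment_cov_def abs_minus_commute)
    also have "increment_cov H t t' t t' = \<bar>t - t'\<bar> powr (2 * H)"
      by (simp add: increment_cov_def abs_minus_commute)
    also have "increment_cov H s s' s s' = \<bar>s - s'\<bar> powr (2 * H)"
      by (simp add: increment_cov_def abs_minus_commute)
    finally show ?thesis using that by simp
  qed
  from this[of 1] this[of "-1"]
  have "0 \<le> \<bar>t - t'\<bar> powr (2 * H) + 2 * increment_cov H t t' s s' + \<bar>s - s'\<bar> powr (2 * H)"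
    "0 \<le> \<bar>t - t'\<bar> powr (2 * H) - 2 * increment_cov H t t' s s' + \<bar>s - s'\<bar> powr (2 * H)"
    by simp_all
  moreover have "\<bar>c\<bar> \<le> (a + b) / 2" if "0 \<le> a + 2 * c + b" "0 \<le> a - 2 * c + b" for a b c :: real
    using that by (simp add: abs_le_iff field_simps)
  ultimately show ?thesis by blast
qed

lemma increment_cov_measurable [measurable]:
  assumes [measurable]: "f \<in> borel_measurable N" "f' \<in> borel_measurable N" "g \<in> borel_measurable N" "g' \<in> borel_measurable N"
  shows "(\<lambda>x. increment_cov H (f x) (f' x) (g x) (g' x)) \<in> borel_measurable N"
  unfolding increment_cov_def by measurable

lemma increment_cov_tendsto:
  assumes "0 < H" "f \<longlonglongrightarrow> t'" "g \<longlonglongrightarrow> s'"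
  shows "(\<lambda>n. increment_cov H t (f n) s (g n)) \<longlonglongrightarrow> increment_cov H t t' s s'"
  unfolding increment_cov_def using \<open>0 < H\<close>
  by (intro tendsto_intros tendsto_powr' assms) auto

text \<open>Also valid when \<open>f\<close> is not integrable, because its integral is then 0 while
  \<open>g\<close> is nonnegative. Iterated integrals can thus be bounded without measurability side
  conditions.\<close>

lemma abs_integral_le:
  fixes f g :: "'a \<Rightarrow> real"
  assumes "integrable N g" "\<And>x. \<bar>f x\<bar> \<le> g x"
  shows "\<bar>integral\<^sup>L N f\<bar> \<le> integral\<^sup>L N g"
proof (cases "integrable N f")
  case True
  have "\<bar>integral\<^sup>L N f\<bar> \<le> (LINT x|N. \<bar>f x\<bar>)" using integral_norm_bound[of N f] by simp
  also have "\<dots> \<le> integral\<^sup>L N g" using True assms by (intro integral_mono) auto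
  finally show ?thesis .
next
  case False
  moreover have "0 \<le> integral\<^sup>L N g"
    by (intro integral_nonneg_AE AE_I2 order_trans[OF abs_ge_zero assms(2)])
  ultimately show ?thesis by (simp add: not_integrable_integral_eq)
qed

lemma increment_cov_back_bound:
  assumes "prob_space M" and B: "fractional_brownian_motion M H B" and "0 < H" "0 \<le> t" "0 \<le> s"
    "0 \<le> t'" "t' \<le> t" "0 \<le> s'" "s' \<le> s"
  shows "\<bar>increment_cov H t t' s s'\<bar> \<le> t powr (2 * H) + s powr (2 * H)"
proof -
  have "\<bar>t - t'\<bar> powr (2 * H) \<le> t powr (2 * H)" "\<bar>s - s'\<bar> powr (2 * H) \<le> s powr (2 * H)"
    using assms by (auto intro!: powr_mono2)
  moreover have "(a + b) / 2 \<le> a' + b'" if "a \<le> a'" "b \<le> b'" "0 \<le> a'" "0 \<le> b'" for a b a' b' :: real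
    using that by (simp add: field_simps)
  moreover have "\<bar>increment_cov H t t' s s'\<bar> \<le> (\<bar>t - t'\<bar> powr (2 * H) + \<bar>s - s'\<bar> powr (2 * H)) / 2"
    using assms by (intro increment_cov_bound[OF assms(1,2)]) auto
  ultimately show ?thesis by (meson order_trans powr_ge_zero)
qed

text \<open>Dominated convergence in each variable: rounded lookback times stay in
  \<open>[0, t]\<close> and \<open>[0, s]\<close>, so one constant \<open>C\<close> bounds the
  covariances on all grids.\<close>

lemma kernel_cov_grid_tendsto:
  assumes "prob_space M" and B: "fractional_brownian_motion M H B" and "0 < H" and k: "integrable lborel k"
    and ts: "0 \<le> t" "0 \<le> s"
  shows "(\<lambda>m. LINT x|lborel. LINT y|lborel. k x * (k y *
       increment_cov H t (real (grid_back (Suc m) t x) / real (Suc m)) s (real (grid_back (Suc m) s y) / real (Suc m))))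
     \<longlonglongrightarrow> kernel_cov H k t s"
proof -
  have [measurable]: "k \<in> borel_measurable borel" using k by auto
  let ?g = "\<lambda>m t x. real (grid_back (Suc m) t x) / real (Suc m)"
  have g: "0 \<le> ?g m t x" "?g m t x \<le> t" if "0 \<le> t" for m t x
    using grid_back_bounds(1)[of "Suc m" t x] lookback_le[OF that, of x] by auto
  define C where "C = t powr (2 * H) + s powr (2 * H)"
  have bd: "\<bar>k x * (k y * increment_cov H t (?g m t x) s (?g m s y))\<bar> \<le> C * \<bar>k x\<bar> * \<bar>k y\<bar>" for m x y
  proof -
    have "\<bar>increment_cov H t (?g m t x) s (?g m s y)\<bar> \<le> C"
      unfolding C_def using g ts by (intro increment_cov_back_bound[OF assms(1-3)]) auto
    then have "\<bar>k x\<bar> * \<bar>k y\<bar> * \<bar>increment_cov H t (?g m t x) s (?g m s y)\<bar> \<le> \<bar>k x\<bar> * \<bar>k y\<bar> * C"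
      by (rule mult_left_mono) simp
    then show ?thesis by (simp add: abs_mult mult_ac)
  qed
  have inner: "(\<lambda>m. LINT y|lborel. k x * (k y * increment_cov H t (?g m t x) s (?g m s y)))
      \<longlonglongrightarrow> (LINT y|lborel. k x * (k y * increment_cov H t (lookback t x) s (lookback s y)))" for x
  proof (rule integral_dominated_convergence[where w="\<lambda>y. C * \<bar>k x\<bar> * \<bar>k y\<bar>"])
    show "AE y in lborel. (\<lambda>m. k x * (k y * increment_cov H t (?g m t x) s (?g m s y)))
       \<longlonglongrightarrow> k x * (k y * increment_cov H t (lookback t x) s (lookback s y))"
      by (intro AE_I2 tendsto_intros increment_cov_tendsto grid_back_tendsto \<open>0 < H\<close>)
    show "integrable lborel (\<lambda>y. C * \<bar>k x\<bar> * \<bar>k y\<bar>)" using k by auto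
  qed (use bd in auto)
  show ?thesis unfolding kernel_cov_def
  proof (rule integral_dominated_convergence[where w="\<lambda>x. C * \<bar>k x\<bar> * (LINT y|lborel. \<bar>k y\<bar>)"])
    show "AE x in lborel. (\<lambda>m. LINT y|lborel. k x * (k y * increment_cov H t (?g m t x) s (?g m s y)))
       \<longlonglongrightarrow> (LINT y|lborel. k x * (k y * increment_cov H t (lookback t x) s (lookback s y)))"
      by (intro AE_I2 inner)
    show "integrable lborel (\<lambda>x. C * \<bar>k x\<bar> * (LINT y|lborel. \<bar>k y\<bar>))" using k by auto
    show "AE x in lborel. norm (LINT y|lborel. k x * (k y * increment_cov H t (?g m t x) s (?g m s y)))
        \<le> C * \<bar>k x\<bar> * (LINT y|lborel. \<bar>k y\<bar>)" for m
      using abs_integral_le[of lborel "\<lambda>y. C * \<bar>k x\<bar> * \<bar>k y\<bar>" for x, OF _ bd[where m=m]] k by auto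
  qed auto
qed

text \<open>Rounding the lookback time to a grid turns the integral into a finite combination of increments whose
  covariance is exactly the kernel covariance with rounded times.\<close>

lemma kernel_gaussian_family:
  assumes "prob_space M" and B: "fractional_brownian_motion M H B" and "0 < H" and k: "integrable lborel k"
    and W: "\<And>t. 0 \<le> t \<Longrightarrow> W t \<in> borel_measurable M"
      "AE \<omega> in M. \<forall>t\<ge>0. W t \<omega> = (LINT x|lborel. k x * (B t \<omega> - B (lookback t x) \<omega>))"
  shows "gaussian_family M {0..} W (kernel_cov H k)"
  unfolding gaussian_family_def
proof (intro allI impI)
  interpret prob_space M by fact
  have [measurable]: "k \<in> borel_measurable borel" using k by auto
  let ?g = "\<lambda>m t x. real (grid_back (Suc m) t x) / real (Suc m)"
  define N where "N = (\<lambda>m t. nat \<lfloor>real (Suc m) * t\<rfloor>)"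
  define w where "w = (\<lambda>m t j. LINT x|lborel. k x * of_bool (grid_back (Suc m) t x = j))"
  fix K :: "nat set" and f :: "nat \<Rightarrow> real" and c :: "nat \<Rightarrow> real"
  assume K: "finite K" "f ` K \<subseteq> {0..}"
  define r where "r = (\<lambda>m t s. LINT x|lborel. LINT y|lborel. k x * (k y *
       increment_cov H t (?g m t x) s (?g m s y)))"
  define L where "L = (\<lambda>m \<omega>. \<Sum>i\<in>K. c i * (LINT x|lborel. k x * (B (f i) \<omega> - B (?g m (f i) x) \<omega>)))"
  have f: "0 \<le> f i" if "i \<in> K" for i using K that by auto
  have r_eq: "r m t s = (\<Sum>j\<le>N m t. \<Sum>l\<le>N m s. w m t j * w m s l * increment_cov H t (real j / real (Suc m)) s (real l / real (Suc m)))"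
    if "0 \<le> t" "0 \<le> s" for m t s
  proof -
    have "r m t s = (LINT x|lborel. k x * (LINT y|lborel. k y * increment_cov H t (?g m t x) s (?g m s y)))"
      by (simp add: r_def)
    also have "\<dots> = (LINT x|lborel. k x * (\<Sum>l\<le>N m s. w m s l * increment_cov H t (?g m t x) s (real l / real (Suc m))))"
      using step_integral(2)[OF k \<open>0 \<le> s\<close>, of "\<lambda>l. increment_cov H t (?g m t x) s (real l / real (Suc m))" "Suc m" for x]
      by (simp add: N_def w_def)
    also have "\<dots> = (\<Sum>j\<le>N m t. w m t j * (\<Sum>l\<le>N m s. w m s l * increment_cov H t (real j / real (Suc m)) s (real l / real (Suc m))))"
      using step_integral(2)[OF k \<open>0 \<le> t\<close>, of "\<lambda>j. \<Sum>l\<le>N m s. w m s l * increment_cov H t (real j / real (Suc m)) s (real l / real (Suc m))" "Suc m"]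
      by (simp add: N_def w_def)
    finally show ?thesis by (simp add: sum_distrib_left mult_ac)
  qed
  show "centred_normal M (\<Sum>i\<in>K. \<Sum>l\<in>K. c i * c l * kernel_cov H k (f i) (f l)) (\<lambda>\<omega>. \<Sum>i\<in>K. c i * W (f i) \<omega>)"
  proof (rule centred_normal_limit[OF prob_space_axioms])
    show "(\<lambda>m. \<Sum>i\<in>K. \<Sum>l\<in>K. c i * c l * r m (f i) (f l)) \<longlonglongrightarrow> (\<Sum>i\<in>K. \<Sum>l\<in>K. c i * c l * kernel_cov H k (f i) (f l))"
      unfolding r_def using f by (intro tendsto_intros kernel_cov_grid_tendsto[OF assms(1-4)]) auto
    show "(\<lambda>\<omega>. \<Sum>i\<in>K. c i * W (f i) \<omega>) \<in> borel_measurable M"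
      using f W(1) by (intro borel_measurable_sum borel_measurable_times) auto
    have "AE \<omega> in M. continuous_on {0..} (\<lambda>t. B t \<omega>)"
      using B by (simp add: fractional_brownian_motion_def)
    then show "AE \<omega> in M. (\<lambda>m. L m \<omega>) \<longlonglongrightarrow> (\<Sum>i\<in>K. c i * W (f i) \<omega>)"
      using W(2)
    proof eventually_elim
      case (elim \<omega>)
      have "(\<lambda>m. LINT x|lborel. k x * (B t \<omega> - B (?g m t x) \<omega>)) \<longlonglongrightarrow> W t \<omega>" if "0 \<le> t" for t
      proof -
        have g: "0 \<le> ?g m t x" "?g m t x \<le> t" for m x
          using grid_back_bounds(1)[of "Suc m" t x] lookback_le[OF \<open>0 \<le> t\<close>, of x] by auto
        have "compact ((\<lambda>u. B u \<omega>) ` {0..t})"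
          using elim(1) by (intro compact_continuous_image continuous_on_subset[OF elim(1)]) auto
        then obtain C where C: "\<And>u. 0 \<le> u \<Longrightarrow> u \<le> t \<Longrightarrow> \<bar>B u \<omega>\<bar> \<le> C"
          by (metis (no_types, lifting) compact_imp_bounded bounded_real atLeastAtMost_iff imageI)
        have "continuous_on UNIV (\<lambda>x. B (lookback t x) \<omega>)"
          unfolding lookback_def by (rule continuous_on_compose2[OF elim(1)]) (auto intro!: continuous_intros)
        then have [measurable]: "(\<lambda>x. B (lookback t x) \<omega>) \<in> borel_measurable borel"
          by (rule borel_measurable_continuous_onI)
        have "(\<lambda>m. LINT x|lborel. k x * (B t \<omega> - B (?g m t x) \<omega>)) \<longlonglongrightarrow> (LINT x|lborel. k x * (B t \<omega> - B (lookback t x) \<omega>))"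
        proof (rule integral_dominated_convergence[where w="\<lambda>x. \<bar>k x\<bar> * (2 * C)"])
          show "(\<lambda>x. k x * (B t \<omega> - B (?g m t x) \<omega>)) \<in> borel_measurable lborel" for m
            using step_integral(1)[OF k that, of "\<lambda>j. B t \<omega> - B (real j / real (Suc m)) \<omega>" "Suc m"]
            by (rule borel_measurable_integrable)
          show "AE x in lborel. (\<lambda>m. k x * (B t \<omega> - B (?g m t x) \<omega>)) \<longlonglongrightarrow> k x * (B t \<omega> - B (lookback t x) \<omega>)"
            by (intro AE_I2 tendsto_intros continuous_on_tendsto_compose[OF elim(1) grid_back_tendsto])
               (auto intro!: always_eventually)
          show "integrable lborel (\<lambda>x. \<bar>k x\<bar> * (2 * C))" using k by auto
          show "AE x in lborel. norm (k x * (B t \<omega> - B (?g m t x) \<omega>)) \<le> \<bar>k x\<bar> * (2 * C)" for m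
          proof (intro AE_I2)
            fix x
            have "\<bar>B t \<omega> - B (?g m t x) \<omega>\<bar> \<le> 2 * C"
              using C[OF \<open>0 \<le> t\<close> order_refl] C[OF g[of m x]] by linarith
            then show "norm (k x * (B t \<omega> - B (?g m t x) \<omega>)) \<le> \<bar>k x\<bar> * (2 * C)"
              by (auto simp: abs_mult intro!: mult_left_mono)
          qed
        qed simp
        then show ?thesis using elim(2) that by simp
      qed
      then show ?case unfolding L_def using f by (intro tendsto_intros) auto
    qed
    fix m
    \<comment> \<open>A pair \<open>(i, j)\<close> stands for the increment of \<open>B\<close> from
      \<open>j / Suc m\<close> to \<open>f i\<close>; its weight is the mass that \<open>k\<close>
      gives to the cell rounded to \<open>j\<close>.\<close>
    let ?S = "Sigma K (\<lambda>i. {..N m (f i)})"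
    have "finite ?S" "(\<lambda>x. (f (fst x), real (snd x) / real (Suc m))) ` ?S \<subseteq> {0..} \<times> {0..}"
      using K f by auto
    from gaussian_family_comb[OF fbm_increment_family[OF assms(1,2)] this, of "\<lambda>x. c (fst x) * w m (f (fst x)) (snd x)"]
    have "centred_normal M
      (\<Sum>x\<in>Sigma K (\<lambda>i. {..N m (f i)}). \<Sum>y\<in>Sigma K (\<lambda>i. {..N m (f i)}). (c (fst x) * w m (f (fst x)) (snd x)) * (c (fst y) * w m (f (fst y)) (snd y)) *
          increment_cov H (f (fst x)) (real (snd x) / real (Suc m)) (f (fst y)) (real (snd y) / real (Suc m)))
      (\<lambda>\<omega>. \<Sum>x\<in>Sigma K (\<lambda>i. {..N m (f i)}). (c (fst x) * w m (f (fst x)) (snd x)) * (B (f (fst x)) \<omega> - B (real (snd x) / real (Suc m)) \<omega>))"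
      unfolding fst_conv snd_conv .
    also have "(\<lambda>\<omega>. \<Sum>x\<in>Sigma K (\<lambda>i. {..N m (f i)}). (c (fst x) * w m (f (fst x)) (snd x)) * (B (f (fst x)) \<omega> - B (real (snd x) / real (Suc m)) \<omega>)) = L m"
    proof
      fix \<omega>
      have "L m \<omega> = (\<Sum>i\<in>K. \<Sum>j\<le>N m (f i). c i * w m (f i) j * (B (f i) \<omega> - B (real j / real (Suc m)) \<omega>))"
        unfolding L_def
      proof (intro sum.cong refl)
        fix i assume "i \<in> K"
        from step_integral(2)[OF k f[OF this], of "\<lambda>j. B (f i) \<omega> - B (real j / real (Suc m)) \<omega>" "Suc m"]
        show "c i * (LINT x|lborel. k x * (B (f i) \<omega> - B (?g m (f i) x) \<omega>)) =
           (\<Sum>j\<le>N m (f i). c i * w m (f i) j * (B (f i) \<omega> - B (real j / real (Suc m)) \<omega>))"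
          by (simp add: N_def w_def sum_distrib_left mult_ac)
      qed
      then show "(\<Sum>x\<in>Sigma K (\<lambda>i. {..N m (f i)}). (c (fst x) * w m (f (fst x)) (snd x)) * (B (f (fst x)) \<omega> - B (real (snd x) / real (Suc m)) \<omega>)) = L m \<omega>"
        using K by (subst (asm) sum.Sigma) (auto simp: case_prod_beta)
    qed
    also have "(\<Sum>x\<in>Sigma K (\<lambda>i. {..N m (f i)}). \<Sum>y\<in>Sigma K (\<lambda>i. {..N m (f i)}). (c (fst x) * w m (f (fst x)) (snd x)) * (c (fst y) * w m (f (fst y)) (snd y)) *
          increment_cov H (f (fst x)) (real (snd x) / real (Suc m)) (f (fst y)) (real (snd y) / real (Suc m)))
       = (\<Sum>i\<in>K. \<Sum>l\<in>K. c i * c l * r m (f i) (f l))"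
    proof -
      have S: "(\<Sum>x\<in>Sigma K (\<lambda>i. {..N m (f i)}). g (fst x) (snd x)) = (\<Sum>i\<in>K. \<Sum>j\<le>N m (f i). g i j)" for g :: "nat \<Rightarrow> nat \<Rightarrow> real"
        using K by (subst sum.Sigma) (auto simp: case_prod_beta)
      have "(\<Sum>i\<in>K. \<Sum>l\<in>K. c i * c l * r m (f i) (f l)) = (\<Sum>i\<in>K. \<Sum>l\<in>K. \<Sum>j\<le>N m (f i). \<Sum>n\<le>N m (f l).
          (c i * w m (f i) j) * (c l * w m (f l) n) * increment_cov H (f i) (real j / real (Suc m)) (f l) (real n / real (Suc m)))"
        using f by (intro sum.cong refl) (simp add: r_eq sum_distrib_left mult_ac)
      also have "\<dots> = (\<Sum>i\<in>K. \<Sum>j\<le>N m (f i). \<Sum>l\<in>K. \<Sum>n\<le>N m (f l).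
          (c i * w m (f i) j) * (c l * w m (f l) n) * increment_cov H (f i) (real j / real (Suc m)) (f l) (real n / real (Suc m)))"
        by (intro sum.cong refl sum.swap)
      finally show ?thesis
        using S[of "\<lambda>l n. (c i * w m (f i) j) * (c l * w m (f l) n) * increment_cov H (f i) (real j / real (Suc m)) (f l) (real n / real (Suc m))" for i j]
          S[of "\<lambda>i j. \<Sum>l\<in>K. \<Sum>n\<le>N m (f l). (c i * w m (f i) j) * (c l * w m (f l) n) * increment_cov H (f i) (real j / real (Suc m)) (f l) (real n / real (Suc m))"]
        by simp
    qed
    finally show "centred_normal M (\<Sum>i\<in>K. \<Sum>l\<in>K. c i * c l * r m (f i) (f l)) (L m)" .
  qed
qed

section \<open>Iterated integrals of covariances against two kernels\<close>

definition double_integral :: "(real \<Rightarrow> real) \<Rightarrow> (real \<Rightarrow> real) \<Rightarrow> (real \<Rightarrow> real \<Rightarrow> real) \<Rightarrow> real" where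
  "double_integral k l \<kappa> = (LINT x|lborel. LINT y|lborel. k x * (l y * \<kappa> x y))"

text \<open>The weight matches \<open>increment_cov_decay\<close>: the covariance functions below
  are all bounded by a constant times
  \<open>(1 + \<bar>x\<bar>) ^ 3 * (1 + \<bar>y\<bar>) ^ 3\<close>, which makes their double
  integrals finite.\<close>

definition cubic_integrable :: "(real \<Rightarrow> real) \<Rightarrow> bool" where
  "cubic_integrable k \<longleftrightarrow> k \<in> borel_measurable borel \<and> integrable lborel (\<lambda>x. \<bar>k x\<bar> * (1 + \<bar>x\<bar>) ^ 3)"

definition cubic_norm :: "(real \<Rightarrow> real) \<Rightarrow> real" where
  "cubic_norm k = (LINT x|lborel. \<bar>k x\<bar> * (1 + \<bar>x\<bar>) ^ 3)"

lemma cubic_integrableD: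
  assumes "cubic_integrable k"
  shows "k \<in> borel_measurable borel" "integrable lborel (\<lambda>x. \<bar>k x\<bar> * (1 + \<bar>x\<bar>) ^ 3)" "integrable lborel k"
proof -
  show k: "k \<in> borel_measurable borel" and i: "integrable lborel (\<lambda>x. \<bar>k x\<bar> * (1 + \<bar>x\<bar>) ^ 3)"
    using assms by (auto simp: cubic_integrable_def)
  show "integrable lborel k"
  proof (rule Bochner_Integration.integrable_bound[OF i])
    have "\<bar>k x\<bar> * 1 \<le> \<bar>k x\<bar> * (1 + \<bar>x\<bar>) ^ 3" for x by (intro mult_left_mono one_le_power) auto
    then show "AE x in lborel. norm (k x) \<le> norm (\<bar>k x\<bar> * (1 + \<bar>x\<bar>) ^ 3)" by (simp add: abs_mult)
  qed (use k in auto)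
qed

lemma
  assumes k: "cubic_integrable k" and l: "cubic_integrable l"
    and \<kappa>: "case_prod \<kappa> \<in> borel_measurable (borel \<Otimes>\<^sub>M borel)" "\<And>x y. \<bar>\<kappa> x y\<bar> \<le> C * ((1 + \<bar>x\<bar>) ^ 3 * (1 + \<bar>y\<bar>) ^ 3)"
  shows double_integral_inner: "integrable lborel (\<lambda>y. k x * (l y * \<kappa> x y))"
    and double_integral_outer: "integrable lborel (\<lambda>x. LINT y|lborel. k x * (l y * \<kappa> x y))"
    and double_integral_bound: "\<bar>double_integral k l \<kappa>\<bar> \<le> C * cubic_norm k * cubic_norm l"
proof -
  note [measurable] = cubic_integrableD(1)[OF k] cubic_integrableD(1)[OF l]
  have \<kappa>m [measurable]: "(\<lambda>z. \<kappa> (f z) (g z)) \<in> borel_measurable N"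
    if [measurable]: "f \<in> borel_measurable N" "g \<in> borel_measurable N" for f g and N :: "'c measure"
    using measurable_compose[OF _ \<kappa>(1), of "\<lambda>z. (f z, g z)" N] by simp
  have bd: "\<bar>k x * (l y * \<kappa> x y)\<bar> \<le> (C * (\<bar>k x\<bar> * (1 + \<bar>x\<bar>) ^ 3)) * (\<bar>l y\<bar> * (1 + \<bar>y\<bar>) ^ 3)" for x y
    using mult_left_mono[OF \<kappa>(2)[of x y], of "\<bar>k x\<bar> * \<bar>l y\<bar>"] by (simp add: abs_mult mult_ac)
  have C: "0 \<le> C" using order_trans[OF abs_ge_zero \<kappa>(2)[of 0 0]] by simp
  have int_l: "integrable lborel (\<lambda>y. c * (\<bar>l y\<bar> * (1 + \<bar>y\<bar>) ^ 3))" for c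
    using cubic_integrableD(2)[OF l] by simp
  have int_k: "integrable lborel (\<lambda>x. C * (\<bar>k x\<bar> * (1 + \<bar>x\<bar>) ^ 3) * cubic_norm l)"
    using cubic_integrableD(2)[OF k] by simp
  show "integrable lborel (\<lambda>y. k x * (l y * \<kappa> x y))" for x
  proof (rule Bochner_Integration.integrable_bound[OF int_l[of "C * (\<bar>k x\<bar> * (1 + \<bar>x\<bar>) ^ 3)"]])
    show "AE y in lborel. norm (k x * (l y * \<kappa> x y)) \<le> norm (C * (\<bar>k x\<bar> * (1 + \<bar>x\<bar>) ^ 3) * (\<bar>l y\<bar> * (1 + \<bar>y\<bar>) ^ 3))"
      unfolding real_norm_def by (intro AE_I2 order_trans[OF bd abs_ge_self])
  qed measurable
  have bd2: "\<bar>LINT y|lborel. k x * (l y * \<kappa> x y)\<bar> \<le> C * (\<bar>k x\<bar> * (1 + \<bar>x\<bar>) ^ 3) * cubic_norm l" for x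
    using abs_integral_le[OF int_l bd[of x]] by (simp add: cubic_norm_def)
  show "integrable lborel (\<lambda>x. LINT y|lborel. k x * (l y * \<kappa> x y))"
  proof (rule Bochner_Integration.integrable_bound[OF int_k])
    show "AE x in lborel. norm (LINT y|lborel. k x * (l y * \<kappa> x y)) \<le> norm (C * (\<bar>k x\<bar> * (1 + \<bar>x\<bar>) ^ 3) * cubic_norm l)"
      unfolding real_norm_def by (intro AE_I2 order_trans[OF bd2 abs_ge_self])
  qed measurable
  show "\<bar>double_integral k l \<kappa>\<bar> \<le> C * cubic_norm k * cubic_norm l"
    unfolding double_integral_def using abs_integral_le[OF int_k bd2] by (simp add: cubic_norm_def)
qed

lemma double_integral_add_scaled:
  assumes k: "cubic_integrable k" and l: "cubic_integrable l"
    and \<kappa>: "case_prod \<kappa> \<in> borel_measurable (borel \<Otimes>\<^sub>M borel)" "\<And>x y. \<bar>\<kappa> x y\<bar> \<le> C * ((1 + \<bar>x\<bar>) ^ 3 * (1 + \<bar>y\<bar>) ^ 3)"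
    and \<kappa>': "case_prod \<kappa>' \<in> borel_measurable (borel \<Otimes>\<^sub>M borel)" "\<And>x y. \<bar>\<kappa>' x y\<bar> \<le> C' * ((1 + \<bar>x\<bar>) ^ 3 * (1 + \<bar>y\<bar>) ^ 3)"
  shows "double_integral k l (\<lambda>x y. \<kappa> x y + c * \<kappa>' x y) = double_integral k l \<kappa> + c * double_integral k l \<kappa>'"
proof -
  have "k x * (l y * (\<kappa> x y + c * \<kappa>' x y)) = k x * (l y * \<kappa> x y) + c * (k x * (l y * \<kappa>' x y))" for x y
    by (simp add: algebra_simps)
  then have "double_integral k l (\<lambda>x y. \<kappa> x y + c * \<kappa>' x y)
    = (LINT x|lborel. LINT y|lborel. k x * (l y * \<kappa> x y) + c * (k x * (l y * \<kappa>' x y)))"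
    by (simp add: double_integral_def)
  also have "\<dots> = (LINT x|lborel. (LINT y|lborel. k x * (l y * \<kappa> x y)) + c * (LINT y|lborel. k x * (l y * \<kappa>' x y)))"
    by (subst Bochner_Integration.integral_add) 
      (intro double_integral_inner[OF k l \<kappa>] integrable_mult_right double_integral_inner[OF k l \<kappa>'] | simp)+
  also have "\<dots> = double_integral k l \<kappa> + c * double_integral k l \<kappa>'"
    unfolding double_integral_def
    by (subst Bochner_Integration.integral_add) 
      (intro double_integral_outer[OF k l \<kappa>] integrable_mult_right double_integral_outer[OF k l \<kappa>'] | simp)+
  finally show ?thesis .
qed

lemma double_integral_left_comb:
  assumes k: "cubic_integrable k" and k': "cubic_integrable k'" and l: "cubic_integrable l"
    and \<kappa>: "case_prod \<kappa> \<in> borel_measurable (borel \<Otimes>\<^sub>M borel)" "\<And>x y. \<bar>\<kappa> x y\<bar> \<le> C * ((1 + \<bar>x\<bar>) ^ 3 * (1 + \<bar>y\<bar>) ^ 3)"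
  shows "double_integral (\<lambda>x. p * k x + q * k' x) l \<kappa> = p * double_integral k l \<kappa> + q * double_integral k' l \<kappa>"
proof -
  have "(p * k x + q * k' x) * (l y * \<kappa> x y) = p * (k x * (l y * \<kappa> x y)) + q * (k' x * (l y * \<kappa> x y))" for x y
    by (simp add: algebra_simps)
  then have "double_integral (\<lambda>x. p * k x + q * k' x) l \<kappa>
    = (LINT x|lborel. LINT y|lborel. p * (k x * (l y * \<kappa> x y)) + q * (k' x * (l y * \<kappa> x y)))"
    by (simp add: double_integral_def)
  also have "\<dots> = (LINT x|lborel. p * (LINT y|lborel. k x * (l y * \<kappa> x y)) + q * (LINT y|lborel. k' x * (l y * \<kappa> x y)))"
    by (subst Bochner_Integration.integral_add) 
      (intro integrable_mult_right double_integral_inner[OF k l \<kappa>] double_integral_inner[OF k' l \<kappa>] | simp)+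
  also have "\<dots> = p * double_integral k l \<kappa> + q * double_integral k' l \<kappa>"
    unfolding double_integral_def
    by (subst Bochner_Integration.integral_add) 
      (intro integrable_mult_right double_integral_outer[OF k l \<kappa>] double_integral_outer[OF k' l \<kappa>] | simp)+
  finally show ?thesis .
qed

lemma double_integral_right_comb:
  assumes k: "cubic_integrable k" and l: "cubic_integrable l" and l': "cubic_integrable l'"
    and \<kappa>: "case_prod \<kappa> \<in> borel_measurable (borel \<Otimes>\<^sub>M borel)" "\<And>x y. \<bar>\<kappa> x y\<bar> \<le> C * ((1 + \<bar>x\<bar>) ^ 3 * (1 + \<bar>y\<bar>) ^ 3)"
  shows "double_integral k (\<lambda>y. p * l y + q * l' y) \<kappa> = p * double_integral k l \<kappa> + q * double_integral k l' \<kappa>"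
proof -
  have "k x * ((p * l y + q * l' y) * \<kappa> x y) = p * (k x * (l y * \<kappa> x y)) + q * (k x * (l' y * \<kappa> x y))" for x y
    by (simp add: algebra_simps)
  then have "double_integral k (\<lambda>y. p * l y + q * l' y) \<kappa>
    = (LINT x|lborel. LINT y|lborel. p * (k x * (l y * \<kappa> x y)) + q * (k x * (l' y * \<kappa> x y)))"
    by (simp add: double_integral_def)
  also have "\<dots> = (LINT x|lborel. p * (LINT y|lborel. k x * (l y * \<kappa> x y)) + q * (LINT y|lborel. k x * (l' y * \<kappa> x y)))"
    by (subst Bochner_Integration.integral_add) 
      (intro integrable_mult_right double_integral_inner[OF k l \<kappa>] double_integral_inner[OF k l' \<kappa>] | simp)+
  also have "\<dots> = p * double_integral k l \<kappa> + q * double_integral k l' \<kappa>"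
    unfolding double_integral_def
    by (subst Bochner_Integration.integral_add) 
      (intro integrable_mult_right double_integral_outer[OF k l \<kappa>] double_integral_outer[OF k l' \<kappa>] | simp)+
  finally show ?thesis .
qed

section \<open>Decay and regularity of the covariance, limit on its diagonal\<close>

lemma powr_diff_le:
  fixes a b q :: real
  assumes "0 < a" "a \<le> b" "0 < q" "q < 1"
  shows "b powr q - a powr q \<le> q * a powr (q - 1) * (b - a)"
proof (cases "a = b")
  case False
  with assms have "a < b" by simp
  have "\<exists>z>a. z < b \<and> b powr q - a powr q = (b - a) * (q * z powr (q - 1))"
    by (rule MVT2[OF \<open>a < b\<close>]) (use assms in \<open>auto intro!: derivative_eq_intros\<close>)
  then obtain z where z: "a < z" "b powr q - a powr q = (b - a) * (q * z powr (q - 1))" by blast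
  have "z powr (q - 1) \<le> a powr (q - 1)"
    using assms z by (intro powr_mono2') auto
  then show ?thesis using assms z by (simp add: mult_left_mono mult_ac)
qed auto

lemma powr_le_square:
  fixes x h :: real
  assumes "0 \<le> x" "0 \<le> h" "h \<le> 2"
  shows "x powr h \<le> (1 + x)\<^sup>2"
proof -
  have "x powr h \<le> (1 + x) powr h" using assms by (intro powr_mono2) auto
  also have "\<dots> \<le> (1 + x) powr 2" using assms by (intro powr_mono) auto
  finally show ?thesis using assms by simp
qed

lemma half_sum_squares_le:
  fixes X Y :: real
  assumes "0 \<le> X" "0 \<le> Y"
  shows "((1 + X)\<^sup>2 + (1 + Y)\<^sup>2) / 2 \<le> (1 + X)\<^sup>2 * (1 + Y)\<^sup>2"
proof -
  have "(a + b) / 2 \<le> a * b" if "1 \<le> a" "1 \<le> b" for a b :: real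
  proof -
    have "1 * b \<le> a * b" "a * 1 \<le> a * b" using that by (intro mult_mono; simp)+
    then show ?thesis by (simp add: field_simps)
  qed
  then show ?thesis using assms by (simp add: one_le_power)
qed

text \<open>If the two increments are far apart, the covariance is a second difference of \<open>u\<^sup>2\<^sup>H\<close>, estimated by the mean
  value theorem applied twice; otherwise the bound by the variances is already enough.\<close>

lemma increment_cov_decay_ordered:
  assumes "prob_space M" and B: "fractional_brownian_motion M H B" and H: "1 / 2 < H" "H < 1"
    and "0 \<le> t'" "t' \<le> t" "0 \<le> s'" "s' \<le> s" "s \<le> t"
  shows "\<bar>increment_cov H t t' s s'\<bar> \<le> 4 * (1 + (t - t')) ^ 3 * (1 + (s - s')) ^ 3 * (1 + \<bar>t - s\<bar>) powr (2 * H - 2)"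
proof -
  define X Y d \<gamma> where "X = t - t'" "Y = s - s'" "d = t - s" "\<gamma> = 2 - 2 * H"
  note defs = this
  have nn: "0 \<le> X" "0 \<le> Y" "0 \<le> d" "0 < \<gamma>" "\<gamma> < 1" using assms by (auto simp: defs)
  have one: "1 \<le> (1 + X) ^ 3" "1 \<le> (1 + Y) ^ 3" using nn by (auto intro!: one_le_power)
  have D: "0 < (1 + d) powr (- \<gamma>)" using nn by simp
  have "\<bar>increment_cov H t t' s s'\<bar> \<le> 4 * (1 + X) ^ 3 * (1 + Y) ^ 3 * (1 + d) powr (- \<gamma>)"
  proof (cases "d \<le> 1 \<or> d \<le> 2 * X")
    case True
    have "\<bar>increment_cov H t t' s s'\<bar> \<le> (X powr (2 * H) + Y powr (2 * H)) / 2"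
      using increment_cov_bound[OF assms(1,2), of t t' s s'] assms by (simp add: defs)
    also have "\<dots> \<le> ((1 + X)\<^sup>2 + (1 + Y)\<^sup>2) / 2"
      using powr_le_square[of X "2 * H"] powr_le_square[of Y "2 * H"] nn H by simp
    also have "\<dots> \<le> (1 + X)\<^sup>2 * (1 + Y)\<^sup>2" by (rule half_sum_squares_le[OF nn(1,2)])
    finally have 1: "\<bar>increment_cov H t t' s s'\<bar> \<le> (1 + X)\<^sup>2 * (1 + Y)\<^sup>2" .
    \<comment> \<open>As \<open>\<gamma> < 1\<close>, the decay factor is bought back with one more
      power of \<open>1 + X\<close>. This is why the weights are cubic rather than
      quadratic.\<close>
    have "(1 + d) powr \<gamma> \<le> (1 + d) powr 1" using nn by (intro powr_mono) auto
    also have "\<dots> \<le> 2 * (1 + X)" using True nn by auto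
    finally have "(1 + d) powr \<gamma> * (1 + d) powr (- \<gamma>) \<le> 2 * (1 + X) * (1 + d) powr (- \<gamma>)"
      using D by (intro mult_right_mono) auto
    then have 2: "1 \<le> 2 * (1 + X) * (1 + d) powr (- \<gamma>)"
      using nn by (simp add: powr_add[symmetric])
    have "(1 + X)\<^sup>2 * (1 + Y)\<^sup>2 * 1 \<le> (1 + X)\<^sup>2 * (1 + Y)\<^sup>2 * (2 * (1 + X) * (1 + d) powr (- \<gamma>))"
      using 2 by (intro mult_left_mono) auto
    also have "\<dots> = 2 * (1 + X) ^ 3 * (1 + Y)\<^sup>2 * (1 + d) powr (- \<gamma>)"
      by (simp add: power2_eq_square power3_eq_cube)
    also have "\<dots> \<le> 4 * (1 + X) ^ 3 * (1 + Y) ^ 3 * (1 + d) powr (- \<gamma>)"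
      using nn D by (intro mult_right_mono mult_mono power_increasing) auto
    finally show ?thesis using 1 by simp
  next
    case False
    then have d: "1 < d" "X < d / 2" by auto
    have X_Y: "\<bar>increment_cov H t t' s s'\<bar> \<le> X * Y * (d / 2) powr (- \<gamma>)"
    proof (cases "X = 0")
      case True
      then show ?thesis by (simp add: increment_cov_def defs)
    next
      case False
      then have "t' < t" using nn by (simp add: defs)
      \<comment> \<open>The covariance is \<open>(g t - g t') / 2\<close>. The mean value theorem in
        \<open>u\<close> yields the factor \<open>X\<close>, and \<open>powr_diff_le\<close> on the
        two terms of the derivative yields \<open>Y\<close>; the point \<open>z\<close> stays at
        distance more than \<open>d / 2\<close> from \<open>s\<close>, where the power
        \<open>- \<gamma>\<close> is singular.\<close>
      define g where "g u = (u - s') powr (2 * H) - (u - s) powr (2 * H)" for u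
      have ts: "s + d / 2 < t'" using d by (simp add: defs field_simps)
      have "\<exists>z>t'. z < t \<and> g t - g t' = (t - t') * (2 * H * (z - s') powr (2 * H - 1) - 2 * H * (z - s) powr (2 * H - 1))"
      proof (rule MVT2[OF \<open>t' < t\<close>])
        fix u assume "t' \<le> u" "u \<le> t"
        then have "0 < u - s" "0 < u - s'" using ts d assms by auto
        then show "(g has_real_derivative 2 * H * (u - s') powr (2 * H - 1) - 2 * H * (u - s) powr (2 * H - 1)) (at u)"
          unfolding g_def[abs_def] by (auto intro!: derivative_eq_intros)
      qed
      then obtain z where z: "t' < z" "z < t"
        "g t - g t' = (t - t') * (2 * H * (z - s') powr (2 * H - 1) - 2 * H * (z - s) powr (2 * H - 1))" by blast
      have zs: "d / 2 < z - s" "0 < z - s" "z - s \<le> z - s'" using z ts d assms by auto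
      define G where "G = (z - s') powr (2 * H - 1) - (z - s) powr (2 * H - 1)"
      have "0 \<le> G" unfolding G_def using zs H by (simp add: powr_mono2)
      have "G \<le> (2 * H - 1) * (z - s) powr (2 * H - 1 - 1) * ((z - s') - (z - s))"
        unfolding G_def using zs H by (intro powr_diff_le) auto
      also have "\<dots> = (2 * H - 1) * (z - s) powr (- \<gamma>) * Y" by (simp add: defs)
      also have "\<dots> \<le> 1 * (d / 2) powr (- \<gamma>) * Y"
        using zs d nn H by (intro mult_right_mono mult_mono powr_mono2') auto
      finally have G: "G \<le> (d / 2) powr (- \<gamma>) * Y" by simp
      have "increment_cov H t t' s s' = (g t - g t') / 2"
        using ts d assms zs z by (simp add: increment_cov_def g_def)
      also have "\<dots> = X * (H * G)" using z(3) by (simp add: G_def defs right_diff_distrib)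
      finally have "\<bar>increment_cov H t t' s s'\<bar> = X * (H * G)" using nn H \<open>0 \<le> G\<close> by simp
      also have "\<dots> \<le> X * (1 * ((d / 2) powr (- \<gamma>) * Y))"
        using nn H \<open>0 \<le> G\<close> G by (intro mult_left_mono mult_mono) auto
      finally show ?thesis by (simp add: mult_ac)
    qed
    \<comment> \<open>From \<open>d > 1\<close> follows \<open>d / 2 \<ge> (1 + d) / 4\<close>, and
      \<open>4 powr \<gamma> \<le> 4\<close> is the origin of the constant 4.\<close>
    have "(d / 2) powr (- \<gamma>) \<le> ((1 + d) / 4) powr (- \<gamma>)" using d nn by (intro powr_mono2') auto
    also have "\<dots> = (1 + d) powr (- \<gamma>) * 4 powr \<gamma>" using nn by (simp add: powr_divide powr_minus field_simps)
    also have "\<dots> \<le> (1 + d) powr (- \<gamma>) * 4 powr 1" using nn by (intro mult_left_mono powr_mono) auto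
    finally have "(d / 2) powr (- \<gamma>) \<le> 4 * (1 + d) powr (- \<gamma>)" by simp
    moreover have "X \<le> (1 + X) ^ 3" "Y \<le> (1 + Y) ^ 3"
      using nn self_le_power[of "1 + X" 3] self_le_power[of "1 + Y" 3] by auto
    ultimately have "X * Y * (d / 2) powr (- \<gamma>) \<le> (1 + X) ^ 3 * (1 + Y) ^ 3 * (4 * (1 + d) powr (- \<gamma>))"
      using nn by (intro mult_mono) auto
    then show ?thesis using X_Y by simp
  qed
  then show ?thesis using nn by (simp add: defs)
qed

lemma increment_cov_swap: "increment_cov H s s' t t' = increment_cov H t t' s s'"
  by (simp add: increment_cov_def abs_minus_commute)

text \<open>The increments have lengths at most \<open>\<bar>x\<bar>\<close> and
  \<open>\<bar>y\<bar>\<close>, and exchanging them reduces the case \<open>t < s\<close> to the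
  ordered one. What depends on time is now separated from what is integrated.\<close>

lemma increment_cov_decay:
  assumes "prob_space M" and B: "fractional_brownian_motion M H B" and H: "1 / 2 < H" "H < 1"
    and "0 \<le> t" "0 \<le> s"
  shows "\<bar>increment_cov H t (lookback t x) s (lookback s y)\<bar>
     \<le> 4 * (1 + \<bar>t - s\<bar>) powr (2 * H - 2) * ((1 + \<bar>x\<bar>) ^ 3 * (1 + \<bar>y\<bar>) ^ 3)"
proof -
  let ?X = "t - lookback t x" and ?Y = "s - lookback s y"
  have X: "0 \<le> ?X" "?X \<le> \<bar>x\<bar>" and Y: "0 \<le> ?Y" "?Y \<le> \<bar>y\<bar>" using assms by (auto simp: lookback_def)
  have "\<bar>increment_cov H t (lookback t x) s (lookback s y)\<bar>
     \<le> 4 * (1 + ?X) ^ 3 * (1 + ?Y) ^ 3 * (1 + \<bar>t - s\<bar>) powr (2 * H - 2)"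
  proof (cases "s \<le> t")
    case True
    then show ?thesis using X Y by (intro increment_cov_decay_ordered[OF assms(1-4)]) auto
  next
    case False
    then show ?thesis
      using X Y increment_cov_decay_ordered[OF assms(1-4), of "lookback s y" s "lookback t x" t]
      by (simp add: increment_cov_swap[of H t] abs_minus_commute mult_ac)
  qed
  also have "\<dots> \<le> 4 * (1 + \<bar>x\<bar>) ^ 3 * (1 + \<bar>y\<bar>) ^ 3 * (1 + \<bar>t - s\<bar>) powr (2 * H - 2)"
    using X Y by (intro mult_right_mono mult_mono power_mono) auto
  finally show ?thesis by (simp add: mult_ac)
qed

lemma kernel_cov_double_integral:
  "kernel_cov H k t s = double_integral k k (\<lambda>x y. increment_cov H t (lookback t x) s (lookback s y))"
  by (simp add: kernel_cov_def double_integral_def)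

lemma increment_cov_lookback_measurable:
  "case_prod (\<lambda>x y. increment_cov H t (lookback t' x) s (lookback s' y)) \<in> borel_measurable (borel \<Otimes>\<^sub>M borel)"
  by measurable

lemma kernel_cov_decay:
  assumes "prob_space M" and B: "fractional_brownian_motion M H B" and H: "1 / 2 < H" "H < 1"
    and "0 \<le> t" "0 \<le> s" and k: "cubic_integrable k"
  shows "\<bar>kernel_cov H k t s\<bar> \<le> 4 * (cubic_norm k)\<^sup>2 * (1 + \<bar>t - s\<bar>) powr (2 * H - 2)"
  using double_integral_bound[OF k k increment_cov_lookback_measurable increment_cov_decay[OF assms(1-6)]]
  unfolding kernel_cov_double_integral by (simp add: power2_eq_square mult_ac)

text \<open>The left side is the variance of the moving average's increment from \<open>s\<close> to
  \<open>t\<close>. \<open>lookback\<close> is 1-Lipschitz in time, so both the current and the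
  looked-back value of \<open>B\<close> move over a time of at most
  \<open>\<bar>t - s\<bar>\<close>.\<close>

lemma kernel_cov_increment:
  assumes "prob_space M" and B: "fractional_brownian_motion M H B" and H: "1 / 2 < H" "H < 1"
    and ts: "0 \<le> t" "0 \<le> s" and k: "cubic_integrable k"
  shows "kernel_cov H k t t - kernel_cov H k t s - kernel_cov H k s t + kernel_cov H k s s
     \<le> 4 * (cubic_norm k)\<^sup>2 * \<bar>t - s\<bar> powr (2 * H)"
proof -
  let ?\<kappa> = "\<lambda>t s x y. increment_cov H t (lookback t x) s (lookback s y)"
  have one: "1 \<le> (1 + \<bar>x\<bar>) ^ 3 * (1 + \<bar>y\<bar>) ^ 3" for x y :: real
    using mult_mono[of 1 "(1 + \<bar>x\<bar>) ^ 3" 1 "(1 + \<bar>y\<bar>) ^ 3"] by (simp add: one_le_power)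
  have bd: "\<bar>?\<kappa> u v x y\<bar> \<le> 4 * ((1 + \<bar>x\<bar>) ^ 3 * (1 + \<bar>y\<bar>) ^ 3)" if "0 \<le> u" "0 \<le> v" for u v x y
  proof -
    have "(1 + \<bar>u - v\<bar>) powr (2 * H - 2) \<le> 1"
      using H powr_mono[of "2 * H - 2" 0 "1 + \<bar>u - v\<bar>"] by (simp split: if_splits)
    then have "4 * (1 + \<bar>u - v\<bar>) powr (2 * H - 2) * ((1 + \<bar>x\<bar>) ^ 3 * (1 + \<bar>y\<bar>) ^ 3) \<le> 4 * ((1 + \<bar>x\<bar>) ^ 3 * (1 + \<bar>y\<bar>) ^ 3)"
      by (intro mult_right_mono) auto
    then show ?thesis using increment_cov_decay[OF assms(1-4) that] order_trans by blast
  qed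
  have close: "\<bar>lookback t x - lookback s x\<bar> \<le> \<bar>t - s\<bar>" for x by (auto simp: lookback_def)
  have ic: "\<bar>increment_cov H a b c d\<bar> \<le> \<bar>t - s\<bar> powr (2 * H)"
    if "0 \<le> a" "0 \<le> b" "0 \<le> c" "0 \<le> d" "\<bar>a - b\<bar> \<le> \<bar>t - s\<bar>" "\<bar>c - d\<bar> \<le> \<bar>t - s\<bar>" for a b c d
  proof -
    have "\<bar>a - b\<bar> powr (2 * H) \<le> \<bar>t - s\<bar> powr (2 * H)" "\<bar>c - d\<bar> powr (2 * H) \<le> \<bar>t - s\<bar> powr (2 * H)"
      using that H by (auto intro!: powr_mono2)
    then show ?thesis using increment_cov_bound[OF assms(1,2) that(1-4)] by simp
  qed
  define \<kappa> where "\<kappa> = (\<lambda>x y. ((?\<kappa> t t x y + (-1) * ?\<kappa> t s x y) + (-1) * ?\<kappa> s t x y) + 1 * ?\<kappa> s s x y)"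
  \<comment> \<open>bilinearity of the covariance in the two-parameter increment \<open>(t - s) - (t' - s')\<close>\<close>
  have \<kappa>_eq: "\<kappa> x y = increment_cov H t s t s - increment_cov H t s (lookback t y) (lookback s y)
      - increment_cov H (lookback t x) (lookback s x) t s
      + increment_cov H (lookback t x) (lookback s x) (lookback t y) (lookback s y)" for x y
    unfolding \<kappa>_def increment_cov_def by (simp add: field_simps)
  have \<kappa>_bd: "\<bar>\<kappa> x y\<bar> \<le> (4 * \<bar>t - s\<bar> powr (2 * H)) * ((1 + \<bar>x\<bar>) ^ 3 * (1 + \<bar>y\<bar>) ^ 3)" for x y
  proof -
    have "\<bar>\<kappa> x y\<bar> \<le> 4 * \<bar>t - s\<bar> powr (2 * H)"
      unfolding \<kappa>_eq
      using ic[of t s t s] ic[of t s "lookback t y" "lookback s y"] ic[of "lookback t x" "lookback s x" t s]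
        ic[of "lookback t x" "lookback s x" "lookback t y" "lookback s y"] close[of x] close[of y] ts
      by (smt (verit) lookback_nonneg)
    also have "\<dots> \<le> (4 * \<bar>t - s\<bar> powr (2 * H)) * ((1 + \<bar>x\<bar>) ^ 3 * (1 + \<bar>y\<bar>) ^ 3)"
      using mult_left_mono[OF one[of x y], of "4 * \<bar>t - s\<bar> powr (2 * H)"] by simp
    finally show ?thesis .
  qed
  have m: "case_prod \<kappa> \<in> borel_measurable (borel \<Otimes>\<^sub>M borel)"
    unfolding \<kappa>_def by measurable
  \<comment> \<open>Crude bounds that only serve to split the integral of the combination; the
    quantitative one is \<open>\<kappa>_bd\<close>.\<close>
  have bd2: "\<bar>?\<kappa> t t x y + (-1) * ?\<kappa> t s x y\<bar> \<le> 8 * ((1 + \<bar>x\<bar>) ^ 3 * (1 + \<bar>y\<bar>) ^ 3)"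
    and bd3: "\<bar>(?\<kappa> t t x y + (-1) * ?\<kappa> t s x y) + (-1) * ?\<kappa> s t x y\<bar> \<le> 12 * ((1 + \<bar>x\<bar>) ^ 3 * (1 + \<bar>y\<bar>) ^ 3)" for x y
    using bd[OF ts(1,1), of x y] bd[OF ts(1,2), of x y] bd[OF ts(2,1), of x y] by linarith+
  have "double_integral k k \<kappa> = kernel_cov H k t t - kernel_cov H k t s - kernel_cov H k s t + kernel_cov H k s s"
    unfolding \<kappa>_def kernel_cov_double_integral
    apply (subst double_integral_add_scaled[OF k k _ bd3 increment_cov_lookback_measurable bd[OF ts(2,2)]], measurable)
    apply (subst double_integral_add_scaled[OF k k _ bd2 increment_cov_lookback_measurable bd[OF ts(2,1)]], measurable)
    apply (subst double_integral_add_scaled[OF k k increment_cov_lookback_measurable bd[OF ts(1,1)] increment_cov_lookback_measurable bd[OF ts(1,2)]])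
    by simp
  then show ?thesis
    using double_integral_bound[OF k k m \<kappa>_bd] by (simp add: power2_eq_square mult_ac)
qed

text \<open>What \<open>increment_cov\<close> becomes for increments ending at a common time and
  reaching back by x and y, once that time is so large that the stop at 0 no longer acts: the
  Brownian covariance at the positive parts of x and y.\<close>

definition stationary_cov :: "real \<Rightarrow> real \<Rightarrow> real \<Rightarrow> real" where
  "stationary_cov H x y = (max 0 x powr (2 * H) + max 0 y powr (2 * H) - \<bar>max 0 x - max 0 y\<bar> powr (2 * H)) / 2"

text \<open>For fixed x and y the integrand is eventually constant in t, and the decay estimate with
  both times equal dominates it uniformly in t.\<close>

lemma kernel_cov_diagonal_tendsto:
  assumes "prob_space M" and B: "fractional_brownian_motion M H B" and H: "1 / 2 < H" "H < 1" and k: "cubic_integrable k"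
  shows "((\<lambda>t. kernel_cov H k t t) \<longlongrightarrow> double_integral k k (stationary_cov H)) at_top"
proof -
  note [measurable] = cubic_integrableD(1)[OF k]
  let ?\<kappa> = "\<lambda>t x y. increment_cov H t (lookback t x) t (lookback t y)"
  have ev: "\<forall>\<^sub>F t in at_top. ?\<kappa> t x y = stationary_cov H x y" for x y
    using eventually_ge_at_top[of "max (max 0 x) (max 0 y)"]
  proof eventually_elim
    case (elim t)
    then have "lookback t x = t - max 0 x" "lookback t y = t - max 0 y" by (auto simp: lookback_def)
    then show ?case by (simp add: increment_cov_def stationary_cov_def abs_minus_commute)
  qed
  have bd: "\<bar>?\<kappa> t x y\<bar> \<le> 4 * ((1 + \<bar>x\<bar>) ^ 3 * (1 + \<bar>y\<bar>) ^ 3)" if "0 \<le> t" for t x y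
    using increment_cov_decay[OF assms(1-4) that that] by simp
  define D where "D = (\<lambda>x y. (4 * (\<bar>k x\<bar> * (1 + \<bar>x\<bar>) ^ 3)) * (\<bar>k y\<bar> * (1 + \<bar>y\<bar>) ^ 3))"
  have bd': "\<bar>k x * (k y * ?\<kappa> t x y)\<bar> \<le> D x y" if "0 \<le> t" for t x y
    using mult_left_mono[OF bd[OF that, of x y], of "\<bar>k x\<bar> * \<bar>k y\<bar>"] by (simp add: D_def abs_mult mult_ac)
  have intD: "integrable lborel (D x)" for x
    unfolding D_def using cubic_integrableD(2)[OF k] by simp
  have D2: "(LINT y|lborel. D x y) = 4 * (\<bar>k x\<bar> * (1 + \<bar>x\<bar>) ^ 3) * cubic_norm k" for x
    by (simp add: D_def cubic_norm_def)
  have sm [measurable]: "stationary_cov H x \<in> borel_measurable borel" for x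
    unfolding stationary_cov_def[abs_def] by measurable
  have sm2: "(\<lambda>x. LINT y|lborel. k x * (k y * stationary_cov H x y)) \<in> borel_measurable borel"
    unfolding stationary_cov_def by measurable
  have inner: "((\<lambda>t. LINT y|lborel. k x * (k y * ?\<kappa> t x y)) \<longlongrightarrow> (LINT y|lborel. k x * (k y * stationary_cov H x y))) at_top" for x
  proof (rule integral_dominated_convergence_at_top[where w="D x"])
    show "\<forall>\<^sub>F t in at_top. AE y in lborel. norm (k x * (k y * ?\<kappa> t x y)) \<le> D x y"
      using eventually_ge_at_top[of 0] by eventually_elim (use bd' in auto)
    show "AE y in lborel. ((\<lambda>t. k x * (k y * ?\<kappa> t x y)) \<longlongrightarrow> k x * (k y * stationary_cov H x y)) at_top"
      by (intro AE_I2 tendsto_eventually) (use ev in \<open>auto elim: eventually_mono\<close>)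
  qed (use intD in auto)
  show ?thesis
    unfolding kernel_cov_def double_integral_def
  proof (rule integral_dominated_convergence_at_top[where w="\<lambda>x. 4 * (\<bar>k x\<bar> * (1 + \<bar>x\<bar>) ^ 3) * cubic_norm k"])
    show "\<forall>\<^sub>F t in at_top. AE x in lborel. norm (LINT y|lborel. k x * (k y * ?\<kappa> t x y)) \<le> 4 * (\<bar>k x\<bar> * (1 + \<bar>x\<bar>) ^ 3) * cubic_norm k"
      using eventually_ge_at_top[of 0]
    proof eventually_elim
      case (elim t)
      show ?case using abs_integral_le[OF intD bd'[OF elim]] by (simp add: D2)
    qed
    show "integrable lborel (\<lambda>x. 4 * (\<bar>k x\<bar> * (1 + \<bar>x\<bar>) ^ 3) * cubic_norm k)"
      using cubic_integrableD(2)[OF k] by simp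
    show "AE x in lborel. ((\<lambda>t. LINT y|lborel. k x * (k y * ?\<kappa> t x y)) \<longlongrightarrow> (LINT y|lborel. k x * (k y * stationary_cov H x y))) at_top"
      using inner by simp
  qed (use sm2 in auto)
qed

section \<open>Exponential kernels\<close>

lemma cubic_integrable_comb:
  assumes "cubic_integrable k" "cubic_integrable l"
  shows "cubic_integrable (\<lambda>x. p * k x + q * l x)"
  unfolding cubic_integrable_def
proof
  note [measurable] = assms[THEN cubic_integrableD(1)]
  show "(\<lambda>x. p * k x + q * l x) \<in> borel_measurable borel" by measurable
  have "integrable lborel (\<lambda>x. \<bar>p\<bar> * (\<bar>k x\<bar> * (1 + \<bar>x\<bar>) ^ 3) + \<bar>q\<bar> * (\<bar>l x\<bar> * (1 + \<bar>x\<bar>) ^ 3))"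
    using assms[THEN cubic_integrableD(2)] by simp
  then show "integrable lborel (\<lambda>x. \<bar>p * k x + q * l x\<bar> * (1 + \<bar>x\<bar>) ^ 3)"
  proof (rule Bochner_Integration.integrable_bound)
    have "\<bar>p * k x + q * l x\<bar> * (1 + \<bar>x\<bar>) ^ 3 \<le> (\<bar>p\<bar> * \<bar>k x\<bar> + \<bar>q\<bar> * \<bar>l x\<bar>) * (1 + \<bar>x\<bar>) ^ 3" for x
      by (intro mult_right_mono) (auto simp: abs_mult[symmetric])
    then have "\<bar>\<bar>p * k x + q * l x\<bar> * (1 + \<bar>x\<bar>) ^ 3\<bar> \<le> \<bar>\<bar>p\<bar> * (\<bar>k x\<bar> * (1 + \<bar>x\<bar>) ^ 3) + \<bar>q\<bar> * (\<bar>l x\<bar> * (1 + \<bar>x\<bar>) ^ 3)\<bar>" for x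
      by (simp add: algebra_simps abs_mult)
    then show "AE x in lborel. norm (\<bar>p * k x + q * l x\<bar> * (1 + \<bar>x\<bar>) ^ 3)
        \<le> norm (\<bar>p\<bar> * (\<bar>k x\<bar> * (1 + \<bar>x\<bar>) ^ 3) + \<bar>q\<bar> * (\<bar>l x\<bar> * (1 + \<bar>x\<bar>) ^ 3))"
      by simp
  qed measurable
qed

lemma cubic_integrable_abs: "cubic_integrable k \<Longrightarrow> cubic_integrable (\<lambda>x. \<bar>k x\<bar>)"
  by (auto simp: cubic_integrable_def)

lemma double_integral_swap:
  assumes k: "cubic_integrable k" and l: "cubic_integrable l"
    and \<kappa>: "case_prod \<kappa> \<in> borel_measurable (borel \<Otimes>\<^sub>M borel)" "\<And>x y. \<bar>\<kappa> x y\<bar> \<le> C * ((1 + \<bar>x\<bar>) ^ 3 * (1 + \<bar>y\<bar>) ^ 3)"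
  shows "double_integral k l \<kappa> = double_integral l k (\<lambda>x y. \<kappa> y x)"
proof -
  note [measurable] = cubic_integrableD(1)[OF k] cubic_integrableD(1)[OF l] \<kappa>(1)
  have \<kappa>': "case_prod (\<lambda>x y. \<bar>\<kappa> x y\<bar>) \<in> borel_measurable (borel \<Otimes>\<^sub>M borel)"
    "\<And>x y. \<bar>\<bar>\<kappa> x y\<bar>\<bar> \<le> C * ((1 + \<bar>x\<bar>) ^ 3 * (1 + \<bar>y\<bar>) ^ 3)"
    using \<kappa>(2) by (simp_all add: case_prod_beta)
  have "integrable (lborel \<Otimes>\<^sub>M lborel) (case_prod (\<lambda>x y. k x * (l y * \<kappa> x y)))"
  proof (rule lborel_pair.Fubini_integrable)
    show "(\<lambda>(x, y). k x * (l y * \<kappa> x y)) \<in> borel_measurable (lborel \<Otimes>\<^sub>M lborel)"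
      by (simp add: case_prod_beta)
    show "integrable lborel (\<lambda>x. LINT y|lborel. norm (case (x, y) of (x, y) \<Rightarrow> k x * (l y * \<kappa> x y)))"
      using double_integral_outer[OF cubic_integrable_abs[OF k] cubic_integrable_abs[OF l] \<kappa>'] by (simp add: abs_mult)
    show "AE x in lborel. integrable lborel (\<lambda>y. case (x, y) of (x, y) \<Rightarrow> k x * (l y * \<kappa> x y))"
      using double_integral_inner[OF k l \<kappa>] by simp
  qed
  from lborel_pair.Fubini_integral[OF this] show ?thesis
    by (simp add: double_integral_def mult_ac)
qed

section \<open>Explicit integrals for exponential densities\<close>

lemma exponential_density_powr_moment:
  assumes "0 < a" "0 \<le> h"
  shows "has_bochner_integral lborel (\<lambda>x. exponential_density a x * max 0 x powr h) (Gamma (h + 1) * a powr (- h))"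
proof -
  define f where "f t = indicator {0..} t * (t powr h / exp t)" for t :: real
  have [measurable]: "f \<in> borel_measurable borel" unfolding f_def by measurable
  have nn: "0 \<le> f t" for t by (simp add: f_def)
  have "((\<lambda>t. if t \<in> {0..} then t powr h / exp t else 0) has_integral Gamma (h + 1)) UNIV"
    using Gamma_integral_real[of "h + 1"] assms unfolding has_integral_restrict_UNIV by simp
  then have hi: "(f has_integral Gamma (h + 1)) UNIV"
    by (rule has_integral_eq[rotated]) (auto simp: f_def)
  have "(\<integral>\<^sup>+t. ennreal (f t) \<partial>lborel) = ennreal (Gamma (h + 1))"
    using nn hi by (intro nn_integral_has_integral_lborel) auto
  then have "has_bochner_integral lborel f (Gamma (h + 1))"
    using nn Gamma_real_pos[of "h + 1"] assms by (intro has_bochner_integral_nn_integral) auto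
  from lborel_has_bochner_integral_real_affine_iff[of a f "Gamma (h + 1)" 0, THEN iffD1, OF _ this]
  have "has_bochner_integral lborel (\<lambda>x. f (a * x)) (Gamma (h + 1) / a)"
    using assms by (simp add: divide_inverse mult.commute)
  then have "has_bochner_integral lborel (\<lambda>x. a powr (1 - h) * f (a * x)) (a powr (1 - h) * (Gamma (h + 1) / a))"
    by (rule has_bochner_integral_mult_right)
  also have "(\<lambda>x. a powr (1 - h) * f (a * x)) = (\<lambda>x. exponential_density a x * max 0 x powr h)"
  proof
    fix x
    show "a powr (1 - h) * f (a * x) = exponential_density a x * max 0 x powr h"
    proof (cases "0 \<le> x")
      case True
      then have "a powr (1 - h) * f (a * x) = (a powr (1 - h) * a powr h) * (x powr h / exp (a * x))"
        using assms by (simp add: f_def powr_mult)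
      also have "a powr (1 - h) * a powr h = a" using assms by (simp add: powr_add[symmetric])
      finally show ?thesis using True assms by (simp add: exponential_density_def exp_minus field_simps)
    next
      case False
      then show ?thesis using assms by (simp add: f_def exponential_density_def indicator_def zero_le_mult_iff)
    qed
  qed
  also have "a powr (1 - h) * (Gamma (h + 1) / a) = Gamma (h + 1) * a powr (- h)"
    using assms by (simp add: powr_diff powr_minus field_simps)
  finally show ?thesis .
qed

lemma exponential_density_total:
  assumes "0 < a"
  shows "integrable lborel (exponential_density a)" "(LINT x|lborel. exponential_density a x) = 1"
proof -
  interpret prob_space "density lborel (exponential_density a)" by (rule prob_space_exponential_density[OF assms])
  have "(\<integral>\<^sup>+x. ennreal (exponential_density a x) \<partial>lborel) = ennreal 1"
    using emeasure_space_1 by (simp add: emeasure_density)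
  then have "has_bochner_integral lborel (exponential_density a) 1"
    using exponential_density_nonneg[OF assms] by (intro has_bochner_integral_nn_integral) auto
  then show "integrable lborel (exponential_density a)" "(LINT x|lborel. exponential_density a x) = 1"
    by (auto simp: has_bochner_integral_iff)
qed

lemma cubic_integrable_exponential:
  assumes "0 < a"
  shows "cubic_integrable (exponential_density a)"
  unfolding cubic_integrable_def
proof
  have i: "integrable lborel (\<lambda>x. exponential_density a x * max 0 x powr 3)"
    using exponential_density_powr_moment[OF assms, of 3] by (auto simp: has_bochner_integral_iff)
  have "integrable lborel (\<lambda>x. 8 * exponential_density a x + 8 * (exponential_density a x * max 0 x powr 3))"
    by (intro Bochner_Integration.integrable_add integrable_mult_right i exponential_density_total assms)
  then show "integrable lborel (\<lambda>x. \<bar>exponential_density a x\<bar> * (1 + \<bar>x\<bar>) ^ 3)"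
  proof (rule Bochner_Integration.integrable_bound)
    show "AE x in lborel. norm (\<bar>exponential_density a x\<bar> * (1 + \<bar>x\<bar>) ^ 3)
        \<le> norm (8 * exponential_density a x + 8 * (exponential_density a x * max 0 x powr 3))"
    proof (intro AE_I2)
      fix x :: real
      show "norm (\<bar>exponential_density a x\<bar> * (1 + \<bar>x\<bar>) ^ 3)
        \<le> norm (8 * exponential_density a x + 8 * (exponential_density a x * max 0 x powr 3))"
      proof (cases "0 \<le> x")
        case False
        then show ?thesis by (simp add: exponential_density_def)
      next
        case True
        have "(1 + x) ^ 3 \<le> (2 * max 1 x) ^ 3" using True by (intro power_mono) auto
        also have "\<dots> \<le> 8 * (1 + x ^ 3)" using True by (simp add: power_mult_distrib max_def)
        finally have "exponential_density a x * (1 + x) ^ 3 \<le> exponential_density a x * (8 * (1 + x ^ 3))"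
          by (rule mult_left_mono) (rule exponential_density_nonneg[OF assms])
        then show ?thesis
          using True exponential_density_nonneg[OF assms, of x] by (simp add: algebra_simps abs_mult)
      qed
    qed
  qed measurable
qed measurable

lemma powr_le_cubic:
  fixes z h :: real
  assumes "0 \<le> z" "1 + z \<le> (1 + \<bar>x\<bar>) * (1 + \<bar>y\<bar>)" "0 \<le> h" "h \<le> 2"
  shows "\<bar>z powr h\<bar> \<le> 1 * ((1 + \<bar>x\<bar>) ^ 3 * (1 + \<bar>y\<bar>) ^ 3)"
proof -
  have "z powr h \<le> (1 + z)\<^sup>2" using assms by (intro powr_le_square)
  also have "\<dots> \<le> ((1 + \<bar>x\<bar>) * (1 + \<bar>y\<bar>))\<^sup>2" using assms by (intro power_mono) auto
  also have "\<dots> \<le> ((1 + \<bar>x\<bar>) * (1 + \<bar>y\<bar>)) ^ 3"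
    using assms by (intro power_increasing) auto
  finally show ?thesis by (simp add: power_mult_distrib)
qed

text \<open>Lack of memory: the second variable exceeds x with probability
  \<open>exp (- b * x)\<close>, and the excess is again exponential of rate \<open>b\<close>.
  Integrating this probability against the first density gives \<open>a / (a + b)\<close>.\<close>

lemma exponential_double_integral_excess:
  assumes ab: "0 < a" "0 < b" and "0 < h"
  shows "double_integral (exponential_density a) (exponential_density b) (\<lambda>x y. max 0 (max 0 y - max 0 x) powr h)
     = a / (a + b) * (Gamma (h + 1) * b powr (- h))"
proof -
  let ?m = "Gamma (h + 1) * b powr (- h)"
  have inner: "exponential_density a x * (LINT y|lborel. exponential_density b y * max 0 (max 0 y - max 0 x) powr h)
      = a / (a + b) * ?m * exponential_density (a + b) x" for x
  proof (cases "0 \<le> x")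
    case False
    then show ?thesis by (simp add: exponential_density_def)
  next
    case True
    have "(LINT y|lborel. exponential_density b y * max 0 (max 0 y - max 0 x) powr h)
      = (LINT z|lborel. exponential_density b (x + z) * max 0 (max 0 (x + z) - max 0 x) powr h)"
      using lborel_integral_real_affine[of 1 "\<lambda>y. exponential_density b y * max 0 (max 0 y - max 0 x) powr h" x] by simp
    also have "\<dots> = (LINT z|lborel. exp (- b * x) * (exponential_density b z * max 0 z powr h))"
    proof (rule Bochner_Integration.integral_cong[OF refl])
      fix z
      show "exponential_density b (x + z) * max 0 (max 0 (x + z) - max 0 x) powr h
          = exp (- b * x) * (exponential_density b z * max 0 z powr h)"
      proof (cases "0 \<le> z")
        case True
        then show ?thesis using \<open>0 \<le> x\<close> by (simp add: exponential_density_def exp_add[symmetric] algebra_simps)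
      next
        case False
        then have "max 0 (max 0 (x + z) - max 0 x) = 0" using \<open>0 \<le> x\<close> by auto
        then show ?thesis using False assms by (simp add: exponential_density_def)
      qed
    qed
    also have "\<dots> = exp (- b * x) * ?m"
      using exponential_density_powr_moment[OF ab(2), of h] assms by (simp add: has_bochner_integral_iff)
    finally have *: "(LINT y|lborel. exponential_density b y * max 0 (max 0 y - max 0 x) powr h) = exp (- b * x) * ?m" .
    have "exp (- x * (a + b)) = exp (- x * a) * exp (- b * x)"
      by (simp add: exp_add[symmetric] algebra_simps)
    then show ?thesis using True ab unfolding * by (simp add: exponential_density_def)
  qed
  have "double_integral (exponential_density a) (exponential_density b) (\<lambda>x y. max 0 (max 0 y - max 0 x) powr h)
     = (LINT x|lborel. a / (a + b) * ?m * exponential_density (a + b) x)"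
    unfolding double_integral_def inner[symmetric] by simp
  also have "\<dots> = a / (a + b) * ?m"
    using exponential_density_total(2)[of "a + b"] ab by simp
  finally show ?thesis .
qed

text \<open>The power of \<open>\<bar>x - y\<bar>\<close> splits into the two one-sided excesses.
  Each \<open>m c\<close> is a moment of order \<open>2 * H\<close>, and subtracting the excess
  terms leaves \<open>m a\<close> and \<open>m b\<close> with weights proportional to
  \<open>a\<close> and \<open>b\<close>.\<close>

lemma double_integral_exponential_stationary_cov:
  assumes ab: "0 < a" "0 < b" and H: "0 < H" "H < 1"
  shows "double_integral (exponential_density a) (exponential_density b) (stationary_cov H)
    = H * Gamma (2 * H) * ((a powr (1 - 2 * H) + b powr (1 - 2 * H)) / (a + b))"
proof -
  let ?h = "2 * H"
  note ca = cubic_integrable_exponential[OF ab(1)] and cb = cubic_integrable_exponential[OF ab(2)]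
  define m where "m c = Gamma (?h + 1) * c powr (- ?h)" for c :: real
  let ?D = "double_integral (exponential_density a) (exponential_density b)"
  let ?\<kappa>1 = "\<lambda>x y :: real. max 0 (max 0 y - max 0 x) powr ?h" and ?\<kappa>2 = "\<lambda>x y :: real. max 0 (max 0 x - max 0 y) powr ?h"
  let ?X = "\<lambda>x y :: real. max 0 x powr ?h" and ?Y = "\<lambda>x y :: real. max 0 y powr ?h"
  have meas: "case_prod ?X \<in> borel_measurable (borel \<Otimes>\<^sub>M borel)" "case_prod ?Y \<in> borel_measurable (borel \<Otimes>\<^sub>M borel)"
    "case_prod ?\<kappa>1 \<in> borel_measurable (borel \<Otimes>\<^sub>M borel)" "case_prod ?\<kappa>2 \<in> borel_measurable (borel \<Otimes>\<^sub>M borel)"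
    by measurable
  have tri: "1 + \<bar>x\<bar> + \<bar>y\<bar> \<le> (1 + \<bar>x\<bar>) * (1 + \<bar>y\<bar>)" for x y :: real
    by (simp add: algebra_simps)
  have bX: "\<bar>?X x y\<bar> \<le> 1 * ((1 + \<bar>x\<bar>) ^ 3 * (1 + \<bar>y\<bar>) ^ 3)" for x y
    using H by (intro powr_le_cubic order_trans[OF _ tri]) auto
  have bY: "\<bar>?Y x y\<bar> \<le> 1 * ((1 + \<bar>x\<bar>) ^ 3 * (1 + \<bar>y\<bar>) ^ 3)" for x y
    using H by (intro powr_le_cubic order_trans[OF _ tri]) auto
  have b1: "\<bar>?\<kappa>1 x y\<bar> \<le> 1 * ((1 + \<bar>x\<bar>) ^ 3 * (1 + \<bar>y\<bar>) ^ 3)" for x y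
    using H by (intro powr_le_cubic order_trans[OF _ tri]) auto
  have b2: "\<bar>?\<kappa>2 x y\<bar> \<le> 1 * ((1 + \<bar>x\<bar>) ^ 3 * (1 + \<bar>y\<bar>) ^ 3)" for x y
    using H by (intro powr_le_cubic order_trans[OF _ tri]) auto
  let ?S = "\<lambda>x y. ((0 + (1/2) * ?X x y) + (1/2) * ?Y x y) + (-1/2) * ?\<kappa>1 x y"
  have bS1: "\<bar>(0 :: real)\<bar> \<le> 0 * ((1 + \<bar>x\<bar>) ^ 3 * (1 + \<bar>y\<bar>) ^ 3)" for x y :: real by simp
  have comb: "\<bar>0 + (1/2) * u\<bar> \<le> 1 * G" "\<bar>(0 + (1/2) * u) + (1/2) * v\<bar> \<le> 2 * G"
      "\<bar>((0 + (1/2) * u) + (1/2) * v) + (-1/2) * w\<bar> \<le> 3 * G"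
    if "\<bar>u\<bar> \<le> 1 * G" "\<bar>v\<bar> \<le> 1 * G" "\<bar>w\<bar> \<le> 1 * G" for u v w G :: real
    using that by linarith+
  note bS2 = comb(1)[OF bX bX bX] and bS3 = comb(2)[OF bX bY bY] and bS4 = comb(3)[OF bX bY b1]
  have "stationary_cov H = (\<lambda>x y. ?S x y + (-1/2) * ?\<kappa>2 x y)"
  proof (intro ext)
    fix x y :: real
    have "\<bar>max 0 x - max 0 y\<bar> powr ?h = ?\<kappa>1 x y + ?\<kappa>2 x y"
      by (cases "max 0 x \<le> max 0 y") (auto simp: abs_if not_le max_absorb1 max_absorb2)
    then show "stationary_cov H x y = ?S x y + (-1/2) * ?\<kappa>2 x y"
      unfolding stationary_cov_def by (simp add: field_simps)
  qed
  then have "?D (stationary_cov H) = ?D (\<lambda>x y. 0) + (1/2) * ?D ?X + (1/2) * ?D ?Y + (-1/2) * ?D ?\<kappa>1 + (-1/2) * ?D ?\<kappa>2"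
    apply (simp only:)
    apply (subst double_integral_add_scaled[OF ca cb _ bS4 meas(4) b2], measurable)
    apply (subst double_integral_add_scaled[OF ca cb _ bS3 meas(3) b1], measurable)
    apply (subst double_integral_add_scaled[OF ca cb _ bS2 meas(2) bY], measurable)
    apply (subst double_integral_add_scaled[OF ca cb _ bS1 meas(1) bX], measurable)
    done
  also have "?D (\<lambda>x y. 0) = 0" by (simp add: double_integral_def)
  also have "?D ?X = m a"
    using exponential_density_powr_moment[OF ab(1), of ?h] exponential_density_total(2)[OF ab(2)] H
    by (simp add: double_integral_def has_bochner_integral_iff m_def mult.commute[of "exponential_density b _"] mult.assoc[symmetric])
  also have "?D ?Y = m b"
    using exponential_density_powr_moment[OF ab(2), of ?h] exponential_density_total(2)[OF ab(1)] H
    by (simp add: double_integral_def has_bochner_integral_iff m_def)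
  also have "?D ?\<kappa>1 = a / (a + b) * m b"
    using exponential_double_integral_excess[OF ab, of ?h] H by (simp add: m_def)
  also have "?D ?\<kappa>2 = b / (a + b) * m a"
    using double_integral_swap[OF ca cb meas(4) b2] exponential_double_integral_excess[OF ab(2,1), of ?h] H
    by (simp add: m_def add.commute)
  also have "0 + 1/2 * m a + 1/2 * m b + (-1/2) * (a / (a + b) * m b) + (-1/2) * (b / (a + b) * m a)
      = (a * m a + b * m b) / (2 * (a + b))"
  proof -
    define u where "u = a / (a + b)"
    have b: "b / (a + b) = 1 - u" using ab by (simp add: u_def field_simps)
    have "(a * m a + b * m b) / (2 * (a + b)) = (a / (a + b) * m a + b / (a + b) * m b) / 2"
      by (simp add: add_divide_distrib mult.commute)
    also have "\<dots> = 1/2 * m a + 1/2 * m b + (-1/2) * (u * m b) + (-1/2) * ((1 - u) * m a)"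
      unfolding b u_def[symmetric] by (simp add: field_simps)
    finally show ?thesis unfolding b u_def[symmetric] by simp
  qed
  \<comment> \<open>The functional equation of \<open>Gamma\<close> at \<open>2 * H\<close> produces
    the factor \<open>2 * H\<close>; halved, it gives the constant \<open>H * Gamma (2 * H)\<close>
    of the moment equation.\<close>
  also have "c * m c = 2 * H * Gamma ?h * c powr (1 - ?h)" if "0 < c" for c
  proof -
    have "?h \<notin> \<int>\<^sub>\<le>\<^sub>0" using H nonpos_Ints_nonpos[of ?h] by auto
    then show ?thesis using that H Gamma_plus1[of ?h] by (simp add: m_def powr_diff powr_minus add.commute field_simps)
  qed
  from this[OF ab(1)] this[OF ab(2)]
  have "(a * m a + b * m b) / (2 * (a + b)) = H * Gamma ?h * ((a powr (1 - ?h) + b powr (1 - ?h)) / (a + b))"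
    using ab by (simp add: field_simps)
  finally show ?thesis .
qed

section \<open>Langevin equations\<close>

text \<open>Variation of constants after integration by parts, so that only values of
  \<open>N\<close> occur. Since the density has mass 1 and the lookback time is 0 beyond t, the
  integral is \<open>N t - N 0\<close> minus the integral of \<open>f\<close> over
  \<open>[0, t]\<close>. With \<open>Y\<close> the primitive of z, the equation makes
  \<open>F\<close> a primitive of \<open>f\<close>, and \<open>F t - F 0 = a * Y t\<close>.\<close>

lemma langevin_path:
  fixes z N :: "real \<Rightarrow> real"
  assumes N: "continuous_on {0..} N" and "0 < a"
    and z: "\<And>t. 0 \<le> t \<Longrightarrow> z integrable_on {0..t}" "\<And>t. 0 \<le> t \<Longrightarrow> z t = - a * integral {0..t} z + (N t - N 0)"
  shows "continuous_on {0..} z"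
    and "0 \<le> t \<Longrightarrow> integrable lborel (\<lambda>x. exponential_density a x * (N t - N (lookback t x)))"
    and "0 \<le> t \<Longrightarrow> z t = (LINT x|lborel. exponential_density a x * (N t - N (lookback t x)))"
proof -
  define Y where "Y u = integral {0..u} z" for u
  have z_Y: "z u = - a * Y u + (N u - N 0)" if "0 \<le> u" for u using z(2)[OF that] by (simp add: Y_def)
  have cont: "continuous_on {0..t} z" if "0 \<le> t" for t
  proof -
    have "continuous_on {0..t} (\<lambda>u. - a * Y u + (N u - N 0))"
      unfolding Y_def using z(1)[OF that]
      by (intro continuous_intros indefinite_integral_continuous_1 continuous_on_subset[OF N]) auto
    then show ?thesis by (rule continuous_on_eq) (use z_Y in auto)
  qed
  show "continuous_on {0..} z"
    unfolding continuous_on_def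
  proof
    fix u :: real assume "u \<in> {0..}"
    have "(z \<longlongrightarrow> z u) (at u within {0..u + 1})"
      using cont[of "u + 1"] \<open>u \<in> {0..}\<close> by (auto simp: continuous_on_def)
    moreover have "at u within {0..u + 1} = at u within {0..}"
      by (rule at_within_nhd[of _ "{..<u + 1}"]) auto
    ultimately show "(z \<longlongrightarrow> z u) (at u within {0..})" by simp
  qed
  assume t: "0 \<le> t"
  have dY: "(Y has_real_derivative z u) (at u within {0..t})" if "0 \<le> u" "u \<le> t" for u
    unfolding Y_def[abs_def] using cont[OF t] that by (intro integral_has_real_derivative) auto
  define f where "f x = a * exp (- a * x) * (N (t - x) - N 0)" for x
  define F where "F x = - a * exp (- a * x) * Y (t - x)" for x
  have img: "(\<lambda>x. t - x) ` {0..t} = {0..t}" by (auto intro!: image_eqI[where x="t - _"])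
  have dF: "(F has_vector_derivative f x) (at x within {0..t})" if "0 \<le> x" "x \<le> t" for x
  proof -
    have "((Y \<circ> (\<lambda>x. t - x)) has_real_derivative z (t - x) * (-1)) (at x within {0..t})"
      by (rule DERIV_image_chain) (use dY[of "t - x"] that in \<open>auto simp: img intro!: derivative_eq_intros\<close>)
    moreover have "f x = a * exp (- a * x) * (z (t - x) + a * Y (t - x))"
      using z_Y[of "t - x"] that by (simp add: f_def)
    ultimately have "(F has_real_derivative f x) (at x within {0..t})"
      unfolding F_def[abs_def] o_def
      by (auto intro!: derivative_eq_intros simp: algebra_simps)
    then show ?thesis by (rule has_real_derivative_iff_has_vector_derivative[THEN iffD1])
  qed
  have cf: "continuous_on {0..t} f"
    unfolding f_def by (intro continuous_intros continuous_on_compose2[OF N]) auto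
  have FTC: "(LINT x|lborel. indicator {0..t} x *\<^sub>R f x) = F t - F 0"
    by (rule integral_FTC_Icc[OF t dF cf])
  have int_f: "integrable lborel (\<lambda>x. indicator {0..t} x *\<^sub>R f x)"
    using borel_integrable_atLeastAtMost'[OF cf] by (simp add: set_integrable_def)
  have split: "exponential_density a x * (N t - N (lookback t x))
      = (N t - N 0) * exponential_density a x - indicator {0..t} x *\<^sub>R f x" for x
  proof -
    consider "x < 0" | "0 \<le> x" "x \<le> t" | "t < x" by linarith
    then show ?thesis
    proof cases
      case 1 then show ?thesis by (simp add: exponential_density_def)
    next
      case 2 then show ?thesis by (simp add: exponential_density_def lookback_def f_def algebra_simps)
    next
      case 3 then show ?thesis using t by (simp add: lookback_def algebra_simps)
    qed
  qed
  show "integrable lborel (\<lambda>x. exponential_density a x * (N t - N (lookback t x)))"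
    unfolding split
    by (intro Bochner_Integration.integrable_diff integrable_mult_right int_f exponential_density_total \<open>0 < a\<close>)
  have "(LINT x|lborel. exponential_density a x * (N t - N (lookback t x))) = (N t - N 0) - (F t - F 0)"
    unfolding split
    using exponential_density_total[OF \<open>0 < a\<close>] int_f FTC by simp
  also have "\<dots> = z t" using z_Y[OF t] by (simp add: F_def Y_def)
  finally show "z t = (LINT x|lborel. exponential_density a x * (N t - N (lookback t x)))" ..
qed

text \<open>Partial fractions: the combination below of input and output of the second equation solves a Langevin
  equation driven directly by the noise.\<close>

lemma langevin_cascade:
  fixes v x b :: "real \<Rightarrow> real"
  assumes "0 < \<theta>" and "v 0 = 0"
    and v: "\<And>t. 0 \<le> t \<Longrightarrow> v integrable_on {0..t}" "\<And>t. 0 \<le> t \<Longrightarrow> v t = - \<rho> * integral {0..t} v + (b t - b 0)"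
    and x: "\<And>t. 0 \<le> t \<Longrightarrow> x integrable_on {0..t}" "\<And>t. 0 \<le> t \<Longrightarrow> x t = - \<theta> * integral {0..t} x + (v t - v 0)"
    and "0 \<le> t"
  shows "(\<lambda>t. ((\<theta> - \<rho>) * x t + \<rho> * v t) / \<theta>) integrable_on {0..t}"
    and "((\<theta> - \<rho>) * x t + \<rho> * v t) / \<theta>
      = - \<theta> * integral {0..t} (\<lambda>t. ((\<theta> - \<rho>) * x t + \<rho> * v t) / \<theta>) + (b t - b 0)"
proof -
  have "((\<lambda>t. ((\<theta> - \<rho>) * x t + \<rho> * v t) * inverse \<theta>) has_integral
      ((\<theta> - \<rho>) * integral {0..t} x + \<rho> * integral {0..t} v) * inverse \<theta>) {0..t}"
    using v(1)[OF \<open>0 \<le> t\<close>] x(1)[OF \<open>0 \<le> t\<close>]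
    by (intro has_integral_mult_left has_integral_add has_integral_mult_right integrable_integral)
  then have hi: "((\<lambda>t. ((\<theta> - \<rho>) * x t + \<rho> * v t) / \<theta>) has_integral
      ((\<theta> - \<rho>) * integral {0..t} x + \<rho> * integral {0..t} v) / \<theta>) {0..t}"
    by (simp add: divide_inverse)
  then show "(\<lambda>t. ((\<theta> - \<rho>) * x t + \<rho> * v t) / \<theta>) integrable_on {0..t}" by blast
  have "\<theta> * integral {0..t} x = v t - x t" "\<rho> * integral {0..t} v = b t - b 0 - v t"
    using v(2)[OF \<open>0 \<le> t\<close>] x(2)[OF \<open>0 \<le> t\<close>] \<open>v 0 = 0\<close> by auto
  then have "\<theta> * ((\<theta> - \<rho>) * integral {0..t} x + \<rho> * integral {0..t} v)
      = (\<theta> - \<rho>) * (v t - x t) + \<theta> * (b t - b 0 - v t)"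
    by (simp add: distrib_left mult.left_commute[of \<theta>])
  then show "((\<theta> - \<rho>) * x t + \<rho> * v t) / \<theta>
      = - \<theta> * integral {0..t} (\<lambda>t. ((\<theta> - \<rho>) * x t + \<rho> * v t) / \<theta>) + (b t - b 0)"
    using \<open>0 < \<theta>\<close> unfolding integral_unique[OF hi] by (simp add: field_simps)
qed

definition cascade_kernel :: "real \<Rightarrow> real \<Rightarrow> real \<Rightarrow> real" where
  "cascade_kernel \<theta> \<rho> x = \<rho> / (\<rho> - \<theta>) * exponential_density \<rho> x + (- \<theta> / (\<rho> - \<theta>)) * exponential_density \<theta> x"

lemma langevin_solution_kernel:
  assumes B: "fractional_brownian_motion M H B" and "0 < \<rho>" and V: "langevin_solution M \<rho> B V"
  shows "AE \<omega> in M. continuous_on {0..} (\<lambda>t. V t \<omega>) \<and>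
     (\<forall>t\<ge>0. V t \<omega> = (LINT x|lborel. exponential_density \<rho> x * (B t \<omega> - B (lookback t x) \<omega>)))"
proof -
  have "AE \<omega> in M. continuous_on {0..} (\<lambda>t. B t \<omega>)"
    using B by (simp add: fractional_brownian_motion_def)
  moreover have "AE \<omega> in M. \<forall>t\<ge>0. (\<lambda>s. V s \<omega>) integrable_on {0..t} \<and>
      V t \<omega> = - \<rho> * integral {0..t} (\<lambda>s. V s \<omega>) + (B t \<omega> - B 0 \<omega>)"
    using V by (auto simp: langevin_solution_def elim: eventually_mono)
  ultimately show ?thesis
  proof eventually_elim
    case (elim \<omega>)
    then show ?case
      using langevin_path[of "\<lambda>t. B t \<omega>" \<rho> "\<lambda>t. V t \<omega>"] \<open>0 < \<rho>\<close> by blast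
  qed
qed

text \<open>With \<open>u\<close> the solution of rate \<theta> driven by \<open>b\<close>, one
  recovers \<open>x = (\<rho> * v - \<theta> * u) / (\<rho> - \<theta>)\<close>, where
  \<open>v\<close> and \<open>u\<close> both have exponential kernels. Distinct rates are essential
  for this inversion.\<close>

lemma langevin_cascade_kernel:
  assumes B: "fractional_brownian_motion M H B" and "0 < \<theta>" "0 < \<rho>" "\<theta> \<noteq> \<rho>"
    and V: "langevin_solution M \<rho> B V" and X: "langevin_solution M \<theta> V X"
  shows "AE \<omega> in M. continuous_on {0..} (\<lambda>t. X t \<omega>) \<and>
     (\<forall>t\<ge>0. X t \<omega> = (LINT x|lborel. cascade_kernel \<theta> \<rho> x * (B t \<omega> - B (lookback t x) \<omega>)))"
proof -
  have "AE \<omega> in M. continuous_on {0..} (\<lambda>t. B t \<omega>)"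
    using B by (simp add: fractional_brownian_motion_def)
  then show ?thesis
    using V[unfolded langevin_solution_def, THEN conjunct2] X[unfolded langevin_solution_def, THEN conjunct2]
  proof eventually_elim
    case (elim \<omega>)
    define b v x where "b t = B t \<omega>" and "v t = V t \<omega>" and "x t = X t \<omega>" for t
    define u where "u t = ((\<theta> - \<rho>) * x t + \<rho> * v t) / \<theta>" for t
    have b: "continuous_on {0..} b" using elim(1) by (simp add: b_def[abs_def])
    have v: "\<And>t. 0 \<le> t \<Longrightarrow> v integrable_on {0..t}" "\<And>t. 0 \<le> t \<Longrightarrow> v t = - \<rho> * integral {0..t} v + (b t - b 0)"
      and "v 0 = 0" using elim(2) by (auto simp: b_def v_def[abs_def])
    have x: "\<And>t. 0 \<le> t \<Longrightarrow> x integrable_on {0..t}" "\<And>t. 0 \<le> t \<Longrightarrow> x t = - \<theta> * integral {0..t} x + (v t - v 0)"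
      using elim(3) by (auto simp: x_def[abs_def] v_def[abs_def])
    have u: "\<And>t. 0 \<le> t \<Longrightarrow> u integrable_on {0..t}" "\<And>t. 0 \<le> t \<Longrightarrow> u t = - \<theta> * integral {0..t} u + (b t - b 0)"
      using langevin_cascade[OF \<open>0 < \<theta>\<close> \<open>v 0 = 0\<close> v x] unfolding u_def by auto
    have pv: "continuous_on {0..} v"
      "\<And>t. 0 \<le> t \<Longrightarrow> integrable lborel (\<lambda>x. exponential_density \<rho> x * (b t - b (lookback t x)))"
      "\<And>t. 0 \<le> t \<Longrightarrow> v t = (LINT x|lborel. exponential_density \<rho> x * (b t - b (lookback t x)))"
      using langevin_path[of b \<rho> v] b \<open>0 < \<rho>\<close> v by blast+
    have pu: "continuous_on {0..} u"
      "\<And>t. 0 \<le> t \<Longrightarrow> integrable lborel (\<lambda>x. exponential_density \<theta> x * (b t - b (lookback t x)))"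
      "\<And>t. 0 \<le> t \<Longrightarrow> u t = (LINT x|lborel. exponential_density \<theta> x * (b t - b (lookback t x)))"
      using langevin_path[of b \<theta> u] b \<open>0 < \<theta>\<close> u by blast+
    have x_uv: "x t = \<rho> / (\<rho> - \<theta>) * v t + (- \<theta> / (\<rho> - \<theta>)) * u t" for t
    proof -
      have "\<rho> / (\<rho> - \<theta>) * v t + (- \<theta> / (\<rho> - \<theta>)) * u t = (\<rho> * v t - \<theta> * u t) / (\<rho> - \<theta>)"
        by (simp add: diff_divide_distrib)
      also have "\<theta> * u t = (\<theta> - \<rho>) * x t + \<rho> * v t"
        using assms(2) by (simp add: u_def)
      also have "\<rho> * v t - ((\<theta> - \<rho>) * x t + \<rho> * v t) = (\<rho> - \<theta>) * x t"
        by (simp add: algebra_simps)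
      finally show ?thesis using assms(4) by simp
    qed
    have "x t = (LINT y|lborel. cascade_kernel \<theta> \<rho> y * (b t - b (lookback t y)))" if "0 \<le> t" for t
    proof -
      have "(LINT y|lborel. cascade_kernel \<theta> \<rho> y * (b t - b (lookback t y)))
        = (LINT y|lborel. \<rho> / (\<rho> - \<theta>) * (exponential_density \<rho> y * (b t - b (lookback t y)))
            + (- \<theta> / (\<rho> - \<theta>)) * (exponential_density \<theta> y * (b t - b (lookback t y))))"
        by (simp only: cascade_kernel_def distrib_right mult.assoc)
      also have "\<dots> = \<rho> / (\<rho> - \<theta>) * v t + (- \<theta> / (\<rho> - \<theta>)) * u t"
        unfolding pv(3)[OF that] pu(3)[OF that] using pv(2)[OF that] pu(2)[OF that]
        by (subst Bochner_Integration.integral_add) (intro integrable_mult_right | simp)+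
      finally show ?thesis using x_uv by simp
    qed
    moreover have "continuous_on {0..} x"
      unfolding x_uv[abs_def] by (intro continuous_intros pv(1) pu(1))
    ultimately show ?case by (simp add: x_def[abs_def] b_def)
  qed
qed

section \<open>Ergodic theorem for sampled second moments\<close>

lemma sum_abs_diff_le:
  fixes g :: "nat \<Rightarrow> real"
  assumes "\<And>k. 0 \<le> g k" "i < n"
  shows "(\<Sum>j<n. g (if j \<le> i then i - j else j - i)) \<le> 2 * (\<Sum>k<n. g k)"
proof -
  define g' where "g' j = g (if j \<le> i then i - j else j - i)" for j
  have "{..<n} = {..i} \<union> {Suc i..<n}" using assms(2) by auto
  moreover have "{..i} \<inter> {Suc i..<n} = {}" by auto
  ultimately have "sum g' {..<n} = sum g' {..i} + sum g' {Suc i..<n}"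
    by (metis finite_atMost finite_atLeastLessThan sum.union_disjoint)
  also have "sum g' {..i} = (\<Sum>k\<le>i. g k)"
    by (rule sum.reindex_bij_witness[where i="\<lambda>k. i - k" and j="\<lambda>k. i - k"]) (auto simp: g'_def)
  also have "\<dots> \<le> (\<Sum>k<n. g k)" using assms by (intro sum_mono2) auto
  also have "sum g' {Suc i..<n} = (\<Sum>k\<in>{1..<n - i}. g k)"
    by (rule sum.reindex_bij_witness[where i="\<lambda>k. k + i" and j="\<lambda>k. k - i"]) (auto simp: g'_def)
  also have "\<dots> \<le> (\<Sum>k<n. g k)" using assms by (intro sum_mono2) auto
  finally show ?thesis by (simp add: g'_def)
qed

text \<open>Each term is at most an increment of
  \<open>x powr (1 - \<gamma>) / (1 - \<gamma>)\<close>, by the mean value theorem and the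
  monotonicity of the derivative; the increments telescope.\<close>

lemma sum_powr_le:
  assumes "0 < \<gamma>" "\<gamma> < 1"
  shows "(\<Sum>k<n. (1 + real k) powr (- \<gamma>)) \<le> real n powr (1 - \<gamma>) / (1 - \<gamma>)"
proof (induction n)
  case 0
  then show ?case by simp
next
  case (Suc n)
  have "(1 + real n) powr (- \<gamma>) \<le> (real (Suc n) powr (1 - \<gamma>) - real n powr (1 - \<gamma>)) / (1 - \<gamma>)"
  proof (cases "n = 0")
    case True
    then show ?thesis using assms by (simp add: field_simps)
  next
    case False
    have "\<exists>z>real n. z < real (Suc n) \<and> real (Suc n) powr (1 - \<gamma>) - real n powr (1 - \<gamma>)
        = (real (Suc n) - real n) * ((1 - \<gamma>) * z powr (1 - \<gamma> - 1))"
      by (rule MVT2) (use False assms in \<open>auto intro!: derivative_eq_intros\<close>)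
    then obtain z where z: "real n < z" "z < real (Suc n)"
      "real (Suc n) powr (1 - \<gamma>) - real n powr (1 - \<gamma>) = (1 - \<gamma>) * z powr (- \<gamma>)" by auto
    have "(1 + real n) powr (- \<gamma>) \<le> z powr (- \<gamma>)"
      using z assms by (intro powr_mono2') auto
    then show ?thesis using z(3) assms by simp
  qed
  then show ?case using Suc by (simp add: diff_divide_distrib)
qed

lemma riemann_left_sum_bound:
  fixes f :: "real \<Rightarrow> real"
  assumes f: "continuous_on {0..T} f" and h: "0 \<le> h"
    and e: "\<And>x y. x \<in> {0..T} \<Longrightarrow> y \<in> {0..T} \<Longrightarrow> \<bar>x - y\<bar> \<le> h \<Longrightarrow> \<bar>f x - f y\<bar> \<le> e"
  shows "real k * h \<le> T \<Longrightarrow> \<bar>integral {0..real k * h} f - (\<Sum>j<k. h * f (real j * h))\<bar> \<le> real k * h * e"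
proof (induction k)
  case 0
  then show ?case by simp
next
  case (Suc k)
  let ?a = "real k * h" and ?b = "real (Suc k) * h"
  have ab: "0 \<le> ?a" "?a \<le> ?b" "?b \<le> T" "?b - ?a = h" using Suc.prems h by (auto simp: algebra_simps)
  have int: "f integrable_on {u..v}" if "0 \<le> u" "v \<le> T" for u v
    by (rule integrable_continuous_real[OF continuous_on_subset[OF f]]) (use that in auto)
  have "((\<lambda>x. f x - f ?a) has_integral (integral {?a..?b} f - h * f ?a)) {?a..?b}"
  proof (rule has_integral_diff)
    show "(f has_integral integral {?a..?b} f) {?a..?b}"
      using int ab by (intro integrable_integral) auto
    show "((\<lambda>x. f ?a) has_integral h * f ?a) {?a..?b}"
      using has_integral_const_real[of "f ?a" ?a ?b] ab by simp
  qed
  moreover have "norm (f x - f ?a) \<le> e" if "x \<in> {?a..?b}" for x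
  proof -
    have "?a \<le> x" "x \<le> ?b" using that by auto
    then have "0 \<le> x" "x \<le> T" "\<bar>x - ?a\<bar> \<le> h" "?a \<le> T" using ab by linarith+
    then show ?thesis using e[of x ?a] ab by simp
  qed
  moreover have "0 \<le> e" using e[of ?a ?a] ab h by auto
  ultimately have step: "\<bar>integral {?a..?b} f - h * f ?a\<bar> \<le> e * h"
    using has_integral_bound_real[of e "{}" "\<lambda>x. f x - f ?a" _ ?a ?b] ab by fastforce
  have "integral {0..?b} f = integral {0..?a} f + integral {?a..?b} f"
    using ab int by (intro Henstock_Kurzweil_Integration.integral_combine[symmetric]) auto
  moreover have "\<bar>integral {0..?a} f - (\<Sum>j<k. h * f (real j * h))\<bar> \<le> ?a * e"
    using Suc ab by simp
  moreover have "?b * e = ?a * e + e * h" by (simp add: algebra_simps)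
  ultimately show ?case using step by (simp add: abs_le_iff)
qed

lemma riemann_left_sum_tendsto:
  fixes f :: "real \<Rightarrow> real"
  assumes f: "continuous_on {0..T} f" and T: "0 < T"
  shows "(\<lambda>N. (1 / real N) * (\<Sum>k<N. f (real k * (T / real N)))) \<longlonglongrightarrow> (1 / T) * integral {0..T} f"
proof (rule LIMSEQ_I)
  fix r :: real assume "0 < r"
  then have "0 < r / 2" by simp
  have "uniformly_continuous_on {0..T} f" using f by (intro compact_uniformly_continuous) auto
  then obtain d where d: "0 < d" "\<And>x y. x \<in> {0..T} \<Longrightarrow> y \<in> {0..T} \<Longrightarrow> \<bar>x - y\<bar> < d \<Longrightarrow> \<bar>f x - f y\<bar> < r / 2"
    using \<open>0 < r / 2\<close> unfolding uniformly_continuous_on_def dist_real_def by metis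
  obtain N0 where N0: "T / d < real N0" using reals_Archimedean2 by blast
  have "norm ((1 / real N) * (\<Sum>k<N. f (real k * (T / real N))) - (1 / T) * integral {0..T} f) < r" if "N0 \<le> N" for N
  proof -
    define h where "h = T / real N"
    have "0 < T / d" using T d by simp
    then have N: "0 < real N" "T / d < real N" using N0 that by linarith+
    then have h: "0 < h" "h < d" "real N * h = T" using T d by (auto simp: h_def field_simps)
    have "\<bar>integral {0..real N * h} f - (\<Sum>j<N. h * f (real j * h))\<bar> \<le> real N * h * (r / 2)"
      using h d(2) by (intro riemann_left_sum_bound[OF f]) (auto intro!: less_imp_le)
    then have *: "\<bar>integral {0..T} f - h * (\<Sum>j<N. f (real j * h))\<bar> \<le> T * (r / 2)"
      by (simp add: h sum_distrib_left)
    have "(1 / real N) * (\<Sum>k<N. f (real k * (T / real N))) = (1 / T) * (h * (\<Sum>j<N. f (real j * h)))"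
      using N T by (simp add: h_def)
    then have "norm ((1 / real N) * (\<Sum>k<N. f (real k * (T / real N))) - (1 / T) * integral {0..T} f)
      = (1 / T) * \<bar>integral {0..T} f - h * (\<Sum>j<N. f (real j * h))\<bar>"
      using T by (simp add: right_diff_distrib[symmetric] abs_mult abs_minus_commute del: times_divide_eq_left times_divide_eq_right)
    also have "\<dots> \<le> (1 / T) * (T * (r / 2))" using * T by (intro mult_left_mono) auto
    also have "\<dots> < r" using T \<open>0 < r\<close> by simp
    finally show ?thesis .
  qed
  then show "\<exists>no. \<forall>n\<ge>no. norm ((1 / real n) * (\<Sum>k<n. f (real k * (T / real n))) - (1 / T) * integral {0..T} f) < r"
    by blast
qed

lemma quad_mean_eq: "quad_mean n d Z \<omega> = (1 / real n) * (\<Sum>i<n. (Z (real i * d) \<omega>)\<^sup>2)"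
proof -
  have "(\<Sum>i=1..n. (Z (real (i - 1) * d) \<omega>)\<^sup>2) = (\<Sum>i<n. (Z (real i * d) \<omega>)\<^sup>2)"
    by (rule sum.reindex_bij_witness[where i=Suc and j="\<lambda>i. i - 1"]) auto
  then show ?thesis by (simp add: quad_mean_def)
qed

text \<open>The sum of the \<open>f n\<close> has finite expectation, so it is almost surely finite
  and its terms tend to 0. Keeping the measurable \<open>f n\<close> apart from \<open>y n\<close>
  allows a \<open>y n\<close> of unproved measurability.\<close>

lemma summable_nn_integral_imp_tendsto_0:
  assumes [measurable]: "\<And>n. f n \<in> borel_measurable M"
    and c: "\<And>n. (\<integral>\<^sup>+\<omega>. f n \<omega> \<partial>M) \<le> ennreal (c n)" "summable c" "\<And>n. 0 \<le> c n"
    and y: "AE \<omega> in M. \<forall>n. f n \<omega> = ennreal (y n \<omega> ^ (2 * p))" and "0 < p"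
  shows "AE \<omega> in M. (\<lambda>n. y n \<omega>) \<longlonglongrightarrow> 0"
proof -
  have "(\<integral>\<^sup>+\<omega>. (\<Sum>n. f n \<omega>) \<partial>M) = (\<Sum>n. \<integral>\<^sup>+\<omega>. f n \<omega> \<partial>M)"
    by (rule nn_integral_suminf) simp
  also have "\<dots> \<le> (\<Sum>n. ennreal (c n))" using c(1) by (intro suminf_le) auto
  also have "\<dots> = ennreal (\<Sum>n. c n)" using c by (intro suminf_ennreal2) auto
  finally have "(\<integral>\<^sup>+\<omega>. (\<Sum>n. f n \<omega>) \<partial>M) \<noteq> \<infinity>" by (auto simp: top_unique)
  then have "AE \<omega> in M. (\<Sum>n. f n \<omega>) \<noteq> \<infinity>" by (intro nn_integral_PInf_AE) auto
  then show ?thesis using y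
  proof eventually_elim
    case (elim \<omega>)
    have "summable (\<lambda>n. y n \<omega> ^ (2 * p))"
      using elim by (intro summable_suminf_not_top) auto
    then have "(\<lambda>n. y n \<omega> ^ (2 * p)) \<longlonglongrightarrow> 0" by (rule summable_LIMSEQ_zero)
    then have "(\<lambda>n. root (2 * p) (y n \<omega> ^ (2 * p))) \<longlonglongrightarrow> root (2 * p) 0" by (rule tendsto_real_root)
    then have "(\<lambda>n. \<bar>root (2 * p) (y n \<omega> ^ (2 * p))\<bar>) \<longlonglongrightarrow> \<bar>root (2 * p) 0\<bar>" by (rule tendsto_rabs)
    then have "(\<lambda>n. \<bar>y n \<omega>\<bar>) \<longlonglongrightarrow> 0"
      using \<open>0 < p\<close> by (subst (asm) root_abs_power) auto
    then show ?case by (simp add: tendsto_rabs_zero_iff)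
  qed
qed

lemma powr_at_top:
  fixes \<delta> :: real
  assumes "0 < \<delta>"
  shows "filterlim (\<lambda>x. x powr \<delta>) at_top at_top"
  unfolding filterlim_at_top
proof
  fix Z :: real
  show "\<forall>\<^sub>F x in at_top. Z \<le> x powr \<delta>"
    using eventually_ge_at_top[of "\<bar>Z\<bar> powr (1 / \<delta>)"]
  proof eventually_elim
    case (elim x)
    then have "(\<bar>Z\<bar> powr (1 / \<delta>)) powr \<delta> \<le> x powr \<delta>" using assms by (intro powr_mono2) auto
    then show ?case using assms by (simp add: powr_powr)
  qed
qed

text \<open>Isolates what the ergodic theorem uses, so that it applies to \<open>V\<close> and
  \<open>X\<close> alike with \<open>\<gamma> = 2 - 2 * H\<close> and \<open>h = 2 * H\<close>. A
  single \<open>C\<close> serves for the decay and for the increments.\<close>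

locale asymptotically_stationary_gaussian = prob_space M for M :: "'a measure" +
  fixes W :: "real \<Rightarrow> 'a \<Rightarrow> real" and r :: "real \<Rightarrow> real \<Rightarrow> real" and C \<gamma> h \<sigma> :: real
  assumes family: "gaussian_family M {0..} W r"
    and \<gamma>: "0 < \<gamma>" "\<gamma> < 1" and h: "0 < h"
    and decay: "\<And>t s. 0 \<le> t \<Longrightarrow> 0 \<le> s \<Longrightarrow> \<bar>r t s\<bar> \<le> C * (1 + \<bar>t - s\<bar>) powr (- \<gamma>)"
    and increment: "\<And>t s. 0 \<le> t \<Longrightarrow> 0 \<le> s \<Longrightarrow> r t t - r t s - r s t + r s s \<le> C * \<bar>t - s\<bar> powr h"
    and diagonal: "((\<lambda>t. r t t) \<longlongrightarrow> \<sigma>) at_top"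
    and continuous: "AE \<omega> in M. continuous_on {0..} (\<lambda>t. W t \<omega>)"
begin

lemma W_normal: "0 \<le> t \<Longrightarrow> centred_normal M (r t t) (W t)"
  using gaussian_family_single[OF family] by simp

lemma W_all_moments: "0 \<le> t \<Longrightarrow> all_moments M (W t)"
  using centred_normal_all_moments[OF prob_space_axioms W_normal] .

lemma r_bound: "0 \<le> t \<Longrightarrow> 0 \<le> s \<Longrightarrow> \<bar>r t s\<bar> \<le> C"
proof -
  assume ts: "0 \<le> t" "0 \<le> s"
  have C: "0 \<le> C" using order_trans[OF abs_ge_zero decay[of 0 0]] by simp
  have "(1 + \<bar>t - s\<bar>) powr (- \<gamma>) \<le> 1" using powr_mono[of "- \<gamma>" 0 "1 + \<bar>t - s\<bar>"] \<gamma> by (simp split: if_splits)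
  then have "C * (1 + \<bar>t - s\<bar>) powr (- \<gamma>) \<le> C" using C by (simp add: mult_left_le)
  then show ?thesis using decay[OF ts] by simp
qed

lemma C_nonneg: "0 \<le> C" using r_bound[of 0 0] by simp

text \<open>The expectation of \<open>quad_mean n d W\<close>.\<close>

definition mean_variance :: "nat \<Rightarrow> real \<Rightarrow> real" where
  "mean_variance n d = (1 / real n) * (\<Sum>i<n. r (real i * d) (real i * d))"

definition time_average :: "real \<Rightarrow> 'a \<Rightarrow> real" where
  "time_average T \<omega> = (1 / T) * integral {0..T} (\<lambda>t. (W t \<omega>)\<^sup>2)"

lemma quad_mean_all_moments:
  assumes "0 \<le> d"
  shows "all_moments M (quad_mean n d W)"
proof -
  have "quad_mean n d W = (\<lambda>\<omega>. (1 / real n) * (\<Sum>i<n. (W (real i * d) \<omega>)\<^sup>2))"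
    by (simp add: quad_mean_eq fun_eq_iff)
  then show ?thesis using assms
    by (simp only:) (intro all_moments_mult all_moments_sum all_moments_power finite_measure_axioms W_all_moments all_moments_const; simp)
qed

text \<open>Points \<open>k\<close> steps apart satisfy
  \<open>1 + k * d \<ge> (1 + k) * min 1 d\<close>, which reduces the sum to unit steps;
  \<open>n powr (1 - \<gamma>)\<close> and \<open>min 1 d\<close> then combine into
  \<open>min n (n * d)\<close>. Stated for any dominated \<open>\<phi>\<close> so that rows and
  columns of \<open>r\<close> are both covered.\<close>

lemma correlation_sum_le:
  assumes d: "0 < d" and "i < n"
    and \<phi>: "\<And>j. \<phi> j \<le> C * (1 + \<bar>real i * d - real j * d\<bar>) powr (- \<gamma>)"
  shows "(\<Sum>j<n. \<phi> j) \<le> 2 * C / (1 - \<gamma>) * real n * min (real n) (real n * d) powr (- \<gamma>)"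
proof -
  define m where "m = min 1 d"
  have m: "0 < m" using d by (simp add: m_def)
  have "(\<Sum>j<n. \<phi> j) \<le> (\<Sum>j<n. C * m powr (- \<gamma>) * (1 + real (if j \<le> i then i - j else j - i)) powr (- \<gamma>))"
  proof (rule sum_mono)
    fix j
    let ?k = "real (if j \<le> i then i - j else j - i)"
    have k: "\<bar>real i * d - real j * d\<bar> = ?k * d"
      using d by (auto simp: left_diff_distrib[symmetric] abs_mult of_nat_diff)
    have "(1 + ?k) * m \<le> 1 + ?k * d"
      unfolding distrib_right using d by (intro add_mono mult_left_mono) (auto simp: m_def)
    then have "(1 + ?k * d) powr (- \<gamma>) \<le> ((1 + ?k) * m) powr (- \<gamma>)"
      using m \<gamma> by (intro powr_mono2') auto
    also have "\<dots> = m powr (- \<gamma>) * (1 + ?k) powr (- \<gamma>)"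
      using m by (simp add: powr_mult mult.commute)
    finally have "C * (1 + ?k * d) powr (- \<gamma>) \<le> C * (m powr (- \<gamma>) * (1 + ?k) powr (- \<gamma>))"
      using C_nonneg by (rule mult_left_mono)
    then show "\<phi> j \<le> C * m powr (- \<gamma>) * (1 + ?k) powr (- \<gamma>)"
      using \<phi>[of j] unfolding k by (simp add: mult_ac)
  qed
  also have "\<dots> = C * m powr (- \<gamma>) * (\<Sum>j<n. (1 + real (if j \<le> i then i - j else j - i)) powr (- \<gamma>))"
    by (simp add: sum_distrib_left)
  also have "\<dots> \<le> C * m powr (- \<gamma>) * (2 * (real n powr (1 - \<gamma>) / (1 - \<gamma>)))"
    using sum_abs_diff_le[of "\<lambda>k. (1 + real k) powr (- \<gamma>)" i n] sum_powr_le[OF \<gamma>, of n] \<open>i < n\<close> C_nonneg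
    by (intro mult_left_mono) auto
  also have "\<dots> = 2 * C / (1 - \<gamma>) * real n * min (real n) (real n * d) powr (- \<gamma>)"
  proof -
    have "min (real n) (real n * d) = real n * m"
      by (simp add: m_def min_mult_distrib_left)
    then have "min (real n) (real n * d) powr (- \<gamma>) = real n powr (- \<gamma>) * m powr (- \<gamma>)"
      using m by (simp add: powr_mult)
    moreover have "real n powr (1 - \<gamma>) = real n * real n powr (- \<gamma>)"
      using \<open>i < n\<close> by (simp add: powr_diff powr_minus divide_inverse)
    ultimately show ?thesis by simp
  qed
  finally show ?thesis .
qed

text \<open>In the bound on the quadratic form one factor \<open>n\<close> comes from the row sums
  and one from the number of variables; the normalisation \<open>1 / n^2\<close> cancels both,
  leaving the p-th power of the rate.\<close>

lemma quad_mean_moment: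
  assumes n: "1 \<le> n" and d: "0 < d"
  shows "(LINT \<omega>|M. (quad_mean n d W \<omega> - mean_variance n d) ^ (2 * p))
    \<le> (8 * C\<^sup>2 / (1 - \<gamma>)) ^ p * (std_moment (2 * p))\<^sup>2 * (min (real n) (real n * d) powr (- \<gamma>)) ^ p"
proof -
  let ?\<mu> = "min (real n) (real n * d) powr (- \<gamma>)"
  let ?\<Lambda> = "2 * C / (1 - \<gamma>) * real n * ?\<mu>"
  let ?W = "\<lambda>i. W (real i * d)" and ?r = "\<lambda>i j. r (real i * d) (real j * d)"
  have F: "gaussian_family M {..<n} ?W ?r"
    using d by (intro gaussian_family_reindex[OF family]) auto
  have "(LINT \<omega>|M. (\<Sum>i<n. (?W i \<omega>)\<^sup>2 - ?r i i) ^ (2 * p)) \<le> (4 * ?\<Lambda> * real (card {..<n}) * C) ^ p * (std_moment (2 * p))\<^sup>2"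
  proof (rule quadratic_form_moment[OF prob_space_axioms F])
    fix i assume i: "i \<in> {..<n}"
    show "(\<Sum>j<n. \<bar>?r i j\<bar>) \<le> ?\<Lambda>"
      using i d by (intro correlation_sum_le[of d i]) (auto intro: decay)
    show "(\<Sum>j<n. \<bar>?r j i\<bar>) \<le> ?\<Lambda>"
      using i d decay[of "real _ * d" "real i * d"] by (intro correlation_sum_le[of d i]) (auto simp: abs_minus_commute)
    show "?r i i \<le> C" using r_bound[of "real i * d" "real i * d"] d by simp
  qed (use n in \<open>auto simp: lessThan_empty_iff\<close>)
  then have "(1 / real n) ^ (2 * p) * (LINT \<omega>|M. (\<Sum>i<n. (?W i \<omega>)\<^sup>2 - ?r i i) ^ (2 * p))
      \<le> (1 / real n) ^ (2 * p) * ((4 * ?\<Lambda> * real n * C) ^ p * (std_moment (2 * p))\<^sup>2)"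
    by (intro mult_left_mono) auto
  moreover have "(LINT \<omega>|M. (quad_mean n d W \<omega> - mean_variance n d) ^ (2 * p))
     = (1 / real n) ^ (2 * p) * (LINT \<omega>|M. (\<Sum>i<n. (?W i \<omega>)\<^sup>2 - ?r i i) ^ (2 * p))"
    by (simp add: quad_mean_eq mean_variance_def right_diff_distrib[symmetric] sum_subtractf power_mult_distrib power_divide
        del: times_divide_eq_left times_divide_eq_right mult_1_left)
  moreover have "(1 / real n) ^ (2 * p) * (4 * ?\<Lambda> * real n * C) ^ p = (8 * C\<^sup>2 / (1 - \<gamma>)) ^ p * ?\<mu> ^ p"
  proof -
    have "(1 / real n)\<^sup>2 * (4 * ?\<Lambda> * real n * C) = 8 * C\<^sup>2 / (1 - \<gamma>) * ?\<mu>"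
      using n by (simp add: power2_eq_square)
    then show ?thesis by (simp only: power_mult power_mult_distrib[symmetric])
  qed
  ultimately show ?thesis by (simp only: mult.assoc[symmetric]) (simp only: mult.assoc mult.commute[of "(std_moment (2 * p))\<^sup>2"])
qed

lemma square_difference_moment:
  assumes s: "0 \<le> s" and t: "0 \<le> t" and d: "0 < d" "\<bar>s - t\<bar> \<le> d"
  shows "(LINT \<omega>|M. ((W s \<omega>)\<^sup>2 - (W t \<omega>)\<^sup>2) ^ (2 * p))
     \<le> std_moment (2 * (2 * p)) * (C ^ (2 * p) + (4 * C) ^ (2 * p)) / 2 * (d powr h) ^ p"
proof -
  \<comment> \<open>The weight that balances Young's inequality for the factors
    \<open>W s - W t\<close> and \<open>W s + W t\<close>: the moment of the first is of order
    \<open>\<epsilon>^2\<close>, that of the second bounded, so both terms become of order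
    \<open>\<epsilon>\<close>.\<close>
  define \<epsilon> where "\<epsilon> = (d powr h) ^ p"
  have \<epsilon>: "0 < \<epsilon>" using d by (simp add: \<epsilon>_def)
  have st: "(\<lambda>b. if b then s else t) ` (UNIV :: bool set) \<subseteq> {0..}" using s t by auto
  have N: "centred_normal M (r s s + e * r s t + e * r t s + e * e * r t t) (\<lambda>\<omega>. W s \<omega> + e * W t \<omega>)" for e
    using gaussian_family_comb[OF family _ st, of "\<lambda>b. if b then 1 else e"]
    by (simp add: UNIV_bool add_ac mult_ac)
  have Np: "centred_normal M (r s s + r s t + r t s + r t t) (\<lambda>\<omega>. W s \<omega> + W t \<omega>)"
    and Nm: "centred_normal M (r s s - r s t - r t s + r t t) (\<lambda>\<omega>. W s \<omega> - W t \<omega>)"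
    using N[of 1] N[of "-1"] by simp_all
  let ?m = "std_moment (2 * (2 * p))"
  have m: "0 \<le> ?m" by (rule std_moment_even_nonneg)
  have "r s s - r s t - r t s + r t t \<le> C * d powr h"
  proof -
    have "\<bar>s - t\<bar> powr h \<le> d powr h" using d h by (intro powr_mono2) auto
    then show ?thesis using increment[OF s t] C_nonneg mult_left_mono[of "\<bar>s - t\<bar> powr h" "d powr h" C] by linarith
  qed
  then have "(LINT \<omega>|M. (W s \<omega> - W t \<omega>) ^ (2 * (2 * p))) \<le> (C * d powr h) ^ (2 * p) * ?m"
    unfolding centred_normal_even_moment[OF prob_space_axioms Nm]
    using Nm m by (intro mult_right_mono power_mono) (auto simp: centred_normal_def)
  also have "(C * d powr h) ^ (2 * p) = C ^ (2 * p) * \<epsilon>\<^sup>2"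
    by (simp add: \<epsilon>_def power_mult_distrib power_mult[symmetric] mult.commute)
  finally have 1: "(LINT \<omega>|M. (W s \<omega> - W t \<omega>) ^ (2 * (2 * p))) \<le> C ^ (2 * p) * \<epsilon>\<^sup>2 * ?m" .
  have "r s s + r s t + r t s + r t t \<le> 4 * C"
    using r_bound[OF s s] r_bound[OF s t] r_bound[OF t s] r_bound[OF t t] by linarith
  then have 2: "(LINT \<omega>|M. (W s \<omega> + W t \<omega>) ^ (2 * (2 * p))) \<le> (4 * C) ^ (2 * p) * ?m"
    unfolding centred_normal_even_moment[OF prob_space_axioms Np]
    using Np m by (intro mult_right_mono power_mono) (auto simp: centred_normal_def)
  have ip: "integrable M (\<lambda>\<omega>. (W s \<omega> + W t \<omega>) ^ (2 * (2 * p)))" and im: "integrable M (\<lambda>\<omega>. (W s \<omega> - W t \<omega>) ^ (2 * (2 * p)))"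
    using centred_normal_moment(1)[OF prob_space_axioms Np] centred_normal_moment(1)[OF prob_space_axioms Nm] .
  have "(LINT \<omega>|M. ((W s \<omega>)\<^sup>2 - (W t \<omega>)\<^sup>2) ^ (2 * p))
    \<le> (LINT \<omega>|M. (1 / \<epsilon>) * (W s \<omega> - W t \<omega>) ^ (2 * (2 * p)) / 2 + \<epsilon> * (W s \<omega> + W t \<omega>) ^ (2 * (2 * p)) / 2)"
  proof (rule integral_mono)
    show "integrable M (\<lambda>\<omega>. ((W s \<omega>)\<^sup>2 - (W t \<omega>)\<^sup>2) ^ (2 * p))"
      by (intro all_moments_power_integrable all_moments_diff all_moments_power finite_measure_axioms W_all_moments s t)
    show "integrable M (\<lambda>\<omega>. (1 / \<epsilon>) * (W s \<omega> - W t \<omega>) ^ (2 * (2 * p)) / 2 + \<epsilon> * (W s \<omega> + W t \<omega>) ^ (2 * (2 * p)) / 2)"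
      using ip im by (intro Bochner_Integration.integrable_add integrable_divide_zero integrable_mult_right) auto
    fix \<omega>
    define x y where "x = (W s \<omega> - W t \<omega>) ^ (2 * p)" and "y = (W s \<omega> + W t \<omega>) ^ (2 * p)"
    have "0 \<le> (x - \<epsilon> * y)\<^sup>2 / \<epsilon>" using \<epsilon> by simp
    also have "\<dots> = (1 / \<epsilon>) * x\<^sup>2 - 2 * (x * y) + \<epsilon> * y\<^sup>2"
      using \<epsilon> by (simp add: power2_eq_square field_simps)
    finally have "x * y \<le> (1 / \<epsilon>) * x\<^sup>2 / 2 + \<epsilon> * y\<^sup>2 / 2" by simp
    moreover have "((W s \<omega>)\<^sup>2 - (W t \<omega>)\<^sup>2) ^ (2 * p) = x * y"
      unfolding x_def y_def power_mult_distrib[symmetric] by (simp add: power2_eq_square algebra_simps)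
    ultimately show "((W s \<omega>)\<^sup>2 - (W t \<omega>)\<^sup>2) ^ (2 * p)
        \<le> (1 / \<epsilon>) * (W s \<omega> - W t \<omega>) ^ (2 * (2 * p)) / 2 + \<epsilon> * (W s \<omega> + W t \<omega>) ^ (2 * (2 * p)) / 2"
      by (simp add: x_def y_def power_mult[symmetric] mult.commute)
  qed
  also have "\<dots> = (1 / \<epsilon>) * (LINT \<omega>|M. (W s \<omega> - W t \<omega>) ^ (2 * (2 * p))) / 2 + \<epsilon> * (LINT \<omega>|M. (W s \<omega> + W t \<omega>) ^ (2 * (2 * p))) / 2"
    using ip im by simp
  also have "\<dots> \<le> (1 / \<epsilon>) * (C ^ (2 * p) * \<epsilon>\<^sup>2 * ?m) / 2 + \<epsilon> * ((4 * C) ^ (2 * p) * ?m) / 2"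
    using 1 2 \<epsilon> by (intro add_mono divide_right_mono mult_left_mono) auto
  also have "\<dots> = ?m * (C ^ (2 * p) + (4 * C) ^ (2 * p)) / 2 * \<epsilon>"
    using \<epsilon> by (simp add: power2_eq_square field_simps)
  finally show ?thesis by (simp add: \<epsilon>_def)
qed

text \<open>On the refined grid the coarse mean takes the value at \<open>k div m\<close> for each
  fine index \<open>k\<close>, so the difference is an average of \<open>W s^2 - W t^2\<close> with
  \<open>\<bar>s - t\<bar> \<le> d\<close>, to which Jensen's inequality applies. The bound does not
  depend on \<open>m\<close>, which permits the passage to the time average.\<close>

lemma quad_mean_refine_moment:
  assumes n: "1 \<le> n" and m: "1 \<le> m" and d: "0 < d"
  shows "(LINT \<omega>|M. (quad_mean n d W \<omega> - quad_mean (n * m) (d / real m) W \<omega>) ^ (2 * p))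
     \<le> std_moment (2 * (2 * p)) * (C ^ (2 * p) + (4 * C) ^ (2 * p)) / 2 * (d powr h) ^ p"
    (is "_ \<le> ?K")
proof -
  let ?N = "n * m" and ?s = "\<lambda>k. real (k div m) * d" and ?t = "\<lambda>k. real k * (d / real m)"
  have N: "0 < ?N" "0 < real ?N" using n m by auto
  have close: "\<bar>?s k - ?t k\<bar> \<le> d" for k
  proof -
    have "real k = real (k div m) * real m + real (k mod m)"
      by (metis div_mult_mod_eq of_nat_add of_nat_mult)
    then have "?t k - ?s k = real (k mod m) * (d / real m)" using m by (simp add: field_simps)
    moreover have "real (k mod m) * (d / real m) \<le> real m * (d / real m)"
      using m d by (intro mult_right_mono) auto
    moreover have "0 \<le> real (k mod m) * (d / real m)" using d by simp
    ultimately show ?thesis using m by auto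
  qed
  have coarse: "quad_mean n d W \<omega> = (1 / real ?N) * (\<Sum>k<?N. (W (?s k) \<omega>)\<^sup>2)" for \<omega>
  proof -
    have "(\<Sum>k<?N. (W (?s k) \<omega>)\<^sup>2) = (\<Sum>i<n. \<Sum>k\<in>{i * m..<i * m + m}. (W (?s k) \<omega>)\<^sup>2)"
      by (simp add: sum.nat_group)
    also have "\<dots> = (\<Sum>i<n. \<Sum>k\<in>{i * m..<i * m + m}. (W (real i * d) \<omega>)\<^sup>2)"
    proof (intro sum.cong refl)
      fix i k assume "k \<in> {i * m..<i * m + m}"
      then have "k div m = i" using m by (intro div_nat_eqI) (auto simp: mult.commute)
      then show "(W (?s k) \<omega>)\<^sup>2 = (W (real i * d) \<omega>)\<^sup>2" by simp
    qed
    also have "\<dots> = real m * (\<Sum>i<n. (W (real i * d) \<omega>)\<^sup>2)" by (simp add: sum_distrib_left)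
    finally show ?thesis using m by (simp add: quad_mean_eq)
  qed
  define y where "y k \<omega> = (W (?s k) \<omega>)\<^sup>2 - (W (?t k) \<omega>)\<^sup>2" for k \<omega>
  have am: "all_moments M (y k)" for k
    unfolding y_def using d by (intro all_moments_diff all_moments_power finite_measure_axioms W_all_moments) auto
  have diff: "quad_mean n d W \<omega> - quad_mean ?N (d / real m) W \<omega> = (\<Sum>k<?N. (1 / real ?N) *\<^sub>R y k \<omega>)" for \<omega>
    unfolding coarse quad_mean_eq[of ?N] y_def
    by (simp only: real_scaleR_def sum_distrib_left[symmetric] sum_subtractf right_diff_distrib)
  have "(LINT \<omega>|M. (quad_mean n d W \<omega> - quad_mean ?N (d / real m) W \<omega>) ^ (2 * p))
     \<le> (LINT \<omega>|M. (\<Sum>k<?N. (1 / real ?N) * y k \<omega> ^ (2 * p)))"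
  proof (rule integral_mono)
    show "integrable M (\<lambda>\<omega>. (quad_mean n d W \<omega> - quad_mean ?N (d / real m) W \<omega>) ^ (2 * p))"
      unfolding diff real_scaleR_def
      by (intro all_moments_power_integrable all_moments_sum all_moments_mult all_moments_const finite_measure_axioms am)
    show "integrable M (\<lambda>\<omega>. \<Sum>k<?N. (1 / real ?N) * y k \<omega> ^ (2 * p))"
      by (intro all_moments_integrable all_moments_sum all_moments_mult all_moments_power all_moments_const finite_measure_axioms am)
    show "(quad_mean n d W \<omega> - quad_mean ?N (d / real m) W \<omega>) ^ (2 * p) \<le> (\<Sum>k<?N. (1 / real ?N) * y k \<omega> ^ (2 * p))" for \<omega>
      unfolding diff
      by (rule convex_on_sum[where C=UNIV]) (use N n m in \<open>auto intro!: convex_power_even simp: lessThan_empty_iff\<close>)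
  qed
  also have "\<dots> = (\<Sum>k<?N. (1 / real ?N) * (LINT \<omega>|M. y k \<omega> ^ (2 * p)))"
    using all_moments_power_integrable[OF am] by (simp add: Bochner_Integration.integral_sum del: of_nat_mult)
  also have "\<dots> \<le> (\<Sum>k<?N. (1 / real ?N) * ?K)"
    unfolding y_def using d close N by (intro sum_mono mult_left_mono square_difference_moment) auto
  also have "\<dots> = ?K" using N by simp
  finally show ?thesis .
qed

lemma quad_mean_refine_tendsto:
  assumes c: "continuous_on {0..} (\<lambda>t. W t \<omega>)" and n: "1 \<le> n" and d: "0 < d"
  shows "(\<lambda>m. quad_mean (n * Suc m) (d / real (Suc m)) W \<omega>) \<longlonglongrightarrow> time_average (real n * d) \<omega>"
proof -
  have T: "0 < real n * d" using n d by simp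
  have "continuous_on {0..real n * d} (\<lambda>t. (W t \<omega>)\<^sup>2)"
    by (intro continuous_intros continuous_on_subset[OF c]) auto
  from riemann_left_sum_tendsto[OF this T]
  have "(\<lambda>N. (1 / real N) * (\<Sum>k<N. (W (real k * (real n * d / real N)) \<omega>)\<^sup>2)) \<longlonglongrightarrow> time_average (real n * d) \<omega>"
    by (simp add: time_average_def)
  then have "((\<lambda>N. (1 / real N) * (\<Sum>k<N. (W (real k * (real n * d / real N)) \<omega>)\<^sup>2)) \<circ> (\<lambda>m. n * Suc m)) \<longlonglongrightarrow> time_average (real n * d) \<omega>"
    by (rule LIMSEQ_subseq_LIMSEQ) (use n in \<open>auto simp: strict_mono_def\<close>)
  moreover have "real n * d / real (n * Suc m) = d / real (Suc m)" for m
    unfolding of_nat_mult using n by (simp del: of_nat_Suc)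
  ultimately show ?thesis unfolding o_def quad_mean_eq by (simp only:)
qed

text \<open>At most \<open>\<tau> / d + 1\<close> grid points precede the time \<open>\<tau>\<close>
  after which the variance is close to \<open>\<sigma>\<close>. Their share is
  \<open>\<tau> / (n * d) + 1 / n\<close>, hence the two divergence conditions.\<close>

lemma mean_variance_tendsto:
  assumes N: "filterlim N at_top sequentially" and ND: "filterlim (\<lambda>k. real (N k) * D k) at_top sequentially"
    and D: "\<And>k. 0 < D k"
  shows "(\<lambda>k. mean_variance (N k) (D k)) \<longlonglongrightarrow> \<sigma>"
proof (rule LIMSEQ_I)
  fix e :: real assume "0 < e"
  then have "\<forall>\<^sub>F t in at_top. \<bar>r t t - \<sigma>\<bar> < e / 2"
    using tendstoD[OF diagonal, of "e / 2"] by (simp add: dist_real_def)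
  then obtain t0 where t0: "\<And>t. t0 \<le> t \<Longrightarrow> \<bar>r t t - \<sigma>\<bar> < e / 2" by (auto simp: eventually_at_top_linorder)
  define \<tau> where "\<tau> = max 0 t0"
  define A where "A = C + \<bar>\<sigma>\<bar>"
  have bd: "\<bar>mean_variance n d - \<sigma>\<bar> \<le> e / 2 + A * (\<tau> / (real n * d) + 1 / real n)" if n: "1 \<le> n" and d: "0 < d" for n d
  proof -
    define c where "c i = (if real i * d < \<tau> then 1 else 0 :: real)" for i
    have "\<bar>mean_variance n d - \<sigma>\<bar> = \<bar>(1 / real n) * (\<Sum>i<n. r (real i * d) (real i * d) - \<sigma>)\<bar>"
      using n by (simp add: mean_variance_def sum_subtractf field_simps)
    also have "\<dots> \<le> (1 / real n) * (\<Sum>i<n. \<bar>r (real i * d) (real i * d) - \<sigma>\<bar>)"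
      unfolding abs_mult by (intro mult_mono) auto
    also have "\<dots> \<le> (1 / real n) * (\<Sum>i<n. e / 2 + A * c i)"
    proof (intro mult_left_mono sum_mono)
      fix i
      show "\<bar>r (real i * d) (real i * d) - \<sigma>\<bar> \<le> e / 2 + A * c i"
      proof (cases "real i * d < \<tau>")
        case True
        have "\<bar>r (real i * d) (real i * d)\<bar> \<le> C" using d by (intro r_bound) auto
        then have "\<bar>r (real i * d) (real i * d) - \<sigma>\<bar> \<le> C + \<bar>\<sigma>\<bar>" by linarith
        then show ?thesis using True \<open>0 < e\<close> by (simp add: c_def A_def)
      next
        case False
        then have "t0 \<le> real i * d" by (simp add: \<tau>_def)
        then show ?thesis using t0[of "real i * d"] False by (simp add: c_def)
      qed
    qed simp
    also have "\<dots> = e / 2 + A * ((\<Sum>i<n. c i) / real n)"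
      unfolding sum.distrib sum_distrib_left[symmetric] using n by (simp add: field_simps)
    also have "(\<Sum>i<n. c i) \<le> \<tau> / d + 1"
    proof -
      have "(\<Sum>i<n. c i) = real (card {i\<in>{..<n}. real i * d < \<tau>})"
        unfolding c_def by (simp add: sum.inter_filter[symmetric])
      also have "\<dots> \<le> real (card {..<nat \<lceil>\<tau> / d\<rceil>})"
      proof (intro of_nat_mono card_mono)
        show "{i\<in>{..<n}. real i * d < \<tau>} \<subseteq> {..<nat \<lceil>\<tau> / d\<rceil>}"
          using d by (auto simp: field_simps zless_nat_eq_int_zless less_ceiling_iff)
      qed simp
      also have "\<dots> \<le> \<tau> / d + 1" using d by (simp add: \<tau>_def)
      finally show ?thesis .
    qed
    then have "e / 2 + A * ((\<Sum>i<n. c i) / real n) \<le> e / 2 + A * ((\<tau> / d + 1) / real n)"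
      using C_nonneg by (intro add_left_mono mult_left_mono divide_right_mono) (auto simp: A_def)
    finally show ?thesis using n d by (simp add: add_divide_distrib mult.commute)
  qed
  have inv: "(\<lambda>k. inverse (real (N k) * D k)) \<longlonglongrightarrow> 0" "(\<lambda>k. inverse (real (N k))) \<longlonglongrightarrow> 0"
    using ND filterlim_compose[OF filterlim_real_sequentially N] by (intro tendsto_inverse_0_at_top; simp)+
  have "(\<lambda>k. e / 2 + A * (\<tau> * inverse (real (N k) * D k) + inverse (real (N k)))) \<longlonglongrightarrow> e / 2 + A * (\<tau> * 0 + 0)"
    by (intro tendsto_intros inv)
  then have "\<forall>\<^sub>F k in sequentially. e / 2 + A * (\<tau> * inverse (real (N k) * D k) + inverse (real (N k))) < e"
    by (rule order_tendstoD(2)) (use \<open>0 < e\<close> in auto)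
  moreover have "\<forall>\<^sub>F k in sequentially. 1 \<le> N k" using N by (simp add: filterlim_at_top)
  ultimately have "\<forall>\<^sub>F k in sequentially. norm (mean_variance (N k) (D k) - \<sigma>) < e"
  proof eventually_elim
    case (elim k)
    have "\<bar>mean_variance (N k) (D k) - \<sigma>\<bar> \<le> e / 2 + A * (\<tau> / (real (N k) * D k) + 1 / real (N k))"
      by (rule bd[OF elim(2) D])
    also have "\<dots> = e / 2 + A * (\<tau> * inverse (real (N k) * D k) + inverse (real (N k)))"
      by (simp only: divide_inverse mult_1_left)
    also have "\<dots> < e" by (rule elim(1))
    finally show ?case by simp
  qed
  then show "\<exists>no. \<forall>n\<ge>no. norm (mean_variance (N n) (D n) - \<sigma>) < e" by (simp add: eventually_sequentially)
qed

lemma quad_mean_AE_tendsto_fast: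
  assumes D: "\<And>k. 0 < D k" and \<delta>: "0 < \<delta>"
    and N: "\<And>k. real (Suc k) powr \<delta> \<le> real (N k)" and ND: "\<And>k. real (Suc k) powr \<delta> \<le> real (N k) * D k"
  shows "AE \<omega> in M. (\<lambda>k. quad_mean (N k) (D k) W \<omega>) \<longlonglongrightarrow> \<sigma>"
proof -
  \<comment> \<open>Chosen so that the bounds
    \<open>Suc k powr (- (\<delta> * \<gamma> * p))\<close> on the moments are summable.\<close>
  obtain p where p: "2 / (\<delta> * \<gamma>) < real p" using reals_Archimedean2 by blast
  have "0 < 2 / (\<delta> * \<gamma>)" using \<delta> \<gamma> by simp
  then have p0: "0 < p" using p by (auto intro: gr0I)
  have p2: "2 < \<delta> * \<gamma> * real p" using p \<delta> \<gamma> by (simp add: field_simps)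
  have N1: "1 \<le> N k" for k using order_trans[OF ge_one_powr_ge_zero N[of k]] \<delta> by simp
  define K where "K = (8 * C\<^sup>2 / (1 - \<gamma>)) ^ p * (std_moment (2 * p))\<^sup>2"
  have K: "0 \<le> K" using \<gamma> by (simp add: K_def)
  have div: "filterlim (\<lambda>k. real (Suc k) powr \<delta>) at_top sequentially"
    using \<delta> by (intro filterlim_compose[OF powr_at_top] filterlim_compose[OF filterlim_real_sequentially filterlim_Suc]) auto
  have am: "all_moments M (\<lambda>\<omega>. quad_mean (N k) (D k) W \<omega> - mean_variance (N k) (D k))" for k
    using D[of k] by (intro all_moments_diff finite_measure_axioms all_moments_const quad_mean_all_moments) auto
  have "AE \<omega> in M. (\<lambda>k. quad_mean (N k) (D k) W \<omega> - mean_variance (N k) (D k)) \<longlonglongrightarrow> 0"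
  proof (rule summable_nn_integral_imp_tendsto_0[where p=p and c="\<lambda>k. K * real (Suc k) powr (- (\<delta> * \<gamma> * real p))"
        and f="\<lambda>k \<omega>. ennreal ((quad_mean (N k) (D k) W \<omega> - mean_variance (N k) (D k)) ^ (2 * p))"])
    show "(\<lambda>\<omega>. ennreal ((quad_mean (N k) (D k) W \<omega> - mean_variance (N k) (D k)) ^ (2 * p))) \<in> borel_measurable M" for k
      using all_moments_measurable[OF am[of k]] by measurable
    show "summable (\<lambda>k. K * real (Suc k) powr (- (\<delta> * \<gamma> * real p)))"
      using p2 by (intro summable_mult) (subst summable_Suc_iff, simp add: summable_real_powr_iff)
    fix k
    let ?\<mu> = "min (real (N k)) (real (N k) * D k)"
    have "?\<mu> powr (- \<gamma>) \<le> (real (Suc k) powr \<delta>) powr (- \<gamma>)"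
      using N[of k] ND[of k] \<gamma> by (intro powr_mono2') auto
    then have "(?\<mu> powr (- \<gamma>)) ^ p \<le> ((real (Suc k) powr \<delta>) powr (- \<gamma>)) ^ p"
      by (intro power_mono) auto
    also have "\<dots> = real (Suc k) powr (- (\<delta> * \<gamma> * real p))"
      by (simp add: powr_powr powr_power mult_ac)
    finally have "K * (?\<mu> powr (- \<gamma>)) ^ p \<le> K * real (Suc k) powr (- (\<delta> * \<gamma> * real p))"
      using K by (rule mult_left_mono)
    then have "(LINT \<omega>|M. (quad_mean (N k) (D k) W \<omega> - mean_variance (N k) (D k)) ^ (2 * p)) \<le> K * real (Suc k) powr (- (\<delta> * \<gamma> * real p))"
      using quad_mean_moment[OF N1 D, of k k p] unfolding K_def by linarith
    then show "(\<integral>\<^sup>+\<omega>. ennreal ((quad_mean (N k) (D k) W \<omega> - mean_variance (N k) (D k)) ^ (2 * p)) \<partial>M)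
        \<le> ennreal (K * real (Suc k) powr (- (\<delta> * \<gamma> * real p)))"
      by (subst nn_integral_eq_integral[OF all_moments_power_integrable[OF am]]) (auto intro: ennreal_leI)
  qed (use p0 K in auto)
  moreover have mean: "(\<lambda>k. mean_variance (N k) (D k)) \<longlonglongrightarrow> \<sigma>"
  proof (rule mean_variance_tendsto[OF _ _ D])
    have "filterlim (\<lambda>k. real (N k)) at_top sequentially"
      by (rule filterlim_at_top_mono[OF div]) (use N in auto)
    then show "filterlim N at_top sequentially" by (simp add: filterlim_sequentially_iff_filterlim_real)
    show "filterlim (\<lambda>k. real (N k) * D k) at_top sequentially"
      by (rule filterlim_at_top_mono[OF div]) (use ND in auto)
  qed
  ultimately show ?thesis
  proof (elim AE_mp, intro AE_I2 impI)
    fix \<omega> assume "(\<lambda>k. quad_mean (N k) (D k) W \<omega> - mean_variance (N k) (D k)) \<longlonglongrightarrow> 0"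
    from tendsto_add[OF this mean] show "(\<lambda>k. quad_mean (N k) (D k) W \<omega>) \<longlonglongrightarrow> \<sigma>" by simp
  qed
qed

text \<open>The lower limit over refinements, almost surely equal to the power of the difference with the time average,
  makes Fatou's lemma applicable without proving the time average measurable.\<close>

lemma quad_mean_time_average_AE:
  assumes N: "\<And>k. 1 \<le> N k" and D: "\<And>k. 0 < D k" "\<And>k. D k \<le> real (Suc k) powr (- \<delta>)" and \<delta>: "0 < \<delta>"
  shows "AE \<omega> in M. (\<lambda>k. quad_mean (N k) (D k) W \<omega> - time_average (real (N k) * D k) \<omega>) \<longlonglongrightarrow> 0"
proof -
  obtain p where p: "2 / (\<delta> * h) < real p" using reals_Archimedean2 by blast
  have "0 < 2 / (\<delta> * h)" using \<delta> h by simp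
  then have p0: "0 < p" using p by (auto intro: gr0I)
  have p2: "2 < \<delta> * h * real p" using p \<delta> h by (simp add: field_simps)
  define K where "K = std_moment (2 * (2 * p)) * (C ^ (2 * p) + (4 * C) ^ (2 * p)) / 2"
  have K: "0 \<le> K" using C_nonneg std_moment_even_nonneg[of "2 * p"] by (simp add: K_def)
  define Y where "Y k m \<omega> = quad_mean (N k) (D k) W \<omega> - quad_mean (N k * Suc m) (D k / real (Suc m)) W \<omega>" for k m \<omega>
  have am: "all_moments M (Y k m)" for k m
    unfolding Y_def using D(1)[of k] by (intro all_moments_diff finite_measure_axioms quad_mean_all_moments) auto
  have Y_meas [measurable]: "Y k m \<in> borel_measurable M" for k m
    using all_moments_measurable[OF am] .
  show ?thesis
  proof (rule summable_nn_integral_imp_tendsto_0[where p=p and c="\<lambda>k. K * real (Suc k) powr (- (\<delta> * h * real p))"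
        and f="\<lambda>k \<omega>. liminf (\<lambda>m. ennreal (Y k m \<omega> ^ (2 * p)))"])
    show "(\<lambda>\<omega>. liminf (\<lambda>m. ennreal (Y k m \<omega> ^ (2 * p)))) \<in> borel_measurable M" for k by measurable
    show "summable (\<lambda>k. K * real (Suc k) powr (- (\<delta> * h * real p)))"
      using p2 by (intro summable_mult) (subst summable_Suc_iff, simp add: summable_real_powr_iff)
    fix k
    have "(D k powr h) ^ p \<le> ((real (Suc k) powr (- \<delta>)) powr h) ^ p"
      using D(1,2)[of k] h by (intro power_mono powr_mono2) auto
    also have "\<dots> = real (Suc k) powr (- (\<delta> * h * real p))" by (simp add: powr_powr powr_power mult_ac)
    finally have "K * (D k powr h) ^ p \<le> K * real (Suc k) powr (- (\<delta> * h * real p))"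
      using K by (rule mult_left_mono)
    then have le: "(LINT \<omega>|M. Y k m \<omega> ^ (2 * p)) \<le> K * real (Suc k) powr (- (\<delta> * h * real p))" for m
      using quad_mean_refine_moment[OF N _ D(1), of "Suc m" k k p] unfolding K_def Y_def by auto
    have "(\<integral>\<^sup>+\<omega>. liminf (\<lambda>m. ennreal (Y k m \<omega> ^ (2 * p))) \<partial>M) \<le> liminf (\<lambda>m. \<integral>\<^sup>+\<omega>. ennreal (Y k m \<omega> ^ (2 * p)) \<partial>M)"
      by (rule nn_integral_liminf) measurable
    also have "\<dots> \<le> liminf (\<lambda>m. ennreal (K * real (Suc k) powr (- (\<delta> * h * real p))))"
    proof (intro Liminf_mono always_eventually allI)
      fix m
      show "(\<integral>\<^sup>+\<omega>. ennreal (Y k m \<omega> ^ (2 * p)) \<partial>M) \<le> ennreal (K * real (Suc k) powr (- (\<delta> * h * real p)))"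
        by (subst nn_integral_eq_integral[OF all_moments_power_integrable[OF am]])
          (auto intro: ennreal_leI[OF le] simp del: of_nat_Suc)
    qed
    finally show "(\<integral>\<^sup>+\<omega>. liminf (\<lambda>m. ennreal (Y k m \<omega> ^ (2 * p))) \<partial>M) \<le> ennreal (K * real (Suc k) powr (- (\<delta> * h * real p)))"
      by (simp add: Liminf_const)
  next
    show "AE \<omega> in M. \<forall>k. liminf (\<lambda>m. ennreal (Y k m \<omega> ^ (2 * p)))
        = ennreal ((quad_mean (N k) (D k) W \<omega> - time_average (real (N k) * D k) \<omega>) ^ (2 * p))"
      using continuous
    proof eventually_elim
      case (elim \<omega>)
      show ?case
      proof
        fix k
        have "(\<lambda>m. ennreal (Y k m \<omega> ^ (2 * p))) \<longlonglongrightarrow> ennreal ((quad_mean (N k) (D k) W \<omega> - time_average (real (N k) * D k) \<omega>) ^ (2 * p))"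
          unfolding Y_def by (intro tendsto_intros tendsto_ennrealI quad_mean_refine_tendsto elim N D)
        then show "liminf (\<lambda>m. ennreal (Y k m \<omega> ^ (2 * p)))
          = ennreal ((quad_mean (N k) (D k) W \<omega> - time_average (real (N k) * D k) \<omega>) ^ (2 * p))"
          by (intro lim_imp_Liminf) auto
      qed
    qed
  qed (use p0 K in auto)
qed

lemma time_average_AE_tendsto: "AE \<omega> in M. ((\<lambda>T. time_average T \<omega>) \<longlongrightarrow> \<sigma>) at_top"
proof -
  \<comment> \<open>A grid of horizon exactly \<open>Suc k\<close> whose size and horizon grow at
    least linearly and whose step decays like \<open>1 / Suc k\<close>: both preceding results apply
    with \<open>\<delta> = 1\<close>.\<close>
  let ?N = "\<lambda>k. Suc k * Suc k" and ?D = "\<lambda>k. 1 / real (Suc k)"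
  have ND: "real (?N k) * ?D k = real (Suc k)" for k unfolding of_nat_mult by (simp del: of_nat_Suc)
  have "AE \<omega> in M. (\<lambda>k. quad_mean (?N k) (?D k) W \<omega>) \<longlonglongrightarrow> \<sigma>"
    by (rule quad_mean_AE_tendsto_fast[where \<delta>=1]) (auto simp: ND simp del: of_nat_Suc mult_Suc mult_Suc_right)
  moreover have "AE \<omega> in M. (\<lambda>k. quad_mean (?N k) (?D k) W \<omega> - time_average (real (?N k) * ?D k) \<omega>) \<longlonglongrightarrow> 0"
    by (rule quad_mean_time_average_AE[where \<delta>=1]) (auto simp: powr_minus_divide simp del: of_nat_Suc)
  ultimately show ?thesis using continuous
  proof eventually_elim
    case (elim \<omega>)
    have "(\<lambda>k. time_average (real (Suc k)) \<omega>) \<longlonglongrightarrow> \<sigma> - 0"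
      using tendsto_diff[OF elim(1) elim(2)] unfolding ND by simp
    then have nat_lim: "(\<lambda>k. time_average (real k) \<omega>) \<longlonglongrightarrow> \<sigma>" by (simp add: LIMSEQ_imp_Suc del: of_nat_Suc)
    define J where "J T = integral {0..T} (\<lambda>t. (W t \<omega>)\<^sup>2)" for T
    have int: "(\<lambda>t. (W t \<omega>)\<^sup>2) integrable_on {0..T}" for T
      by (intro integrable_continuous_real continuous_intros continuous_on_subset[OF elim(3)]) auto
    have J_mono: "J S \<le> J T" if "S \<le> T" for S T
      unfolding J_def using that int by (intro integral_subset_le) auto
    have avg: "time_average T \<omega> = J T / T" for T by (simp add: time_average_def J_def)
    let ?k = "\<lambda>T::real. nat \<lfloor>T\<rfloor>"
    have fl: "filterlim ?k at_top at_top"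
      unfolding filterlim_at_top
    proof
      fix Z
      show "\<forall>\<^sub>F T in at_top. Z \<le> ?k T"
        using eventually_ge_at_top[of "real Z"] by eventually_elim (simp add: le_nat_floor)
    qed
    \<comment> \<open>The time average at T lies between those at the floor of T and at the next
      integer, up to ratios that tend to 1, since \<open>J\<close> is monotone.\<close>
    have lo: "((\<lambda>T. (real (?k T) / T) * time_average (real (?k T)) \<omega>) \<longlongrightarrow> 1 * \<sigma>) at_top"
      and hi: "((\<lambda>T. (real (Suc (?k T)) / T) * time_average (real (Suc (?k T))) \<omega>) \<longlongrightarrow> 1 * \<sigma>) at_top"
    proof -
      have inv: "((\<lambda>T::real. 1 / T) \<longlongrightarrow> 0) at_top" 
        using tendsto_inverse_0_at_top[OF filterlim_ident] by (simp add: inverse_eq_divide)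
      have f1: "((\<lambda>T. real (?k T) / T) \<longlongrightarrow> 1) at_top"
      proof (rule real_tendsto_sandwich)
        show "\<forall>\<^sub>F T in at_top. 1 - 1 / T \<le> real (?k T) / T"
          using eventually_gt_at_top[of 0]
        proof eventually_elim
          case (elim T)
          have "T - 1 \<le> real (?k T)" by linarith
          then have "(T - 1) / T \<le> real (?k T) / T" using elim by (intro divide_right_mono) auto
          then show ?case using elim by (simp add: diff_divide_distrib)
        qed
        show "\<forall>\<^sub>F T in at_top. real (?k T) / T \<le> 1"
          using eventually_gt_at_top[of 0] by eventually_elim (simp add: field_simps)
        show "((\<lambda>T::real. 1 - 1 / T) \<longlongrightarrow> 1) at_top" using tendsto_diff[OF tendsto_const inv, of 1] by simp
      qed simp
      have f2: "((\<lambda>T. real (Suc (?k T)) / T) \<longlongrightarrow> 1) at_top"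
        using tendsto_add[OF f1 inv] by (simp add: add_divide_distrib add.commute)
      show "((\<lambda>T. (real (?k T) / T) * time_average (real (?k T)) \<omega>) \<longlongrightarrow> 1 * \<sigma>) at_top"
        by (intro tendsto_mult f1 filterlim_compose[OF nat_lim fl])
      show "((\<lambda>T. (real (Suc (?k T)) / T) * time_average (real (Suc (?k T))) \<omega>) \<longlongrightarrow> 1 * \<sigma>) at_top"
        by (intro tendsto_mult f2 filterlim_compose[OF nat_lim filterlim_compose[OF filterlim_Suc fl]])
    qed
    show ?case
    proof (rule real_tendsto_sandwich)
      show "\<forall>\<^sub>F T in at_top. (real (?k T) / T) * time_average (real (?k T)) \<omega> \<le> time_average T \<omega>"
        using eventually_ge_at_top[of 1]
      proof eventually_elim
        case (elim T)
        then have "1 \<le> \<lfloor>T\<rfloor>" by simp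
        then have "0 < real (?k T)" "real (?k T) \<le> T" by auto
        have cancel: "x / T * (y / x) = y / T" if "0 < x" for x y using that by simp
        have "real (?k T) / T * (J (real (?k T)) / real (?k T)) = J (real (?k T)) / T"
          by (rule cancel) fact
        also have "\<dots> \<le> J T / T"
          using J_mono[OF \<open>real (?k T) \<le> T\<close>] elim by (intro divide_right_mono) auto
        finally show ?case by (simp only: avg)
      qed
      show "\<forall>\<^sub>F T in at_top. time_average T \<omega> \<le> (real (Suc (?k T)) / T) * time_average (real (Suc (?k T))) \<omega>"
        using eventually_ge_at_top[of 1]
      proof eventually_elim
        case (elim T)
        then have "T \<le> real (Suc (?k T))" by simp linarith
        then show ?case using J_mono[of T "real (Suc (?k T))"] elim by (simp add: avg divide_right_mono del: of_nat_Suc)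
      qed
    qed (use lo hi in simp_all)
  qed
qed

text \<open>The two regimes may alternate in n. Instead of subsequences, two full step sequences are
  used, each agreeing with \<open>D\<close> on its own indices and harmless on the others; every n
  is covered by one of them.\<close>

theorem quad_mean_AE_tendsto:
  assumes D: "\<And>n. 1 \<le> n \<Longrightarrow> 0 < D n" and T: "filterlim (\<lambda>n. real n * D n) at_top sequentially"
  shows "AE \<omega> in M. (\<lambda>n. quad_mean n (D n) W \<omega>) \<longlonglongrightarrow> \<sigma>"
proof -
  define fast where "fast k \<longleftrightarrow> sqrt (real (Suc k)) \<le> real (Suc k) * D (Suc k)" for k
  define D1 where "D1 k = (if fast k then D (Suc k) else 1)" for k
  define D2 where "D2 k = (if fast k then 1 / sqrt (real (Suc k)) else D (Suc k))" for k
  have sqrt_le: "sqrt (real (Suc k)) \<le> real (Suc k)" for k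
    by (rule real_le_lsqrt) (auto simp: power2_eq_square)
  have half: "x powr (1 / 2) = sqrt x" if "0 \<le> x" for x :: real using that by (rule powr_half_sqrt)
  have neg_half: "real (Suc k) powr (- (1 / 2)) = 1 / sqrt (real (Suc k))" for k
    unfolding powr_minus half[OF of_nat_0_le_iff] by (rule inverse_eq_divide)
  have A: "AE \<omega> in M. (\<lambda>k. quad_mean (Suc k) (D1 k) W \<omega>) \<longlonglongrightarrow> \<sigma>"
  proof (rule quad_mean_AE_tendsto_fast[where \<delta>="1 / 2"])
    show "real (Suc k) powr (1 / 2) \<le> real (Suc k)" "real (Suc k) powr (1 / 2) \<le> real (Suc k) * D1 k" for k
      unfolding half[OF of_nat_0_le_iff] using sqrt_le[of k] by (auto simp: D1_def fast_def)
  qed (use D in \<open>auto simp: D1_def\<close>)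
  have D2_pos: "0 < D2 k" for k using D[of "Suc k"] by (simp add: D2_def)
  have B: "AE \<omega> in M. (\<lambda>k. quad_mean (Suc k) (D2 k) W \<omega> - time_average (real (Suc k) * D2 k) \<omega>) \<longlonglongrightarrow> 0"
  proof (rule quad_mean_time_average_AE[where \<delta>="1 / 2"])
    fix k
    show "D2 k \<le> real (Suc k) powr (- (1 / 2))"
    proof (cases "fast k")
      case True
      then show ?thesis unfolding neg_half by (simp add: D2_def)
    next
      case False
      then have "real (Suc k) * D (Suc k) \<le> sqrt (real (Suc k))" by (simp add: fast_def)
      then have "D (Suc k) \<le> sqrt (real (Suc k)) / real (Suc k)"
        by (simp add: pos_le_divide_eq mult.commute del: of_nat_Suc)
      also have "\<dots> = 1 / sqrt (real (Suc k))" by (rule sqrt_divide_self_eq[THEN trans]) (auto simp: inverse_eq_divide)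
      finally show ?thesis using False unfolding neg_half by (simp add: D2_def)
    qed
  qed (use D2_pos in auto)
  have lim: "filterlim (\<lambda>k. real (Suc k) * D2 k) at_top sequentially"
  proof (rule filterlim_at_top_mono)
    have "filterlim (\<lambda>k. sqrt (real (Suc k))) at_top sequentially"
      by (intro filterlim_compose[OF sqrt_at_top] filterlim_compose[OF filterlim_real_sequentially filterlim_Suc])
    then show "filterlim (\<lambda>k. min (real (Suc k) * D (Suc k)) (sqrt (real (Suc k)))) at_top sequentially"
      using filterlim_compose[OF T filterlim_Suc] by (auto simp: filterlim_at_top eventually_conj_iff)
    show "\<forall>\<^sub>F k in sequentially. min (real (Suc k) * D (Suc k)) (sqrt (real (Suc k))) \<le> real (Suc k) * D2 k"
      by (intro always_eventually allI) (auto simp: D2_def real_div_sqrt simp del: of_nat_Suc)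
  qed
  show ?thesis
    using A B time_average_AE_tendsto
  proof eventually_elim
    case (elim \<omega>)
    have "(\<lambda>k. time_average (real (Suc k) * D2 k) \<omega>) \<longlonglongrightarrow> \<sigma>" using filterlim_compose[OF elim(3) lim] .
    from tendsto_add[OF elim(2) this] have B': "(\<lambda>k. quad_mean (Suc k) (D2 k) W \<omega>) \<longlonglongrightarrow> \<sigma>" by simp
    have "(\<lambda>k. quad_mean (Suc k) (D (Suc k)) W \<omega>) \<longlonglongrightarrow> \<sigma>"
    proof (rule tendstoI)
      fix e :: real assume "0 < e"
      from tendstoD[OF elim(1) this] tendstoD[OF B' this]
      show "\<forall>\<^sub>F k in sequentially. dist (quad_mean (Suc k) (D (Suc k)) W \<omega>) \<sigma> < e"
        by eventually_elim (auto simp: D1_def D2_def split: if_splits)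
    qed
    then show ?case by (rule LIMSEQ_imp_Suc)
  qed
qed

end

section \<open>The moment equation\<close>

text \<open>Slope of the chord of \<open>u \<mapsto> u powr \<beta>\<close> between u and v,
  extended by the derivative on the diagonal; the form of \<open>F_bar\<close> in squared
  variables.\<close>

definition secant :: "real \<Rightarrow> real \<Rightarrow> real \<Rightarrow> real" where
  "secant \<beta> v u = (if u = v then \<beta> * v powr (\<beta> - 1) else (v powr \<beta> - u powr \<beta>) / (v - u))"

lemma powr_secant_mean_value:
  fixes \<beta> :: real
  assumes "0 < a" "a < b"
  obtains z where "a < z" "z < b" "b powr \<beta> - a powr \<beta> = (b - a) * (\<beta> * z powr (\<beta> - 1))"
proof -
  have "\<exists>z>a. z < b \<and> b powr \<beta> - a powr \<beta> = (b - a) * (\<beta> * z powr (\<beta> - 1))"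
    by (rule MVT2[OF \<open>a < b\<close>]) (use assms in \<open>auto intro!: derivative_eq_intros\<close>)
  then show ?thesis using that by blast
qed

text \<open>Chord slopes of a strictly concave function decrease when an endpoint moves right. The
  derivative is strictly decreasing, so mean value points order the slopes; the case distinction is
  on the position of \<open>v\<close> relative to \<open>u\<close> and \<open>w\<close>.\<close>

lemma secant_strict_decreasing:
  assumes \<beta>: "0 < \<beta>" "\<beta> < 1" and u: "0 < u" "u < w" and v: "0 < v"
  shows "secant \<beta> v w < secant \<beta> v u"
proof -
  have d: "\<beta> * b powr (\<beta> - 1) < \<beta> * a powr (\<beta> - 1)" if "0 < a" "a < b" for a b
    using that \<beta> by (intro mult_strict_left_mono powr_less_mono2_neg) auto
  have s: "secant \<beta> b a = secant \<beta> a b" for a b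
    by (auto simp: secant_def) (metis minus_diff_eq minus_divide_divide)
  have right: "secant \<beta> a b < \<beta> * a powr (\<beta> - 1)" and left: "\<beta> * b powr (\<beta> - 1) < secant \<beta> b a"
    if ab: "0 < a" "a < b" for a b
  proof -
    obtain z where z: "a < z" "z < b" "b powr \<beta> - a powr \<beta> = (b - a) * (\<beta> * z powr (\<beta> - 1))"
      using powr_secant_mean_value[OF ab] .
    then have "secant \<beta> b a = \<beta> * z powr (\<beta> - 1)" using ab by (simp add: secant_def)
    then show "secant \<beta> a b < \<beta> * a powr (\<beta> - 1)" "\<beta> * b powr (\<beta> - 1) < secant \<beta> b a"
      using d[of a z] d[of z b] z ab by (auto simp: s)
  qed
  have three: "secant \<beta> b c < secant \<beta> a c" "secant \<beta> a c < secant \<beta> a b"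
    if abc: "0 < a" "a < b" "b < c" for a b c
  proof -
    define A B where "A = secant \<beta> a b" and "B = secant \<beta> b c"
    obtain z where z: "a < z" "z < b" "b powr \<beta> - a powr \<beta> = (b - a) * (\<beta> * z powr (\<beta> - 1))"
      using powr_secant_mean_value[OF abc(1,2)] .
    obtain y where y: "b < y" "y < c" "c powr \<beta> - b powr \<beta> = (c - b) * (\<beta> * y powr (\<beta> - 1))"
      using powr_secant_mean_value[OF order.strict_trans[OF abc(1,2)] abc(3)] .
    have A: "A = \<beta> * z powr (\<beta> - 1)" unfolding A_def s[of a] using that z by (simp add: secant_def s)
    have B: "B = \<beta> * y powr (\<beta> - 1)" unfolding B_def s[of b] using that y by (simp add: secant_def s)
    have "B < A" unfolding A B using d[of z y] y z that by auto
    \<comment> \<open>The slope of the long chord is the weighted mean of those of the two short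
      ones, hence strictly between \<open>B\<close> and \<open>A\<close>.\<close>
    have "c powr \<beta> - a powr \<beta> = (c - b) * B + (b - a) * A"
      using y(3) z(3) unfolding A B by simp
    moreover have "secant \<beta> a c = (c powr \<beta> - a powr \<beta>) / (c - a)"
      unfolding s[of c a, symmetric] using that by (simp add: secant_def)
    ultimately have S: "secant \<beta> a c = ((c - b) * B + (b - a) * A) / (c - a)" by simp
    have "B * (c - a) < (c - b) * B + (b - a) * A"
      using mult_strict_left_mono[OF \<open>B < A\<close>, of "b - a"] that by (simp add: algebra_simps)
    then show "secant \<beta> b c < secant \<beta> a c" unfolding S B_def[symmetric] using that by (simp add: less_divide_eq)
    have "(c - b) * B + (b - a) * A < A * (c - a)"
      using mult_strict_left_mono[OF \<open>B < A\<close>, of "c - b"] that by (simp add: algebra_simps)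
    then show "secant \<beta> a c < secant \<beta> a b" unfolding S A_def[symmetric] using that by (simp add: divide_less_eq)
  qed
  consider "w < v" | "w = v" | "u < v" "v < w" | "u = v" | "v < u" using u by linarith
  then show ?thesis
  proof cases
    case 1
    then show ?thesis using three(1)[of u w v] u by (simp add: s[of v])
  next
    case 2
    then show ?thesis using left[of u v] u by (simp add: secant_def[of \<beta> v v])
  next
    case 3
    then show ?thesis using three[of u v w] u by (simp add: s[of v u])
  next
    case 4
    then show ?thesis using right[of v w] u by (simp add: secant_def[of \<beta> v v])
  next
    case 5
    then show ?thesis using three(2)[of v u w] u v by simp
  qed
qed

text \<open>In squared variables, powers with exponent \<open>2 - 2 * H\<close> become powers with
  exponent \<open>1 - H\<close>, and the diagonal case of \<open>F_bar\<close> becomes the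
  derivative.\<close>

lemma F_bar_secant:
  assumes "0 < x" "0 < y"
  shows "F_bar H (x, y) = (H * Gamma (2 * H) * secant (1 - H) (y\<^sup>2) (x\<^sup>2), H * Gamma (2 * H) * y powr (- 2 * H))"
proof -
  have sq: "(z\<^sup>2) powr a = z powr (2 * a)" if "0 < z" for z a :: real
    using that by (simp add: powr_powr flip: powr_numeral)
  have "x\<^sup>2 = y\<^sup>2 \<longleftrightarrow> x = y" using assms by (simp add: power2_eq_iff)
  then show ?thesis
    using assms by (auto simp: F_bar_def secant_def sq algebra_simps)
qed

lemma moment_estimate_tendsto:
  fixes est :: "nat \<Rightarrow> real \<times> real"
  assumes H: "1 / 2 < H" "H < 1" and pos: "0 < \<theta>" "0 < \<rho>" "\<theta> \<noteq> \<rho>"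
    and q: "(\<lambda>n. (q1 n, q2 n)) \<longlonglongrightarrow> F_bar H (\<theta>, \<rho>)"
    and est: "\<forall>\<^sub>F n in sequentially. moment_estimate H (q1 n, q2 n) (est n)"
  shows "est \<longlonglongrightarrow> (\<theta>, \<rho>)"
proof -
  define c where "c = H * Gamma (2 * H)"
  have c: "0 < c" using H by (simp add: c_def Gamma_real_pos)
  let ?s = "\<lambda>x y. secant (1 - H) (y\<^sup>2) (x\<^sup>2)"
  have q1: "q1 \<longlonglongrightarrow> c * ?s \<theta> \<rho>" and q2: "q2 \<longlonglongrightarrow> c * \<rho> powr (- 2 * H)"
    using tendsto_fst[OF q] tendsto_snd[OF q] pos by (simp_all add: F_bar_secant c_def)
  \<comment> \<open>Inverts the second component, which involves the second coordinate only. The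
    formula is meaningful for positive \<open>q2 n\<close>, hence eventually.\<close>
  define y where "y n = (q2 n / c) powr (- (1 / (2 * H)))" for n
  have yl: "y \<longlonglongrightarrow> \<rho>"
  proof -
    have "(\<lambda>n. (q2 n / c) powr (- (1 / (2 * H)))) \<longlonglongrightarrow> (c * \<rho> powr (- 2 * H) / c) powr (- (1 / (2 * H)))"
      using c pos by (intro tendsto_intros q2) auto
    also have "(c * \<rho> powr (- 2 * H) / c) powr (- (1 / (2 * H))) = \<rho>"
      using c pos H by (simp add: powr_powr)
    finally show ?thesis by (simp add: y_def[abs_def])
  qed
  have q2_pos: "\<forall>\<^sub>F n in sequentially. 0 < q2 n"
    using order_tendstoD(1)[OF q2, of 0] c pos by simp
  have y_unique: "b = y n" if "c * b powr (- 2 * H) = q2 n" "0 < b" for b n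
    using that c H by (simp add: y_def powr_powr flip: that(1))
  have y_eq: "c * y n powr (- 2 * H) = q2 n" if "0 < q2 n" for n
    using that c H by (simp add: y_def powr_powr)
  \<comment> \<open>The interval of radius \<open>e\<close> around \<open>\<theta>\<close> avoids
    \<open>\<rho>\<close>, hence eventually \<open>y n\<close>. The diagonal is never met there, and
    continuity of the secant is that of an ordinary quotient.\<close>
  have near: "\<forall>\<^sub>F n in sequentially. \<exists>x. \<bar>x - \<theta>\<bar> \<le> e \<and> est n = (x, y n)"
    if e: "0 < e" "e < \<theta>" "e < \<bar>\<rho> - \<theta>\<bar>" for e
  proof -
    have ne: "\<theta> - e \<noteq> \<rho>" "\<theta> + e \<noteq> \<rho>" using e by auto
    have cont: "(\<lambda>n. c * ?s x (y n)) \<longlonglongrightarrow> c * ?s x \<rho>" if "0 < x" "x \<noteq> \<rho>" for x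
    proof -
      have sq: "x\<^sup>2 \<noteq> \<rho>\<^sup>2" using that pos by (simp add: power2_eq_iff)
      have y2: "(\<lambda>n. (y n)\<^sup>2) \<longlonglongrightarrow> \<rho>\<^sup>2" by (intro tendsto_intros yl)
      have "\<forall>\<^sub>F n in sequentially. (y n)\<^sup>2 \<noteq> x\<^sup>2" using tendsto_imp_eventually_ne[OF y2, of "x\<^sup>2"] sq by simp
      then have ev: "\<forall>\<^sub>F n in sequentially. c * (((y n)\<^sup>2 powr (1 - H) - x\<^sup>2 powr (1 - H)) / ((y n)\<^sup>2 - x\<^sup>2)) = c * ?s x (y n)"
        by eventually_elim (auto simp: secant_def)
      have "(\<lambda>n. c * (((y n)\<^sup>2 powr (1 - H) - x\<^sup>2 powr (1 - H)) / ((y n)\<^sup>2 - x\<^sup>2))) \<longlonglongrightarrow> c * ?s x \<rho>"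
        using sq pos unfolding secant_def by (auto intro!: tendsto_eq_intros yl)
      then show ?thesis using ev by (rule Lim_transform_eventually)
    qed
    have mono: "?s b v < ?s a v" if "0 < a" "a < b" "0 < v" for a b v
      using that H by (intro secant_strict_decreasing) (auto intro!: power_strict_mono)
    have "(\<lambda>n. c * ?s (\<theta> - e) (y n) - q1 n) \<longlonglongrightarrow> c * ?s (\<theta> - e) \<rho> - c * ?s \<theta> \<rho>"
      using e ne by (intro tendsto_diff cont q1) auto
    moreover have "0 < c * ?s (\<theta> - e) \<rho> - c * ?s \<theta> \<rho>" using mono[of "\<theta> - e" \<theta> \<rho>] c e pos by simp
    ultimately have lo: "\<forall>\<^sub>F n in sequentially. 0 < c * ?s (\<theta> - e) (y n) - q1 n" by (rule order_tendstoD(1))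
    have "(\<lambda>n. q1 n - c * ?s (\<theta> + e) (y n)) \<longlonglongrightarrow> c * ?s \<theta> \<rho> - c * ?s (\<theta> + e) \<rho>"
      using e ne pos by (intro tendsto_diff cont q1) auto
    moreover have "0 < c * ?s \<theta> \<rho> - c * ?s (\<theta> + e) \<rho>" using mono[of \<theta> "\<theta> + e" \<rho>] c e pos by simp
    ultimately have hi: "\<forall>\<^sub>F n in sequentially. 0 < q1 n - c * ?s (\<theta> + e) (y n)" by (rule order_tendstoD(1))
    have "(\<lambda>n. \<bar>y n - \<theta>\<bar>) \<longlonglongrightarrow> \<bar>\<rho> - \<theta>\<bar>" by (intro tendsto_intros yl)
    then have away: "\<forall>\<^sub>F n in sequentially. e < \<bar>y n - \<theta>\<bar>"
      by (rule order_tendstoD(1)) (rule e(3))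
    have ypos: "\<forall>\<^sub>F n in sequentially. 0 < y n" using order_tendstoD(1)[OF yl] pos by simp
    show ?thesis
      using lo hi away ypos q2_pos est
    proof eventually_elim
      case (elim n)
      have sq: "x\<^sup>2 \<noteq> (y n)\<^sup>2" if "\<theta> - e \<le> x" "x \<le> \<theta> + e" for x
        using that elim(3,4) e by (auto simp: power2_eq_iff)
      have "continuous_on {\<theta> - e..\<theta> + e} (\<lambda>x. ((y n)\<^sup>2 powr (1 - H) - x\<^sup>2 powr (1 - H)) / ((y n)\<^sup>2 - x\<^sup>2))"
        using sq e by (intro continuous_intros) (auto dest: sym)
      then have "continuous_on {\<theta> - e..\<theta> + e} (\<lambda>x. ?s x (y n))"
        by (rule continuous_on_eq) (use sq in \<open>auto simp: secant_def\<close>)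
      then obtain x where x: "\<theta> - e \<le> x" "x \<le> \<theta> + e" "?s x (y n) = q1 n / c"
        using IVT2'[of "\<lambda>x. ?s x (y n)" "\<theta> + e" "q1 n / c" "\<theta> - e"] elim(1,2) c e by (auto simp: field_simps)
      have "moment_solution H (q1 n, q2 n) (x, y n)"
        using x e elim c y_eq[OF elim(5)] by (simp add: moment_solution_def F_bar_secant c_def[symmetric])
      \<comment> \<open>Existence, just obtained, excludes the arbitrary default: the given estimate
        must itself be a solution.\<close>
      then have sol: "moment_solution H (q1 n, q2 n) (est n)"
        using elim(6) by (auto simp: moment_estimate_def)
      obtain a b where ab: "est n = (a, b)" by (cases "est n")
      have ab_pos: "0 < a" "0 < b" and eqs: "c * ?s a b = q1 n" "c * b powr (- 2 * H) = q2 n"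
        using sol by (auto simp: ab moment_solution_def F_bar_secant c_def)
      have b: "b = y n" by (rule y_unique[OF eqs(2) ab_pos(2)])
      have "c * ?s a (y n) = c * ?s x (y n)" using eqs(1) x(3) c by (simp add: b)
      then have "?s a (y n) = ?s x (y n)" by (rule mult_left_cancel[THEN iffD1, rotated]) (use c in simp)
      \<comment> \<open>The estimate could a priori lie anywhere on the positive axis; strict
        monotonicity identifies it with the solution found near \<open>\<theta>\<close>.\<close>
      then have "a = x"
        using mono[of a x "y n"] mono[of x a "y n"] ab_pos elim(4) x e by (cases a x rule: linorder_cases) auto
      then show ?case using x ab b by (auto simp: abs_le_iff)
    qed
  qed
  have "(\<lambda>n. fst (est n)) \<longlonglongrightarrow> \<theta>"
  proof (rule tendstoI)
    fix r :: real assume "0 < r"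
    define e where "e = min (r / 2) (min (\<theta> / 2) (\<bar>\<rho> - \<theta>\<bar> / 2))"
    have "0 < e" "e < \<theta>" "e < \<bar>\<rho> - \<theta>\<bar>" "e < r" using \<open>0 < r\<close> pos by (auto simp: e_def min_less_iff_disj)
    from near[OF this(1-3)] show "\<forall>\<^sub>F n in sequentially. dist (fst (est n)) \<theta> < r"
      by eventually_elim (use \<open>e < r\<close> in \<open>auto simp: dist_real_def\<close>)
  qed
  moreover have "(\<lambda>n. snd (est n)) \<longlonglongrightarrow> \<rho>"
  proof (rule Lim_transform_eventually[OF yl])
    define e where "e = min (\<theta> / 2) (\<bar>\<rho> - \<theta>\<bar> / 2)"
    have "0 < e" "e < \<theta>" "e < \<bar>\<rho> - \<theta>\<bar>" using pos by (auto simp: e_def min_less_iff_disj)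
    from near[OF this] show "\<forall>\<^sub>F n in sequentially. y n = snd (est n)"
      by eventually_elim auto
  qed
  ultimately show ?thesis using tendsto_Pair by fastforce
qed

section \<open>Limits of the two empirical second moments\<close>

lemma kernel_quad_mean_AE_tendsto:
  assumes M: "prob_space M" and B: "fractional_brownian_motion M H B" and H: "1 / 2 < H" "H < 1"
    and k: "cubic_integrable k" and meas: "\<And>t. 0 \<le> t \<Longrightarrow> Z t \<in> borel_measurable M"
    and Z: "AE \<omega> in M. continuous_on {0..} (\<lambda>t. Z t \<omega>) \<and>
      (\<forall>t\<ge>0. Z t \<omega> = (LINT x|lborel. k x * (B t \<omega> - B (lookback t x) \<omega>)))"
    and D: "\<And>n. 1 \<le> n \<Longrightarrow> 0 < D n" "filterlim (\<lambda>n. real n * D n) at_top sequentially"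
  shows "AE \<omega> in M. (\<lambda>n. quad_mean n (D n) Z \<omega>) \<longlonglongrightarrow> double_integral k k (stationary_cov H)"
proof -
  have Z1: "AE \<omega> in M. continuous_on {0..} (\<lambda>t. Z t \<omega>)"
    and Z2: "AE \<omega> in M. \<forall>t\<ge>0. Z t \<omega> = (LINT x|lborel. k x * (B t \<omega> - B (lookback t x) \<omega>))"
    using Z by (auto elim: eventually_mono)
  interpret prob_space M by (rule M)
  interpret asymptotically_stationary_gaussian M Z "kernel_cov H k" "4 * (cubic_norm k)\<^sup>2" "2 - 2 * H" "2 * H"
    "double_integral k k (stationary_cov H)"
  proof
    show "gaussian_family M {0..} Z (kernel_cov H k)"
      using H by (intro kernel_gaussian_family[OF M B _ cubic_integrableD(3)[OF k] meas Z2]) auto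
    show "\<bar>kernel_cov H k t s\<bar> \<le> 4 * (cubic_norm k)\<^sup>2 * (1 + \<bar>t - s\<bar>) powr - (2 - 2 * H)" if "0 \<le> t" "0 \<le> s" for t s
      using kernel_cov_decay[OF M B H that k] by simp
    show "kernel_cov H k t t - kernel_cov H k t s - kernel_cov H k s t + kernel_cov H k s s
        \<le> 4 * (cubic_norm k)\<^sup>2 * \<bar>t - s\<bar> powr (2 * H)" if "0 \<le> t" "0 \<le> s" for t s
      by (rule kernel_cov_increment[OF M B H that k])
    show "((\<lambda>t. kernel_cov H k t t) \<longlongrightarrow> double_integral k k (stationary_cov H)) at_top"
      by (rule kernel_cov_diagonal_tendsto[OF M B H k])
  qed (use H Z1 in auto)
  show ?thesis using D by (rule quad_mean_AE_tendsto)
qed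

lemma stationary_cov_measurable: "case_prod (stationary_cov H) \<in> borel_measurable (borel \<Otimes>\<^sub>M borel)"
  unfolding stationary_cov_def by measurable

lemma stationary_cov_bound:
  assumes "0 < H" "H < 1"
  shows "\<bar>stationary_cov H x y\<bar> \<le> 2 * ((1 + \<bar>x\<bar>) ^ 3 * (1 + \<bar>y\<bar>) ^ 3)"
proof -
  have tri: "1 + \<bar>x\<bar> + \<bar>y\<bar> \<le> (1 + \<bar>x\<bar>) * (1 + \<bar>y\<bar>)" by (simp add: algebra_simps)
  have *: "\<bar>z powr (2 * H)\<bar> \<le> 1 * ((1 + \<bar>x\<bar>) ^ 3 * (1 + \<bar>y\<bar>) ^ 3)" if "0 \<le> z" "z \<le> \<bar>x\<bar> + \<bar>y\<bar>" for z
    using that assms by (intro powr_le_cubic order_trans[OF _ tri]) auto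
  have comb: "\<bar>(u + v - w) / 2\<bar> \<le> 2 * G" if "\<bar>u\<bar> \<le> 1 * G" "\<bar>v\<bar> \<le> 1 * G" "\<bar>w\<bar> \<le> 1 * G" for u v w G :: real
  proof -
    have "\<bar>u + v - w\<bar> \<le> 3 * G" "0 \<le> G" using that by linarith+
    then show ?thesis by simp
  qed
  have "max 0 x \<le> \<bar>x\<bar> + \<bar>y\<bar>" "max 0 y \<le> \<bar>x\<bar> + \<bar>y\<bar>" "\<bar>max 0 x - max 0 y\<bar> \<le> \<bar>x\<bar> + \<bar>y\<bar>"
    by linarith+
  then show ?thesis unfolding stationary_cov_def
    by (intro comb[OF *[of "max 0 x"] *[of "max 0 y"] *[of "\<bar>max 0 x - max 0 y\<bar>"]]) simp_all
qed

lemma stationary_variance_exponential: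
  assumes "0 < \<rho>" "0 < H" "H < 1"
  shows "double_integral (exponential_density \<rho>) (exponential_density \<rho>) (stationary_cov H) = H * Gamma (2 * H) * \<rho> powr (- 2 * H)"
proof -
  have "(t + t) / (\<rho> + \<rho>) = t / \<rho>" for t using assms by (simp add: field_simps)
  moreover have "\<rho> powr (1 - 2 * H) = \<rho> * \<rho> powr (- 2 * H)"
    using powr_mult_base[of \<rho> "- 2 * H"] assms by simp
  ultimately have "(\<rho> powr (1 - 2 * H) + \<rho> powr (1 - 2 * H)) / (\<rho> + \<rho>) = \<rho> powr (- 2 * H)"
    using assms by simp
  then show ?thesis using double_integral_exponential_stationary_cov[OF assms(1,1,2,3)] by simp
qed

lemma stationary_variance_cascade:
  assumes pos: "0 < \<theta>" "0 < \<rho>" "\<theta> \<noteq> \<rho>" and H: "0 < H" "H < 1"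
  shows "double_integral (cascade_kernel \<theta> \<rho>) (cascade_kernel \<theta> \<rho>) (stationary_cov H)
    = H * Gamma (2 * H) * ((\<rho> powr (2 - 2 * H) - \<theta> powr (2 - 2 * H)) / (\<rho>\<^sup>2 - \<theta>\<^sup>2))"
proof -
  let ?e\<rho> = "exponential_density \<rho>" and ?e\<theta> = "exponential_density \<theta>"
  let ?S = "stationary_cov H"
  define p q where "p = \<rho> / (\<rho> - \<theta>)" and "q = - \<theta> / (\<rho> - \<theta>)"
  define a b where "a = \<rho> powr (1 - 2 * H)" and "b = \<theta> powr (1 - 2 * H)"
  define c where "c = H * Gamma (2 * H)"
  note e\<rho> = cubic_integrable_exponential[OF pos(2)] and e\<theta> = cubic_integrable_exponential[OF pos(1)]
  note S = stationary_cov_measurable[of H] stationary_cov_bound[OF H]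
  have K: "cascade_kernel \<theta> \<rho> = (\<lambda>x. p * ?e\<rho> x + q * ?e\<theta> x)"
    by (simp add: fun_eq_iff cascade_kernel_def p_def q_def)
  have "double_integral (cascade_kernel \<theta> \<rho>) (cascade_kernel \<theta> \<rho>) ?S
    = p * (p * double_integral ?e\<rho> ?e\<rho> ?S + q * double_integral ?e\<rho> ?e\<theta> ?S)
      + q * (p * double_integral ?e\<theta> ?e\<rho> ?S + q * double_integral ?e\<theta> ?e\<theta> ?S)"
    unfolding K double_integral_left_comb[OF e\<rho> e\<theta> cubic_integrable_comb[OF e\<rho> e\<theta>] S]
      double_integral_right_comb[OF e\<rho> e\<rho> e\<theta> S] double_integral_right_comb[OF e\<theta> e\<rho> e\<theta> S] ..
  also have "\<dots> = c * (p * (p * ((a + a) / (\<rho> + \<rho>)) + q * ((a + b) / (\<rho> + \<theta>)))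
      + q * (p * ((b + a) / (\<theta> + \<rho>)) + q * ((b + b) / (\<theta> + \<theta>))))"
    using pos H by (simp add: double_integral_exponential_stationary_cov a_def b_def c_def algebra_simps)
  also have "p * (p * ((a + a) / (\<rho> + \<rho>)) + q * ((a + b) / (\<rho> + \<theta>)))
      + q * (p * ((b + a) / (\<theta> + \<rho>)) + q * ((b + b) / (\<theta> + \<theta>))) = (\<rho> * a - \<theta> * b) / (\<rho>\<^sup>2 - \<theta>\<^sup>2)"
  proof -
    \<comment> \<open>The normalisation of the kernel contributes \<open>d\<close> twice to the
      denominator; the numerator factors as \<open>(\<rho> * a - \<theta> * b) * d\<close>, so one
      factor cancels and \<open>d * s\<close> remains.\<close>
    define d s where "d = \<rho> - \<theta>" and "s = \<rho> + \<theta>"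
    have ds: "d \<noteq> 0" "s \<noteq> 0" "\<rho> \<noteq> 0" "\<theta> \<noteq> 0" using pos by (auto simp: d_def s_def)
    have "p * (p * ((a + a) / (\<rho> + \<rho>)) + q * ((a + b) / (\<rho> + \<theta>)))
      + q * (p * ((b + a) / (\<theta> + \<rho>)) + q * ((b + b) / (\<theta> + \<theta>)))
      = (\<rho> * a * s - 2 * \<rho> * \<theta> * (a + b) + \<theta> * b * s) / (d * d * s)"
    proof -
      have "(a + a) / (\<rho> + \<rho>) = a / \<rho>" "(b + b) / (\<theta> + \<theta>) = b / \<theta>" "\<theta> + \<rho> = s" "b + a = a + b"
        using ds by (auto simp: s_def field_simps)
      then show ?thesis
        unfolding p_def q_def d_def[symmetric] s_def[symmetric] using ds by (simp add: field_simps)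
    qed
    also have "\<rho> * a * s - 2 * \<rho> * \<theta> * (a + b) + \<theta> * b * s = (\<rho> * a - \<theta> * b) * d"
      by (simp add: d_def s_def algebra_simps)
    also have "(\<rho> * a - \<theta> * b) * d / (d * d * s) = (\<rho> * a - \<theta> * b) / (d * s)" using ds by simp
    also have "d * s = \<rho>\<^sup>2 - \<theta>\<^sup>2" by (simp add: d_def s_def power2_eq_square algebra_simps)
    finally show ?thesis .
  qed
  also have "\<rho> * a - \<theta> * b = \<rho> powr (2 - 2 * H) - \<theta> powr (2 - 2 * H)"
    using pos powr_mult_base[of \<rho> "1 - 2 * H"] powr_mult_base[of \<theta> "1 - 2 * H"] by (auto simp: a_def b_def)
  finally show ?thesis by (simp add: c_def)
qed

theorem theorem19:
  fixes M :: "'a measure"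
    and H \<theta> \<rho> \<alpha> :: real
    and B V X :: "real \<Rightarrow> 'a \<Rightarrow> real"
    and \<Delta> :: "nat \<Rightarrow> real"
    and est :: "nat \<Rightarrow> 'a \<Rightarrow> real \<times> real"
  assumes "prob_space M"
    and "1 / 2 < H" and "H < 1"
    and "0 < \<theta>" and "0 < \<rho>" and "\<theta> \<noteq> \<rho>"
    and "fractional_brownian_motion M H B"
    and "langevin_solution M \<rho> B V"
    and "langevin_solution M \<theta> V X"
    and "\<And>n. 1 \<le> n \<Longrightarrow> 0 < \<Delta> n"
    and "filterlim (\<lambda>n. real n * \<Delta> n) at_top sequentially"
    and "\<alpha> < 1 / H"
    and "\<And>n. 1 \<le> n \<Longrightarrow> \<Delta> n \<le> real n powr \<alpha>"
    and "\<And>n \<omega>. 1 \<le> n \<Longrightarrow> \<omega> \<in> space M \<Longrightarrow>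
           moment_estimate H (quad_mean n (\<Delta> n) X \<omega>, quad_mean n (\<Delta> n) V \<omega>) (est n \<omega>)"
  shows "AE \<omega> in M. (\<lambda>n. est n \<omega>) \<longlonglongrightarrow> (\<theta>, \<rho>)"
proof -
  note M = assms(1) and H = assms(2,3) and pos = assms(4-6) and B = assms(7) and D = assms(10,11)
  have H0: "0 < H" using H by simp
  have V_meas: "V t \<in> borel_measurable M" and X_meas: "X t \<in> borel_measurable M" if "0 \<le> t" for t
    using assms(8,9) that by (auto simp: langevin_solution_def)
  have cascade: "cubic_integrable (cascade_kernel \<theta> \<rho>)"
    unfolding cascade_kernel_def[abs_def]
    by (intro cubic_integrable_comb cubic_integrable_exponential pos)
  have QV: "AE \<omega> in M. (\<lambda>n. quad_mean n (\<Delta> n) V \<omega>) \<longlonglongrightarrow> H * Gamma (2 * H) * \<rho> powr (- 2 * H)"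
    using kernel_quad_mean_AE_tendsto[OF M B H cubic_integrable_exponential[OF pos(2)] V_meas
        langevin_solution_kernel[OF B pos(2) assms(8)] D]
    unfolding stationary_variance_exponential[OF pos(2) H0 H(2)] .
  have QX: "AE \<omega> in M. (\<lambda>n. quad_mean n (\<Delta> n) X \<omega>) \<longlonglongrightarrow>
      H * Gamma (2 * H) * ((\<rho> powr (2 - 2 * H) - \<theta> powr (2 - 2 * H)) / (\<rho>\<^sup>2 - \<theta>\<^sup>2))"
    using kernel_quad_mean_AE_tendsto[OF M B H cascade X_meas langevin_cascade_kernel[OF B pos assms(8,9)] D]
    unfolding stationary_variance_cascade[OF pos H0 H(2)] .
  have F: "F_bar H (\<theta>, \<rho>) = (H * Gamma (2 * H) * ((\<rho> powr (2 - 2 * H) - \<theta> powr (2 - 2 * H)) / (\<rho>\<^sup>2 - \<theta>\<^sup>2)),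
      H * Gamma (2 * H) * \<rho> powr (- 2 * H))"
    using pos by (simp add: F_bar_def)
  \<comment> \<open>Outside a null set both second moments converge along the path, and the
    deterministic convergence result applies to it.\<close>
  show ?thesis
    using QV QX AE_space
  proof eventually_elim
    case (elim \<omega>)
    have "\<forall>\<^sub>F n in sequentially. moment_estimate H (quad_mean n (\<Delta> n) X \<omega>, quad_mean n (\<Delta> n) V \<omega>) (est n \<omega>)"
      using eventually_ge_at_top[of 1] by eventually_elim (rule assms(14)[OF _ elim(3)])
    moreover have "(\<lambda>n. (quad_mean n (\<Delta> n) X \<omega>, quad_mean n (\<Delta> n) V \<omega>)) \<longlonglongrightarrow> F_bar H (\<theta>, \<rho>)"
      unfolding F by (intro tendsto_Pair elim)
    ultimately show ?case by (intro moment_estimate_tendsto[OF H pos])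
  qed
qed

end
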